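(* Let $M>4$, $\alpha>5$ be fixed and suppose $\epsilon_i^{(j)}$, $i=1,\dots,n$, $j=1,\dots,m$, are $(M,\alpha)$-short range dependent random variables. Let $\mathcal{K}=k(n,m)$ be an integer with $\mathcal{K}\to\infty$, $\mathcal{K}/n\to0$ and $\mathcal{K}/m\to 0$ as $\min(n,m)\to\infty$, let $V=V(n,m)$ be a positive integer, and for $v=1,\dots,V$ let $x_v,y_v$ be integers with $\mathcal{K}+1\le x_v\le n-\mathcal{K}$ and $\mathcal{K}+1\le y_v\le m-\mathcal{K}$. Let $a_{i,v}^{(j)}$, $i=1,\dots,n$, $j=1,\dots,m$, $v=1,\dots,V$, be real numbers for which there is a fixed constant $C>0$ (independent of $n,m$) such that: (1) $\sum_{i=1}^n\sum_{j=1}^m (a_{i,v}^{(j)})^2>0$ for all $v$; (2) there exist real numbers $\lambda_{i,v},\tau_{j,v}\ge0$ with $\frac{|a_{i,v}^{(j)}|}{\sqrt{\sum_{i=1}^n\sum_{j=1}^m (a_{i,v}^{(j)})^2}}\le\lambda_{i,v}\tau_{j,v}$ for all $i,j,v$, and $\sum_{i=1}^n\lambda_{i,v}^2\le C$, $\sum_{j=1}^m\tau_{j,v}^2\le C$, $|\lambda_{i,v}|\le C/\sqrt{\mathcal{K}}$, $|\tau_{j,v}|\le C/\sqrt{\mathcal{K}}$; (3) $a_{i,v}^{(j)}=0$ if $|i-x_v|>\mathcal{K}$ or $|j-y_v|>\mathcal{K}$. Let $K(\cdot)$ be a variance kernel function and let $\mathcal{B}=\mathcal{B}(n,m)$ be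 a bandwidth satisfying $\mathcal{B}\to\infty$ and $\frac{V^{4/M}\mathcal{B}^3}{\mathcal{K}}\to0$ as $\min(n,m)\to\infty$. Put $c_{i,v}^{(j)}=a_{i,v}^{(j)}\big/\sqrt{\sum_{i=1}^n\sum_{j=1}^m (a_{i,v}^{(j)})^2}$. Then $$\Big\Vert\max_{v_1,v_2=1,\dots,V}\Big|\sum_{i_1=1}^n\sum_{j_1=1}^m\sum_{i_2=1}^n\sum_{j_2=1}^m c_{i_1,v_1}^{(j_1)}c_{i_2,v_2}^{(j_2)}\epsilon_{i_1}^{(j_1)}\epsilon_{i_2}^{(j_2)}K\Big(\frac{i_1-i_2}{\mathcal{B}}\Big)K\Big(\frac{j_1-j_2}{\mathcal{B}}\Big)-Cov\Big(\sum_{i_1=1}^n\sum_{j_1=1}^m c_{i_1,v_1}^{(j_1)}\epsilon_{i_1}^{(j_1)},\sum_{i_2=1}^n\sum_{j_2=1}^m c_{i_2,v_2}^{(j_2)}\epsilon_{i_2}^{(j_2)}\Big)\Big|\Big\Vert_{M/2}=O\Big(S(\mathcal{B})+\frac{V^{4/M}\mathcal{B}^3}{\mathcal{K}}\Big),$$ where $S(\mathcal{B})=\mathcal{B}^{5-\alpha}$ if $5<\alpha<6$; $S(\mathcal{B})=\log(\mathcal{B})/\mathcal{B}$ if $\alpha=6$; and $S(\mathcal{B})=1/\mathcal{B}$ if $\alpha>6$.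
   Context: Notation: $\Vert X\Vert_r=(\mathbf{E}|X|^r)^{1/r}$. All quantities ($\mathcal{K}$, $\mathcal{B}$, $V$, $x_v$, $y_v$, $a_{i,v}^{(j)}$, $\epsilon_i^{(j)}$, ...) may depend on $(n,m)$; $O(\cdot)$ is as $\min(n,m)\to\infty$. Random field. Let $e_i^{(j)}$, $i,j\in\mathbf{Z}$, be independent (not necessarily identically distributed) random variables. For positive integers $n,m$ and $1\le i\le n$, $1\le j\le m$, let $\epsilon_i^{(j)}=G_{i,n}^{(j),m}(e_{i-u}^{(j-v)};\,u,v\in\mathbf{Z})$ for a measurable function $G_{i,n}^{(j),m}$ (so $\epsilon_i^{(j)}$ may depend on $n,m$; this is suppressed in the notation). Dependence measure. Let $e_i^{(j)\dagger}$, $i,j\in\mathbf{Z}$, be independent random variables, independent of all $e_p^{(q)}$, with $e_i^{(j)\dagger}$ having the same distribution as $e_i^{(j)}$. For $p,q\in\mathbf{Z}$ let $\epsilon_{i,p}^{(j),(q)}$ be obtained from $\epsilon_i^{(j)}=G_{i,n}^{(j),m}(\cdot)$ by replacing the single innovation $e_{i+p}^{(j+q)}$ by $e_{i+p}^{(j+q)\dagger}$. Put $\delta_p^{(q)}=\max_{1\le i\le n,\,1\le j\le m}\Vert\epsilon_i^{(j)}-\epsilon_{i,p}^{(j),(q)}\Vert_M$. Definition. $\epsilon_i^{(j)}$ is called $(M,\alpha)$-short range dependent if $\epsilon_i^{(j)}=G_{i,n}^{(j),m}(e_{i-u}^{(j-v)};\,u,v\in\mathbf{Z})$ for all $1\le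 i\le n$, $1\le j\le m$, with independent random variables $e_i^{(j)}$, $i,j\in\mathbf{Z}$, and measurable functions $G_{i,n}^{(j),m}$, and $\mathbf{E}\epsilon_i^{(j)}=0$ for all $i,j$, $\max_{1\le i\le n,1\le j\le m}\Vert\epsilon_i^{(j)}\Vert_M=O(1)$, and $\sup_{p,q\in\mathbf{Z}}(1+|p|+|q|)^\alpha\delta_p^{(q)}=O(1)$, where $O(1)$ means bounded by a constant not depending on $n,m$. Variance kernel function. A function $K:\mathbf{R}\to[0,1]$ is a variance kernel function if it is symmetric, continuously differentiable, $K(0)=1$, $K$ is decreasing on $[0,\infty)$, its Fourier transform $\mathcal{F}K(x)=\int_{\mathbf{R}}K(t)\exp(-2\pi\mathrm{i}tx)\,\mathrm{d}t$ satisfies $\mathcal{F}K(x)\ge0$ for all $x\in\mathbf{R}$, $\int_0^\infty K^2(x)\,dx<\infty$, and $\int_0^\infty xK(x)\,dx<\infty$. *)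

theory Defs
  imports "HOL-Probability.Probability"
begin

text \<open>The asymptotic regime min(n,m) \<open>\<rightarrow>\<close> infinity.\<close>

definition grid_at_top :: "(nat \<times> nat) filter" where
  "grid_at_top = filtercomap (\<lambda>(n, m). min n m) at_top"

text \<open>
  The norm (E |X|^r)^(1/r), for r > 0. It takes values in the extended nonnegative reals, so that
  an upper bound by a real number includes the finiteness of the r-th absolute moment.
\<close>

definition Lr_norm :: "'w measure \<Rightarrow> real \<Rightarrow> ('w \<Rightarrow> real) \<Rightarrow> ennreal" where
  "Lr_norm P r X =
     (let I = (\<integral>\<^sup>+ \<omega>. ennreal (\<bar>X \<omega>\<bar> powr r) \<partial>P)
      in if I = \<infinity> then \<infinity> else ennreal (enn2real I powr (1 / r)))"

definition covariance :: "'w measure \<Rightarrow> ('w \<Rightarrow> real) \<Rightarrow> ('w \<Rightarrow> real) \<Rightarrow> real" where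
  "covariance P X Y =
     (\<integral>\<omega>. (X \<omega> - (\<integral>\<omega>'. X \<omega>' \<partial>P)) * (Y \<omega> - (\<integral>\<omega>'. Y \<omega>' \<partial>P)) \<partial>P)"

text \<open>The lower index comes first: \<open>z (i, j)\<close> stands for $z_i^{(j)}$.\<close>

type_synonym field_config = "int \<times> int \<Rightarrow> real"

definition seen_from :: "int \<Rightarrow> int \<Rightarrow> field_config \<Rightarrow> field_config" where
  "seen_from i j z = (\<lambda>(u, v). z (i - u, j - v))"

text \<open>
  An independent copy of the innovations always exists after enlarging the probability space: on
  the product of P with itself, the innovations are \<open>(\<omega>, \<omega>') \<mapsto> e k \<omega>\<close> and their independent
  copies are \<open>(\<omega>, \<omega>') \<mapsto> e k \<omega>'\<close>. The dependence measure below depends only on the joint law of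
  the innovations and their copies, hence not on the choice of this realisation.
\<close>

definition dependence_measure ::
  "'w measure \<Rightarrow> real \<Rightarrow> (int \<times> int \<Rightarrow> 'w \<Rightarrow> real) \<Rightarrow> (int \<Rightarrow> int \<Rightarrow> field_config \<Rightarrow> real) \<Rightarrow>
   nat \<Rightarrow> nat \<Rightarrow> int \<Rightarrow> int \<Rightarrow> ennreal" where
  "dependence_measure P M e G n m p q =
     (MAX (i, j) \<in> {1..int n} \<times> {1..int m}.
        Lr_norm (P \<Otimes>\<^sub>M P) M
          (\<lambda>(\<omega>, \<omega>'). G i j (seen_from i j (\<lambda>k. e k \<omega>))
                   - G i j (seen_from i j ((\<lambda>k. e k \<omega>)((i + p, j + q) := e (i + p, j + q) \<omega>')))))"

text \<open>
  \<open>\<epsilon> n m i j\<close> is the random field at site (i, j) of the n by m grid. Integrability is listed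
  because the Bochner integral of a non-integrable function is 0.
\<close>

definition short_range_dependent ::
  "'w measure \<Rightarrow> real \<Rightarrow> real \<Rightarrow> (nat \<Rightarrow> nat \<Rightarrow> int \<Rightarrow> int \<Rightarrow> 'w \<Rightarrow> real) \<Rightarrow> bool" where
  "short_range_dependent P M \<alpha> \<epsilon> \<longleftrightarrow>
     (\<exists>e G.
        prob_space.indep_vars P (\<lambda>_. borel) e UNIV \<and>
        (\<forall>n\<ge>1. \<forall>m\<ge>1. \<forall>i\<in>{1..int n}. \<forall>j\<in>{1..int m}.
           G n m i j \<in> borel_measurable (\<Pi>\<^sub>M k\<in>UNIV. borel) \<and>
           (\<forall>\<omega>\<in>space P. \<epsilon> n m i j \<omega> = G n m i j (seen_from i j (\<lambda>k. e k \<omega>))) \<and>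
           integrable P (\<epsilon> n m i j) \<and> (\<integral>\<omega>. \<epsilon> n m i j \<omega> \<partial>P) = 0) \<and>
        (\<exists>C::real. \<forall>\<^sub>F (n, m) in grid_at_top.
           (MAX (i, j) \<in> {1..int n} \<times> {1..int m}. Lr_norm P M (\<epsilon> n m i j)) \<le> ennreal C) \<and>
        (\<exists>C::real. \<forall>\<^sub>F (n, m) in grid_at_top.
           (SUP (p, q) \<in> UNIV. ennreal ((1 + \<bar>real_of_int p\<bar> + \<bar>real_of_int q\<bar>) powr \<alpha>)
              * dependence_measure P M e (G n m) n m p q) \<le> ennreal C))"

definition fourier :: "(real \<Rightarrow> real) \<Rightarrow> real \<Rightarrow> complex" where
  "fourier K x = (\<integral>t. complex_of_real (K t) * exp (- 2 * of_real pi * \<i> * of_real t * of_real x) \<partial>lborel)"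

definition variance_kernel :: "(real \<Rightarrow> real) \<Rightarrow> bool" where
  "variance_kernel K \<longleftrightarrow>
     (\<forall>x. K x \<in> {0..1}) \<and>
     (\<forall>x. K (- x) = K x) \<and>
     K C1_differentiable_on UNIV \<and>
     K 0 = 1 \<and>
     antimono_on {0..} K \<and>
     (\<forall>x. fourier K x \<in> \<real>\<^sub>\<ge>\<^sub>0) \<and>
     set_integrable lborel {0..} (\<lambda>x. (K x)\<^sup>2) \<and>
     set_integrable lborel {0..} (\<lambda>x. x * K x)"

definition weight_norm :: "nat \<Rightarrow> nat \<Rightarrow> (int \<Rightarrow> int \<Rightarrow> real) \<Rightarrow> real" where
  "weight_norm n m a = sqrt (\<Sum>i\<in>{1..int n}. \<Sum>j\<in>{1..int m}. (a i j)\<^sup>2)"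

definition normalized :: "nat \<Rightarrow> nat \<Rightarrow> (int \<Rightarrow> int \<Rightarrow> real) \<Rightarrow> int \<Rightarrow> int \<Rightarrow> real" where
  "normalized n m a i j = a i j / weight_norm n m a"

definition weighted_sum ::
  "nat \<Rightarrow> nat \<Rightarrow> (int \<Rightarrow> int \<Rightarrow> real) \<Rightarrow> (int \<Rightarrow> int \<Rightarrow> 'w \<Rightarrow> real) \<Rightarrow> 'w \<Rightarrow> real" where
  "weighted_sum n m c \<epsilon> \<omega> = (\<Sum>i\<in>{1..int n}. \<Sum>j\<in>{1..int m}. c i j * \<epsilon> i j \<omega>)"

definition cov_estimator ::
  "nat \<Rightarrow> nat \<Rightarrow> (real \<Rightarrow> real) \<Rightarrow> real \<Rightarrow> (int \<Rightarrow> int \<Rightarrow> real) \<Rightarrow> (int \<Rightarrow> int \<Rightarrow> real) \<Rightarrow>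
   (int \<Rightarrow> int \<Rightarrow> 'w \<Rightarrow> real) \<Rightarrow> 'w \<Rightarrow> real" where
  "cov_estimator n m K B c c' \<epsilon> \<omega> =
     (\<Sum>i\<^sub>1\<in>{1..int n}. \<Sum>j\<^sub>1\<in>{1..int m}. \<Sum>i\<^sub>2\<in>{1..int n}. \<Sum>j\<^sub>2\<in>{1..int m}.
        c i\<^sub>1 j\<^sub>1 * c' i\<^sub>2 j\<^sub>2 * \<epsilon> i\<^sub>1 j\<^sub>1 \<omega> * \<epsilon> i\<^sub>2 j\<^sub>2 \<omega>
          * K (real_of_int (i\<^sub>1 - i\<^sub>2) / B) * K (real_of_int (j\<^sub>1 - j\<^sub>2) / B))"

text \<open>Only used for \<open>\<alpha> > 5\<close>.\<close>

definition bias_rate :: "real \<Rightarrow> real \<Rightarrow> real" where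
  "bias_rate \<alpha> B = (if \<alpha> < 6 then B powr (5 - \<alpha>) else if \<alpha> = 6 then ln B / B else 1 / B)"

end

theory Submission
  imports Defs
begin

text \<open>
  The estimator is a quadratic form in the field. Its error splits into the fluctuation around
  its own mean and the deterministic distance of that mean from the covariance. Write \<open>k\<close>
  for the size of the windows. The weights are at most \<open>C^2 / k\<close> and have sum of squares at most 1,
  and every row of the kernel matrix sums to \<open>O(B^2)\<close>.

  \<^emph>\<open>Fluctuation.\<close> Realise the innovations as the coordinates of a product space and reveal them one
  after the other. The increments of the conditional means are martingale differences, and the
  Lp norm of an increment is at most the change of the quadratic form when that coordinate is
  resampled. For \<open>p \<ge> 2\<close> the squares of the Lp norms of martingale differences add, apart from a constant
  factor (\<open>Lp_bound_martingale_step\<close>), so that the squared norm of the fluctuation is at most a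
  constant times the sum of the squared resampling effects (\<open>Lp_bound_centered\<close>). The quadratic form
  inherits the decay of the dependence measure through the product rule and the Cauchy--Schwarz
  inequality; this is where the M-th moments of the field turn into moments of order \<open>M/2\<close> of the
  estimator. With Schur's test for the sum over all innovations the fluctuation of one form is
  \<open>O(B^2 / k)\<close> (\<open>quadratic_form_concentration\<close>). The maximum over \<open>V^2\<close> forms costs the factor
  \<open>(V^2) powr (2/M) = V powr (4/M)\<close>.

  \<^emph>\<open>Bias.\<close> Martingale increments belonging to different innovations are uncorrelated, hence
  the covariance of two functions is at most the sum over the innovations of the products of their
  resampling effects (\<open>cov_le_sum_influences\<close>). For two sites of the field these effects decay
  around different centres, and the covariance inherits the exponent of their decay
  (\<open>cov_decay\<close>). A variance kernel satisfies \<open>1 - K x \<le> L * \<bar>x\<bar>\<close>, so the weight of a pair of sites at distance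
  \<open>h\<close> is off by at most \<open>L * h / B\<close>, and summing this against the covariances gives \<open>O(1 / B)\<close>
  (\<open>quadratic_form_bias\<close>). For large \<open>B\<close> the term \<open>1 / B\<close> is at most the bias rate \<open>S(B)\<close>, and
  \<open>B^2 / k\<close> is at most \<open>B^3 / k\<close>.

  The passage from finitely many revealed coordinates to all of them rests on the fact that a
  function in Lp changes little in Lp when only coordinates outside a large finite set are resampled
  (\<open>resampling_converges_Lp\<close>).
\<close>

section \<open>Bounds for norms of random variables\<close>

text \<open>
  The norm enters through an upper bound \<open>b\<close>, and the integral is an extended nonnegative one: then
  the bound implies integrability, and norm inequalities become implications without side
  conditions about the existence of moments.
\<close>
definition Lp_bound :: "'a measure \<Rightarrow> real \<Rightarrow> ('a \<Rightarrow> real) \<Rightarrow> real \<Rightarrow> bool" where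
  "Lp_bound M p f b \<longleftrightarrow> f \<in> borel_measurable M \<and> 0 \<le> b \<and>
     (\<integral>\<^sup>+x. ennreal (\<bar>f x\<bar> powr p) \<partial>M) \<le> ennreal (b powr p)"

lemma Lp_bound_nonneg: "Lp_bound M p f b \<Longrightarrow> 0 \<le> b"
  and Lp_bound_nn_integral:
    "Lp_bound M p f b \<Longrightarrow> (\<integral>\<^sup>+x. ennreal (\<bar>f x\<bar> powr p) \<partial>M) \<le> ennreal (b powr p)"
  by (auto simp: Lp_bound_def)

lemma Lp_bound_mono:
  assumes "Lp_bound M p f b" "b \<le> b'" "0 \<le> p"
  shows "Lp_bound M p f b'"
proof -
  have "b powr p \<le> b' powr p" using assms by (intro powr_mono2) (auto simp: Lp_bound_def)
  with assms show ?thesis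
    by (auto simp: Lp_bound_def intro: order_trans ennreal_leI)
qed

lemma Lp_bound_cmult:
  assumes "Lp_bound M p f b" shows "Lp_bound M p (\<lambda>x. c * f x) (\<bar>c\<bar> * b)"
proof -
  have [measurable]: "f \<in> borel_measurable M" using assms by (simp add: Lp_bound_def)
  have "(\<integral>\<^sup>+x. ennreal (\<bar>c * f x\<bar> powr p) \<partial>M)
      = (\<integral>\<^sup>+x. ennreal (\<bar>c\<bar> powr p) * ennreal (\<bar>f x\<bar> powr p) \<partial>M)"
    by (intro nn_integral_cong) (simp add: abs_mult powr_mult ennreal_mult)
  also have "\<dots> = ennreal (\<bar>c\<bar> powr p) * (\<integral>\<^sup>+x. ennreal (\<bar>f x\<bar> powr p) \<partial>M)"
    by (rule nn_integral_cmult) measurable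
  also have "\<dots> \<le> ennreal (\<bar>c\<bar> powr p) * ennreal (b powr p)"
    using assms by (intro mult_left_mono) (auto simp: Lp_bound_def)
  also have "\<dots> = ennreal ((\<bar>c\<bar> * b) powr p)"
    using assms by (simp add: powr_mult ennreal_mult Lp_bound_def)
  finally show ?thesis using assms by (auto simp: Lp_bound_def)
qed

lemma Lp_bound_distr:
  assumes [measurable]: "T \<in> measurable M N" "f \<in> borel_measurable N"
  shows "Lp_bound (distr M N T) p f b \<longleftrightarrow> Lp_bound M p (\<lambda>x. f (T x)) b"
proof -
  have "(\<integral>\<^sup>+x. ennreal (\<bar>f x\<bar> powr p) \<partial>distr M N T) = (\<integral>\<^sup>+x. ennreal (\<bar>f (T x)\<bar> powr p) \<partial>M)"
    by (intro nn_integral_distr) measurable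
  then show ?thesis using assms unfolding Lp_bound_def by (auto intro: measurable_compose)
qed

lemma Lp_bound_cong_AE:
  assumes "AE x in M. f x = g x" "f \<in> borel_measurable M" "Lp_bound M p g b"
  shows "Lp_bound M p f b"
proof -
  have "(\<integral>\<^sup>+x. ennreal (\<bar>f x\<bar> powr p) \<partial>M) = (\<integral>\<^sup>+x. ennreal (\<bar>g x\<bar> powr p) \<partial>M)"
    using assms(1) by (intro nn_integral_cong_AE) auto
  with assms show ?thesis by (simp add: Lp_bound_def)
qed

lemma Lp_bound_0_AE:
  assumes "Lp_bound M p f 0" shows "AE x in M. f x = 0"
proof -
  have [measurable]: "f \<in> borel_measurable M" using assms by (simp add: Lp_bound_def)
  have "(\<integral>\<^sup>+x. ennreal (\<bar>f x\<bar> powr p) \<partial>M) = 0" using assms by (simp add: Lp_bound_def)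
  then have "AE x in M. ennreal (\<bar>f x\<bar> powr p) = 0"
    by (subst (asm) nn_integral_0_iff_AE) auto
  then show ?thesis by (auto simp: ennreal_eq_0_iff)
qed

text \<open>
  The only convexity fact behind the norm inequalities below. After dividing a function by its
  norm, integrating this inequality compares norms with different exponents.
\<close>
lemma power_young:
  fixes t :: real
  assumes "0 \<le> t" "0 < r" "r \<le> p"
  shows "t powr r \<le> (1 - r/p) + (r/p) * t powr p"
proof (cases "t = 0 \<or> r = p")
  case True
  then show ?thesis using assms by auto
next
  case False
  have "1 powr (1 - r/p) * (t powr p) powr (r/p) \<le> (1 - r/p) * 1 + (r/p) * t powr p"
    using assms False by (intro Youngs_inequality_0) auto
  then show ?thesis using assms by (simp add: powr_powr)
qed

lemma Lp_bound_mono_exponent: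
  assumes "prob_space M" "Lp_bound M p f b" "0 < r" "r \<le> p"
  shows "Lp_bound M r f b"
proof (cases "b = 0")
  case True
  have [measurable]: "f \<in> borel_measurable M" using assms by (simp add: Lp_bound_def)
  have "AE x in M. f x = 0" using assms True Lp_bound_0_AE by blast
  then have "(\<integral>\<^sup>+x. ennreal (\<bar>f x\<bar> powr r) \<partial>M) = (\<integral>\<^sup>+x. 0 \<partial>M)"
    by (intro nn_integral_cong_AE) auto
  then show ?thesis using True by (simp add: Lp_bound_def)
next
  case False
  interpret prob_space M by fact
  have [measurable]: "f \<in> borel_measurable M" using assms by (simp add: Lp_bound_def)
  have b: "b > 0" using False assms by (simp add: Lp_bound_def)
  have pt: "\<bar>f x\<bar> powr r \<le> b powr r * (1 - r/p) + (b powr r * (r/p) / b powr p) * \<bar>f x\<bar> powr p" for x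
  proof -
    have "(\<bar>f x\<bar> / b) powr r \<le> (1 - r/p) + (r/p) * (\<bar>f x\<bar> / b) powr p"
      using assms b by (intro power_young) auto
    then have "b powr r * ((\<bar>f x\<bar> / b) powr r) \<le> b powr r * ((1 - r/p) + (r/p) * (\<bar>f x\<bar> / b) powr p)"
      by (intro mult_left_mono) auto
    then show ?thesis using b by (simp add: powr_divide algebra_simps)
  qed
  have "(\<integral>\<^sup>+x. ennreal (\<bar>f x\<bar> powr r) \<partial>M)
     \<le> (\<integral>\<^sup>+x. ennreal (b powr r * (1 - r/p)) + ennreal (b powr r * (r/p) / b powr p) * ennreal (\<bar>f x\<bar> powr p) \<partial>M)"
    using pt assms by (intro nn_integral_mono) (simp add: ennreal_mult[symmetric] ennreal_plus[symmetric] del: ennreal_plus)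
  also have "\<dots> = ennreal (b powr r * (1 - r/p)) + ennreal (b powr r * (r/p) / b powr p) * (\<integral>\<^sup>+x. ennreal (\<bar>f x\<bar> powr p) \<partial>M)"
    by (subst nn_integral_add; simp add: nn_integral_cmult emeasure_space_1)
  also have "\<dots> \<le> ennreal (b powr r * (1 - r/p)) + ennreal (b powr r * (r/p) / b powr p) * ennreal (b powr p)"
    using assms by (intro add_left_mono mult_left_mono) (auto simp: Lp_bound_def)
  also have "\<dots> = ennreal (b powr r)"
  proof -
    have "b powr r * (r/p) / b powr p * b powr p = b powr r * (r/p)" using b by simp
    moreover have "0 \<le> 1 - r/p" using assms by simp
    moreover have "b powr r * (1 - r/p) + b powr r * (r/p) = b powr r" by (simp add: right_diff_distrib)
    ultimately show ?thesis
      using b assms by (simp only: ennreal_mult[symmetric] ennreal_plus[symmetric] mult_nonneg_nonneg divide_nonneg_nonneg powr_ge_zero less_imp_le)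
  qed
  finally show ?thesis using assms by (simp add: Lp_bound_def)
qed

lemma Lp_bound_integrable_powr:
  assumes "Lp_bound M p f b" shows "integrable M (\<lambda>x. \<bar>f x\<bar> powr p)"
proof -
  have [measurable]: "f \<in> borel_measurable M" using assms by (simp add: Lp_bound_def)
  show ?thesis
    using assms by (intro integrableI_nonneg) (auto simp: Lp_bound_def intro: le_less_trans)
qed

lemma Lp_bound_integrable:
  assumes "prob_space M" "Lp_bound M p f b" "1 \<le> p"
  shows "integrable M f"
proof -
  have "Lp_bound M 1 f b" using assms by (auto intro: Lp_bound_mono_exponent[of M p])
  from Lp_bound_integrable_powr[OF this] have "integrable M (\<lambda>x. \<bar>f x\<bar>)" by simp
  then show ?thesis using assms by (subst (asm) integrable_abs_iff) (auto simp: Lp_bound_def)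
qed

text \<open>
  For a finite right-hand side, monotonicity of the norms in the exponent bounds the first absolute
  moment. An integral that does not exist is 0 by convention and satisfies the bound trivially.
\<close>
lemma jensen_abs_powr:
  fixes f :: "'a \<Rightarrow> real"
  assumes "prob_space M" "f \<in> borel_measurable M" "1 \<le> p"
  shows "ennreal (\<bar>\<integral>x. f x \<partial>M\<bar> powr p) \<le> (\<integral>\<^sup>+x. ennreal (\<bar>f x\<bar> powr p) \<partial>M)"
proof (cases "(\<integral>\<^sup>+x. ennreal (\<bar>f x\<bar> powr p) \<partial>M)")
  case (real c)
  define b where "b = c powr (1/p)"
  have bp: "b powr p = c" using real assms by (simp add: b_def powr_powr)
  have "Lp_bound M p f b" using assms real bp by (simp add: Lp_bound_def b_def)
  then have L1: "Lp_bound M 1 f b" using assms by (auto intro: Lp_bound_mono_exponent[of M p])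
  have "ennreal \<bar>\<integral>x. f x \<partial>M\<bar> \<le> (\<integral>\<^sup>+x. ennreal \<bar>f x\<bar> \<partial>M)"
    using integral_norm_bound_ennreal[of M f] Lp_bound_integrable[OF assms(1) L1] by simp
  also have "\<dots> \<le> ennreal b" using Lp_bound_nn_integral[OF L1] Lp_bound_nonneg[OF L1] by simp
  finally have "\<bar>\<integral>x. f x \<partial>M\<bar> \<le> b" using L1 by (simp add: Lp_bound_def)
  then have "\<bar>\<integral>x. f x \<partial>M\<bar> powr p \<le> c" using assms bp powr_mono2[of p "\<bar>\<integral>x. f x \<partial>M\<bar>" b] by simp
  then show ?thesis using real by (simp add: ennreal_leI)
qed simp

lemma convex_abs_powr_sum:
  fixes w u :: "'i \<Rightarrow> real"
  assumes "finite I" "\<And>i. i \<in> I \<Longrightarrow> 0 \<le> w i" "(\<Sum>i\<in>I. w i) = 1" "1 \<le> p"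
  shows "\<bar>\<Sum>i\<in>I. w i * u i\<bar> powr p \<le> (\<Sum>i\<in>I. w i * \<bar>u i\<bar> powr p)"
proof -
  define c where "c = (\<Sum>i\<in>I. w i * \<bar>u i\<bar> powr p)"
  have c0: "c \<ge> 0" using assms by (auto simp: c_def intro!: sum_nonneg)
  have le: "\<bar>\<Sum>i\<in>I. w i * u i\<bar> \<le> (\<Sum>i\<in>I. w i * \<bar>u i\<bar>)"
    using assms by (intro order_trans[OF sum_abs]) (simp add: abs_mult)
  show ?thesis
  proof (cases "c = 0")
    case True
    then have "\<And>i. i \<in> I \<Longrightarrow> w i * \<bar>u i\<bar> powr p = 0"
      using assms unfolding c_def by (subst (asm) sum_nonneg_eq_0_iff) auto
    then have "(\<Sum>i\<in>I. w i * \<bar>u i\<bar>) = 0" by (intro sum.neutral) auto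
    with le c0 show ?thesis using True by (simp add: c_def)
  next
    case False
    define b where "b = c powr (1/p)"
    have b: "b > 0" using False c0 by (simp add: b_def)
    have bp: "b powr p = c" using c0 assms by (simp add: b_def powr_powr)
    have "(\<Sum>i\<in>I. w i * (\<bar>u i\<bar> / b)) \<le> (\<Sum>i\<in>I. w i * ((1 - 1/p) + (1/p) * (\<bar>u i\<bar> / b) powr p))"
      using assms b power_young[of "\<bar>u _\<bar> / b" 1 p]
      by (intro sum_mono mult_left_mono) auto
    also have "\<dots> = (\<Sum>i\<in>I. (1 - 1/p) * w i + (1/p/c) * (w i * \<bar>u i\<bar> powr p))"
      using b bp by (intro sum.cong) (auto simp: powr_divide algebra_simps)
    also have "\<dots> = (1 - 1/p) * (\<Sum>i\<in>I. w i) + (1/p/c) * c"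
      by (simp add: sum.distrib sum_distrib_left c_def)
    also have "\<dots> = 1" using False assms by (simp add: algebra_simps)
    finally have "(\<Sum>i\<in>I. w i * \<bar>u i\<bar>) \<le> b" using b by (simp add: field_simps sum_divide_distrib[symmetric])
    with le have "\<bar>\<Sum>i\<in>I. w i * u i\<bar> powr p \<le> b powr p" using assms by (intro powr_mono2) auto
    then show ?thesis using bp c_def by simp
  qed
qed

text \<open>
  Minkowski's inequality: a sum of functions with norms at most \<open>b i\<close> is a convex combination, with
  weights proportional to \<open>b i\<close>, of functions whose norms are all at most the sum of the bounds.
\<close>
lemma Lp_bound_sum:
  assumes "finite I" "\<And>i. i \<in> I \<Longrightarrow> Lp_bound M p (f i) (b i)" "1 \<le> p"
  shows "Lp_bound M p (\<lambda>x. \<Sum>i\<in>I. f i x) (\<Sum>i\<in>I. b i)"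
proof -
  \<comment> \<open>functions with bound 0 vanish almost everywhere and cannot be normalised, so they are set apart\<close>
  define I' where "I' = {i\<in>I. b i > 0}"
  define S where "S = (\<Sum>i\<in>I'. b i)"
  have fin: "finite I'" using assms by (simp add: I'_def)
  have meas [measurable]: "\<And>i. i \<in> I \<Longrightarrow> f i \<in> borel_measurable M" using assms by (auto simp: Lp_bound_def)
  have meas' [measurable]: "\<And>i. i \<in> I' \<Longrightarrow> f i \<in> borel_measurable M" using meas by (auto simp: I'_def)
  have b0: "\<And>i. i \<in> I \<Longrightarrow> 0 \<le> b i" using assms by (auto simp: Lp_bound_def)
  have Seq: "(\<Sum>i\<in>I. b i) = S"
    unfolding S_def using assms b0 by (intro sum.mono_neutral_right) (auto simp: I'_def le_less)
  have "AE x in M. \<forall>i\<in>I - I'. f i x = 0"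
  proof (rule AE_finite_allI)
    fix i assume "i \<in> I - I'"
    then have "Lp_bound M p (f i) 0" using assms(2)[of i] b0[of i] by (auto simp: I'_def)
    then show "AE x in M. f i x = 0" by (rule Lp_bound_0_AE)
  qed (use assms in auto)
  then have ae: "AE x in M. (\<Sum>i\<in>I. f i x) = (\<Sum>i\<in>I'. f i x)"
    by eventually_elim (use assms in \<open>intro sum.mono_neutral_right; auto simp: I'_def\<close>)
  have "Lp_bound M p (\<lambda>x. \<Sum>i\<in>I'. f i x) S"
  proof (cases "I' = {}")
    case True then show ?thesis by (simp add: Lp_bound_def S_def)
  next
    case False
    have S: "S > 0" unfolding S_def using False fin by (intro sum_pos) (auto simp: I'_def)
    have pt: "\<bar>\<Sum>i\<in>I'. f i x\<bar> powr p \<le> (\<Sum>i\<in>I'. (S powr p * (b i / S) / b i powr p) * \<bar>f i x\<bar> powr p)" for x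
    proof -
      have "\<bar>\<Sum>i\<in>I'. f i x\<bar> = S * \<bar>\<Sum>i\<in>I'. (b i / S) * (f i x / b i)\<bar>"
      proof -
        have "(\<Sum>i\<in>I'. (b i / S) * (f i x / b i)) = (\<Sum>i\<in>I'. f i x / S)"
          by (intro sum.cong) (auto simp: I'_def)
        then show ?thesis using S by (simp add: sum_divide_distrib[symmetric])
      qed
      then have "\<bar>\<Sum>i\<in>I'. f i x\<bar> powr p = S powr p * \<bar>\<Sum>i\<in>I'. (b i / S) * (f i x / b i)\<bar> powr p"
        using S by (simp add: powr_mult)
      also have "\<dots> \<le> S powr p * (\<Sum>i\<in>I'. (b i / S) * \<bar>f i x / b i\<bar> powr p)"
        using S fin assms by (intro mult_left_mono convex_abs_powr_sum)
          (auto simp: I'_def S_def sum_divide_distrib[symmetric])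
      also have "\<dots> = (\<Sum>i\<in>I'. (S powr p * (b i / S) / b i powr p) * \<bar>f i x\<bar> powr p)"
        unfolding sum_distrib_left by (intro sum.cong) (auto simp: I'_def powr_divide)
      finally show ?thesis .
    qed
    have "(\<integral>\<^sup>+x. ennreal (\<bar>\<Sum>i\<in>I'. f i x\<bar> powr p) \<partial>M)
       \<le> (\<integral>\<^sup>+x. (\<Sum>i\<in>I'. ennreal (S powr p * (b i / S) / b i powr p) * ennreal (\<bar>f i x\<bar> powr p)) \<partial>M)"
    proof (rule nn_integral_mono)
      fix x
      have "(\<Sum>i\<in>I'. ennreal (S powr p * (b i / S) / b i powr p) * ennreal (\<bar>f i x\<bar> powr p))
          = ennreal (\<Sum>i\<in>I'. (S powr p * (b i / S) / b i powr p) * \<bar>f i x\<bar> powr p)"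
        using S by (subst sum_ennreal[symmetric]) (auto simp: ennreal_mult[symmetric] I'_def)
      then show "ennreal (\<bar>\<Sum>i\<in>I'. f i x\<bar> powr p)
          \<le> (\<Sum>i\<in>I'. ennreal (S powr p * (b i / S) / b i powr p) * ennreal (\<bar>f i x\<bar> powr p))"
        using pt[of x] by (simp only: ennreal_leI)
    qed
    also have "\<dots> = (\<Sum>i\<in>I'. ennreal (S powr p * (b i / S) / b i powr p) * (\<integral>\<^sup>+x. ennreal (\<bar>f i x\<bar> powr p) \<partial>M))"
      by (subst nn_integral_sum) (auto intro!: sum.cong nn_integral_cmult)
    also have "\<dots> \<le> (\<Sum>i\<in>I'. ennreal (S powr p * (b i / S) / b i powr p) * ennreal (b i powr p))"
      using assms by (intro sum_mono mult_left_mono) (auto simp: Lp_bound_def I'_def)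
    also have "\<dots> = (\<Sum>i\<in>I'. ennreal (S powr p * (b i / S)))"
      using S by (intro sum.cong) (auto simp: ennreal_mult[symmetric] I'_def)
    also have "\<dots> = ennreal (\<Sum>i\<in>I'. S powr p * (b i / S))"
      using S by (intro sum_ennreal) (auto simp: I'_def)
    also have "(\<Sum>i\<in>I'. S powr p * (b i / S)) = S powr p"
      using S by (simp add: sum_distrib_left[symmetric] sum_divide_distrib[symmetric]) (simp add: S_def)
    finally show ?thesis using S by (simp add: Lp_bound_def)
  qed
  then show ?thesis unfolding Seq using ae meas
    by - (rule Lp_bound_cong_AE, auto)
qed

lemma Lp_bound_add:
  assumes "Lp_bound M p f a" "Lp_bound M p g b" "1 \<le> p"
  shows "Lp_bound M p (\<lambda>x. f x + g x) (a + b)"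
  using Lp_bound_sum[of "UNIV :: bool set" M p "\<lambda>i. if i then f else g" "\<lambda>i. if i then a else b"] assms
  by (simp add: UNIV_bool add.commute)

lemma Lp_bound_diff:
  assumes "Lp_bound M p f a" "Lp_bound M p g b" "1 \<le> p"
  shows "Lp_bound M p (\<lambda>x. f x - g x) (a + b)"
  using Lp_bound_add[OF assms(1) Lp_bound_cmult[OF assms(2), of "-1"] assms(3)] by simp

lemma Lp_bound_mult:
  assumes "Lp_bound M (2 * p) f a" "Lp_bound M (2 * p) g b"
  shows "Lp_bound M p (\<lambda>x. f x * g x) (a * b)"
proof -
  have [measurable]: "f \<in> borel_measurable M" "g \<in> borel_measurable M" using assms by (auto simp: Lp_bound_def)
  have ab: "a \<ge> 0" "b \<ge> 0" using assms by (auto simp: Lp_bound_def)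
  have "(\<integral>\<^sup>+x. ennreal (\<bar>f x * g x\<bar> powr p) \<partial>M)\<^sup>2
      = (\<integral>\<^sup>+x. ennreal (\<bar>f x\<bar> powr p) * ennreal (\<bar>g x\<bar> powr p) \<partial>M)\<^sup>2"
    by (simp add: abs_mult powr_mult ennreal_mult)
  also have "\<dots> \<le> (\<integral>\<^sup>+x. (ennreal (\<bar>f x\<bar> powr p))\<^sup>2 \<partial>M) * (\<integral>\<^sup>+x. (ennreal (\<bar>g x\<bar> powr p))\<^sup>2 \<partial>M)"
    by (rule Cauchy_Schwarz_nn_integral) measurable
  also have "\<dots> = (\<integral>\<^sup>+x. ennreal (\<bar>f x\<bar> powr (2 * p)) \<partial>M) * (\<integral>\<^sup>+x. ennreal (\<bar>g x\<bar> powr (2 * p)) \<partial>M)"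
    by (simp add: ennreal_power power2_eq_square powr_add[symmetric] ennreal_mult[symmetric])
  also have "\<dots> \<le> ennreal (a powr (2 * p)) * ennreal (b powr (2 * p))"
    using assms by (intro mult_mono) (auto simp: Lp_bound_def)
  also have "\<dots> = (ennreal ((a * b) powr p))\<^sup>2"
    unfolding mult_2 powr_add using ab
    by (simp add: ennreal_mult[symmetric] ennreal_power power2_eq_square powr_mult mult_ac)
  finally have "(\<integral>\<^sup>+x. ennreal (\<bar>f x * g x\<bar> powr p) \<partial>M) \<le> ennreal ((a * b) powr p)"
    by (cases "\<integral>\<^sup>+x. ennreal (\<bar>f x * g x\<bar> powr p) \<partial>M")
      (simp_all add: ennreal_power abs_le_square_iff[symmetric] top_power_ennreal top_unique)
  then show ?thesis using ab by (simp add: Lp_bound_def)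
qed

lemma Lp_bound_integral:
  assumes "prob_space M" "Lp_bound M p f b" "1 \<le> p"
  shows "\<bar>\<integral>x. f x \<partial>M\<bar> \<le> b"
proof -
  have "Lp_bound M 1 f b" using assms by (auto intro: Lp_bound_mono_exponent[of M p])
  then have "ennreal (\<bar>\<integral>x. f x \<partial>M\<bar>) \<le> ennreal b"
    using order_trans[OF jensen_abs_powr[OF assms(1), of f 1] Lp_bound_nn_integral]
    by (auto simp: Lp_bound_def)
  then show ?thesis using Lp_bound_nonneg[OF assms(2)] by simp
qed

lemma Lp_bound_closed:
  assumes "\<And>\<eta>. \<eta> > 0 \<Longrightarrow> Lp_bound M p f (b + \<eta>)" "0 \<le> b" "0 < p"
  shows "Lp_bound M p f b"
proof -
  have "((\<lambda>\<eta>. ennreal ((b + \<eta>) powr p)) \<longlongrightarrow> ennreal ((b + 0) powr p)) (at_right 0)"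
    using assms by (intro tendsto_intros tendsto_ennrealI tendsto_powr')
      (auto simp: eventually_at_filter)
  moreover have "\<forall>\<^sub>F \<eta> in at_right 0. (\<integral>\<^sup>+x. ennreal (\<bar>f x\<bar> powr p) \<partial>M) \<le> ennreal ((b + \<eta>) powr p)"
    using assms by (auto simp: eventually_at_filter Lp_bound_def)
  ultimately have "(\<integral>\<^sup>+x. ennreal (\<bar>f x\<bar> powr p) \<partial>M) \<le> ennreal ((b + 0) powr p)"
    by (intro tendsto_lowerbound) (auto simp: trivial_limit_at_right_real)
  moreover have "f \<in> borel_measurable M" using assms(1)[of 1] by (simp add: Lp_bound_def)
  ultimately show ?thesis using assms by (simp add: Lp_bound_def)
qed

lemma Lp_bound_dominated:
  assumes "Lp_bound P p g b" "f \<in> borel_measurable P" "\<And>x. x \<in> space P \<Longrightarrow> \<bar>f x\<bar> \<le> \<bar>g x\<bar>" "0 \<le> p"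
  shows "Lp_bound P p f b"
proof -
  have "(\<integral>\<^sup>+x. ennreal (\<bar>f x\<bar> powr p) \<partial>P) \<le> (\<integral>\<^sup>+x. ennreal (\<bar>g x\<bar> powr p) \<partial>P)"
    using assms by (intro nn_integral_mono ennreal_leI powr_mono2) auto
  then show ?thesis using assms by (auto simp: Lp_bound_def)
qed

text \<open>
  A power of the maximum is at most the sum of the powers, which is why only a root of the number
  of functions is lost.
\<close>
lemma Lp_bound_Max:
  assumes I: "finite I" "I \<noteq> {}" and f: "\<And>i. i \<in> I \<Longrightarrow> Lp_bound P p (f i) b" and p: "0 < p"
  shows "Lp_bound P p (\<lambda>x. MAX i\<in>I. \<bar>f i x\<bar>) (real (card I) powr (1 / p) * b)"
proof -
  have b: "0 \<le> b" using f I(2) by (auto simp: Lp_bound_def)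
  have [measurable]: "f i \<in> borel_measurable P" if "i \<in> I" for i using f[OF that] by (simp add: Lp_bound_def)
  have "(\<integral>\<^sup>+x. ennreal (\<bar>MAX i\<in>I. \<bar>f i x\<bar>\<bar> powr p) \<partial>P) \<le> (\<integral>\<^sup>+x. (\<Sum>i\<in>I. ennreal (\<bar>f i x\<bar> powr p)) \<partial>P)"
  proof (rule nn_integral_mono)
    fix x
    have "(MAX i\<in>I. \<bar>f i x\<bar>) \<in> (\<lambda>i. \<bar>f i x\<bar>) ` I" using I by (intro Max_in) auto
    then obtain i where i: "(MAX i\<in>I. \<bar>f i x\<bar>) = \<bar>f i x\<bar>" "i \<in> I" by (rule imageE)
    have "ennreal (\<bar>MAX i\<in>I. \<bar>f i x\<bar>\<bar> powr p) = ennreal (\<bar>f i x\<bar> powr p)" unfolding i(1) by simp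
    also have "\<dots> \<le> (\<Sum>i\<in>I. ennreal (\<bar>f i x\<bar> powr p))"
      using I i(2) by (intro member_le_sum) auto
    finally show "ennreal (\<bar>MAX i\<in>I. \<bar>f i x\<bar>\<bar> powr p) \<le> (\<Sum>i\<in>I. ennreal (\<bar>f i x\<bar> powr p))" .
  qed
  also have "\<dots> = (\<Sum>i\<in>I. \<integral>\<^sup>+x. ennreal (\<bar>f i x\<bar> powr p) \<partial>P)"
    by (rule nn_integral_sum) measurable
  also have "\<dots> \<le> (\<Sum>i\<in>I. ennreal (b powr p))"
    using f by (intro sum_mono) (auto simp: Lp_bound_def)
  also have "\<dots> = ennreal ((real (card I) powr (1 / p) * b) powr p)"
    using p b by (simp add: powr_mult powr_powr ennreal_mult ennreal_of_nat_eq_real_of_nat)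
  finally show ?thesis using I b by (auto simp: Lp_bound_def)
qed

section \<open>Adding a martingale difference\<close>

lemma Lp_bound_iff_integral:
  "Lp_bound M p f b \<longleftrightarrow> f \<in> borel_measurable M \<and> 0 \<le> b \<and>
     integrable M (\<lambda>x. \<bar>f x\<bar> powr p) \<and> (\<integral>x. \<bar>f x\<bar> powr p \<partial>M) \<le> b powr p"
proof (cases "f \<in> borel_measurable M \<and> integrable M (\<lambda>x. \<bar>f x\<bar> powr p)")
  case True
  then show ?thesis by (simp add: Lp_bound_def nn_integral_eq_integral)
next
  case False
  then show ?thesis using Lp_bound_integrable_powr[of M p f b] by (auto simp: Lp_bound_def)
qed

text \<open>
  Up to \<open>\<bar>t\<bar> = 1/p\<close> the power is at most \<open>exp (p * t)\<close>, whose exponent stays in the interval where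
  \<open>1 + z + z^2\<close> dominates the exponential. Beyond it every term is at most a multiple of
  \<open>\<bar>t\<bar> powr p\<close>.
\<close>
lemma one_plus_powr_le:
  fixes t p :: real
  assumes p: "2 \<le> p"
  shows "\<bar>1 + t\<bar> powr p \<le> 1 + p * t + ((p + 1) powr p + p powr p + p\<^sup>2) * (t\<^sup>2 + \<bar>t\<bar> powr p)"
    (is "_ \<le> _ + ?c * _")
proof (cases "\<bar>t\<bar> \<le> 1 / p")
  case True
  have "1 / p \<le> 1 / 2" using p by (intro divide_left_mono) auto
  with True have t: "\<bar>t\<bar> \<le> 1/2" by simp
  have pt: "\<bar>p * t\<bar> \<le> 1" using True p by (simp add: abs_mult field_simps)
  have exp_le: "exp z \<le> 1 + z + z\<^sup>2" if "\<bar>z\<bar> \<le> 1" for z :: real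
  proof (cases "0 \<le> z")
    case True then show ?thesis using that exp_bound[of z] by simp
  next
    case False
    define u where "u = - z"
    have u: "0 \<le> u" "u \<le> 1" using False that by (auto simp: u_def)
    have "exp z = 1 / exp u" by (simp add: u_def exp_minus field_simps)
    also have "\<dots> \<le> 1 / (1 + u)"
      using u exp_ge_add_one_self[of u] by (intro divide_left_mono) auto
    also have "\<dots> \<le> 1 - u + u\<^sup>2"
    proof -
      have "(1 - u + u\<^sup>2) * (1 + u) = 1 + u ^ 3" by (simp add: algebra_simps power2_eq_square power3_eq_cube)
      then have "1 \<le> (1 - u + u\<^sup>2) * (1 + u)" using u by simp
      then show ?thesis using u by (simp add: divide_le_eq)
    qed
    finally show ?thesis by (simp add: u_def)
  qed
  have "\<bar>1 + t\<bar> powr p = exp (p * ln (1 + t))" using t by (simp add: powr_def)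
  also have "\<dots> \<le> exp (p * t)"
    using t p ln_add_one_self_le_self2[of t] by (simp add: mult_left_mono)
  also have "\<dots> \<le> 1 + p * t + p\<^sup>2 * t\<^sup>2" using exp_le[OF pt] by (simp add: power_mult_distrib)
  also have "p\<^sup>2 * t\<^sup>2 \<le> ?c * (t\<^sup>2 + \<bar>t\<bar> powr p)" by (intro mult_mono) auto
  finally show ?thesis by simp
next
  case False
  then have pt: "1 \<le> p * \<bar>t\<bar>" using p by (simp add: field_simps)
  have "\<bar>1 + t\<bar> \<le> (p + 1) * \<bar>t\<bar>" using pt by (simp add: algebra_simps abs_if split: if_splits)
  then have "\<bar>1 + t\<bar> powr p \<le> ((p + 1) * \<bar>t\<bar>) powr p" using p by (intro powr_mono2) auto
  then have 1: "\<bar>1 + t\<bar> powr p \<le> (p + 1) powr p * \<bar>t\<bar> powr p" using p by (simp add: powr_mult)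
  have "- (1 + p * t) \<le> p * \<bar>t\<bar>" using p mult_left_mono[OF abs_ge_minus_self[of t], of p] by simp
  also have "\<dots> = (p * \<bar>t\<bar>) powr 1" using p by simp
  also have "\<dots> \<le> (p * \<bar>t\<bar>) powr p" using pt p by (intro powr_mono) auto
  also have "\<dots> = p powr p * \<bar>t\<bar> powr p" using p by (simp add: powr_mult)
  finally have 2: "- (1 + p * t) \<le> p powr p * \<bar>t\<bar> powr p" .
  have "(p + 1) powr p * \<bar>t\<bar> powr p + p powr p * \<bar>t\<bar> powr p \<le> ?c * (t\<^sup>2 + \<bar>t\<bar> powr p)"
    unfolding distrib_right[symmetric] by (intro mult_mono) auto
  then show ?thesis using 1 2 by linarith
qed

text \<open>
  Four times the constant in the previous inequality. The factor 4 pays for splitting a power of a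
  sum into two halves in \<open>powr_sum_expansion_le\<close>.
\<close>
definition burkholder_const :: "real \<Rightarrow> real" where
  "burkholder_const p = 4 * ((p + 1) powr p + p powr p + p\<^sup>2)"

lemma burkholder_const_ge: "2 \<le> p \<Longrightarrow> 4 \<le> burkholder_const p"
  using one_le_power[of p 2] by (simp add: burkholder_const_def add_increasing)

text \<open>
  The first-order term is kept exactly because it integrates to 0 along a martingale difference.
  For \<open>x = 0\<close> all powers of \<open>x\<close> are 0 by convention and the last summand alone suffices.
\<close>
lemma abs_add_powr_le:
  fixes x y p :: real
  assumes p: "2 \<le> p"
  shows "\<bar>x + y\<bar> powr p \<le> \<bar>x\<bar> powr p + p * (sgn x * \<bar>x\<bar> powr (p - 1) * y)
           + burkholder_const p / 4 * (\<bar>x\<bar> powr (p - 2) * y\<^sup>2 + \<bar>y\<bar> powr p)"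
proof (cases "x = 0")
  case True
  have "1 * \<bar>y\<bar> powr p \<le> burkholder_const p / 4 * \<bar>y\<bar> powr p"
    using burkholder_const_ge[OF p] by (intro mult_right_mono) auto
  then show ?thesis using True by simp
next
  case False
  define t where "t = y / x"
  have y: "y = x * t" using False by (simp add: t_def)
  have "\<bar>x + y\<bar> powr p = \<bar>x\<bar> powr p * \<bar>1 + t\<bar> powr p"
  proof -
    have "x + y = x * (1 + t)" by (simp add: y algebra_simps)
    then show ?thesis by (simp only: abs_mult) (simp add: powr_mult)
  qed
  also have "\<dots> \<le> \<bar>x\<bar> powr p * (1 + p * t + burkholder_const p / 4 * (t\<^sup>2 + \<bar>t\<bar> powr p))"
  proof (rule mult_left_mono)
    have c: "burkholder_const p / 4 = (p + 1) powr p + p powr p + p\<^sup>2" by (simp add: burkholder_const_def)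
    show "\<bar>1 + t\<bar> powr p \<le> 1 + p * t + burkholder_const p / 4 * (t\<^sup>2 + \<bar>t\<bar> powr p)"
      unfolding c by (rule one_plus_powr_le[OF p])
  qed simp
  also have "\<dots> = \<bar>x\<bar> powr p + p * (sgn x * \<bar>x\<bar> powr (p - 1) * y)
           + burkholder_const p / 4 * (\<bar>x\<bar> powr (p - 2) * y\<^sup>2 + \<bar>y\<bar> powr p)"
  proof -
    have 1: "\<bar>x\<bar> powr p * t = sgn x * \<bar>x\<bar> powr (p - 1) * y"
      using False by (simp add: powr_diff y sgn_if abs_if field_simps)
    have 2: "\<bar>x\<bar> powr p * t\<^sup>2 = \<bar>x\<bar> powr (p - 2) * y\<^sup>2"
      using False by (simp add: powr_diff y power_mult_distrib)
    have 3: "\<bar>x\<bar> powr p * \<bar>t\<bar> powr p = \<bar>y\<bar> powr p"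
      by (simp add: y abs_mult powr_mult)
    show ?thesis unfolding 1[symmetric] 2[symmetric] 3[symmetric] by (simp add: algebra_simps)
  qed
  finally show ?thesis .
qed

text \<open>
  A pointwise form of Hoelder's inequality with exponents \<open>p / (p - 2)\<close> and \<open>p / 2\<close>: integrating it
  against functions with norms at most \<open>a\<close> and \<open>b\<close> leaves the factor \<open>a powr (p - 2) * b^2\<close>.
\<close>
lemma powr_young_product:
  fixes a b :: real
  assumes p: "2 \<le> p" and ab: "0 < a" "0 < b"
  shows "\<bar>x\<bar> powr (p - 2) * y\<^sup>2 \<le> a powr (p - 2) * b\<^sup>2 *
    ((1 - 2/p) * (\<bar>x\<bar> powr p / a powr p) + (2/p) * (\<bar>y\<bar> powr p / b powr p))"
proof (cases "x = 0 \<or> y = 0")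
  case True
  have "0 \<le> a powr (p - 2) * b\<^sup>2 *
    ((1 - 2/p) * (\<bar>x\<bar> powr p / a powr p) + (2/p) * (\<bar>y\<bar> powr p / b powr p))"
    using p by (intro mult_nonneg_nonneg add_nonneg_nonneg) auto
  then show ?thesis using True by auto
next
  case False
  define u v where "u = \<bar>x\<bar> / a" and "v = \<bar>y\<bar> / b"
  have uv: "u > 0" "v > 0" using False ab by (auto simp: u_def v_def)
  have "(u powr p) powr (1 - 2/p) * (v powr p) powr (2/p) \<le> (1 - 2/p) * u powr p + (2/p) * v powr p"
    using p uv by (intro Youngs_inequality_0) auto
  moreover have "p * (1 - 2/p) = p - 2" using p by (simp add: field_simps)
  ultimately have le: "u powr (p - 2) * v\<^sup>2 \<le> (1 - 2/p) * u powr p + (2/p) * v powr p"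
    using p uv by (simp add: powr_powr)
  have "\<bar>x\<bar> powr (p - 2) * y\<^sup>2 = a powr (p - 2) * b\<^sup>2 * (u powr (p - 2) * v\<^sup>2)"
    using ab by (simp add: u_def v_def powr_divide power_divide)
  also have "\<dots> \<le> a powr (p - 2) * b\<^sup>2 * ((1 - 2/p) * u powr p + (2/p) * v powr p)"
    using le by (intro mult_left_mono) auto
  finally show ?thesis using ab by (simp add: u_def v_def powr_divide)
qed

text \<open>
  With \<open>q = p / 2\<close>, the power \<open>(A + z) powr q\<close> dominates both its linearisation at \<open>A\<close> (Bernoulli)
  and \<open>A powr q + z powr q\<close> (superadditivity). Their average controls the mixed term by the
  former and the pure power of \<open>b\<close> by the latter.
\<close>
lemma powr_sum_expansion_le:
  fixes a b c p :: real
  assumes p: "2 \<le> p" and ab: "0 < a" "0 < b" and c: "1 \<le> c"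
  shows "a powr p + c * (a powr (p - 2) * b\<^sup>2 + b powr p) \<le> (sqrt (a\<^sup>2 + 4 * c * b\<^sup>2)) powr p"
proof -
  define q A z where "q = p / 2" and "A = a\<^sup>2" and "z = 4 * c * b\<^sup>2"
  have q: "1 \<le> q" and A: "A > 0" and z: "z > 0" using assms by (auto simp: q_def A_def z_def)
  have Aq: "A powr q = a powr p" "A powr (q - 1) = a powr (p - 2)"
    using ab by (simp_all add: A_def q_def powr_powr flip: powr_numeral)
  have bern: "A powr q + q * A powr (q - 1) * z \<le> (A + z) powr q"
  proof -
    define s where "s = z / A"
    have s: "s > 0" using A z by (simp add: s_def)
    have "(1 + s) powr 1 \<le> (1 - 1/q) + (1/q) * (1 + s) powr q"
      using s q by (intro power_young) auto
    then have "q * (1 + s) \<le> q * ((1 - 1/q) + (1/q) * (1 + s) powr q)"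
      using q s by (intro mult_left_mono) auto
    also have "\<dots> = q - 1 + (1 + s) powr q" using q by (simp add: field_simps)
    finally have "1 + q * s \<le> (1 + s) powr q" by (simp add: distrib_left)
    then have "A powr q * (1 + q * s) \<le> A powr q * (1 + s) powr q" by (intro mult_left_mono) auto
    also have "\<dots> = (A * (1 + s)) powr q" by (simp add: powr_mult)
    also have "A * (1 + s) = A + z" using A by (simp add: s_def field_simps)
    finally show ?thesis using A by (simp add: s_def powr_diff field_simps)
  qed
  have super: "A powr q + z powr q \<le> (A + z) powr q"
  proof -
    have eq: "w powr q = w * w powr (q - 1)" if "w > 0" for w :: real
      using that by (simp add: powr_diff)
    have "A powr q + z powr q \<le> A * (A + z) powr (q - 1) + z * (A + z) powr (q - 1)"
      unfolding eq[OF A] eq[OF z] using A z q by (intro add_mono mult_left_mono powr_mono2) auto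
    also have "\<dots> = (A + z) powr q" using A z by (simp add: eq algebra_simps)
    finally show ?thesis .
  qed
  have "2 * (c * (a powr (p - 2) * b\<^sup>2)) \<le> q * (4 * c * (a powr (p - 2) * b\<^sup>2))"
  proof -
    have h: "0 \<le> c * (a powr (p - 2) * b\<^sup>2)" using c by simp
    have "2 * (c * (a powr (p - 2) * b\<^sup>2)) \<le> 4 * (q * (c * (a powr (p - 2) * b\<^sup>2)))"
      using mult_right_mono[OF q h] h by linarith
    then show ?thesis by (simp add: mult_ac)
  qed
  also have "\<dots> = q * A powr (q - 1) * z" by (simp add: Aq z_def mult_ac)
  finally have 1: "2 * (c * (a powr (p - 2) * b\<^sup>2)) \<le> q * A powr (q - 1) * z" .
  have "2 * (c * b powr p) \<le> (4 * c) powr q * b powr p"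
  proof -
    have "2 * c \<le> (4 * c) powr 1" using c by simp
    also have "\<dots> \<le> (4 * c) powr q" using c q by (intro powr_mono) auto
    finally have "2 * c * b powr p \<le> (4 * c) powr q * b powr p" by (intro mult_right_mono) auto
    then show ?thesis by (simp add: mult_ac)
  qed
  also have "\<dots> = z powr q"
    using ab by (simp add: z_def q_def powr_mult powr_powr flip: powr_numeral)
  finally have 2: "2 * (c * b powr p) \<le> z powr q" .
  have "(sqrt (a\<^sup>2 + 4 * c * b\<^sup>2)) powr p = (A + z) powr q"
    using A z by (simp add: A_def z_def q_def powr_half_sqrt[symmetric] powr_powr)
  then show ?thesis using bern super 1 2 Aq by (simp add: distrib_left)
qed

lemma Lp_bound_dual_integrable:
  assumes f: "Lp_bound M p f a" and g: "Lp_bound M p g b" and p: "1 < p"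
  shows "integrable M (\<lambda>x. sgn (f x) * \<bar>f x\<bar> powr (p - 1) * g x)"
proof (rule Bochner_Integration.integrable_bound)
  show "integrable M (\<lambda>x. \<bar>f x\<bar> powr p + \<bar>g x\<bar> powr p)"
    using f g by (intro Bochner_Integration.integrable_add Lp_bound_integrable_powr)
  have [measurable]: "f \<in> borel_measurable M" "g \<in> borel_measurable M"
    using f g by (auto simp: Lp_bound_def)
  show "(\<lambda>x. sgn (f x) * \<bar>f x\<bar> powr (p - 1) * g x) \<in> borel_measurable M"
    by measurable
  have "u powr (p - 1) * v \<le> u powr p + v powr p" if "u \<ge> 0" "v \<ge> 0" for u v :: real
  proof (cases "u \<le> v")
    case True
    have "u powr (p - 1) * v \<le> v powr (p - 1) * v"
      using True that p by (intro mult_right_mono powr_mono2) auto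
    also have "\<dots> = v powr p" using that p by (cases "v = 0") (auto simp: powr_diff)
    finally show ?thesis by (simp add: add_increasing)
  next
    case False
    have "u powr (p - 1) * v \<le> u powr (p - 1) * u" using False by (intro mult_left_mono) auto
    also have "\<dots> = u powr p" using that p by (cases "u = 0") (auto simp: powr_diff)
    finally show ?thesis by (simp add: add_increasing2)
  qed
  then show "AE x in M. norm (sgn (f x) * \<bar>f x\<bar> powr (p - 1) * g x) \<le> norm (\<bar>f x\<bar> powr p + \<bar>g x\<bar> powr p)"
    by (intro AE_I2) (simp add: abs_mult abs_sgn_eq)
qed

text \<open>
  The squared norms add, with constant exactly 1 in front of the square of \<open>a\<close>; this is what allows
  the step to be iterated over arbitrarily many martingale differences.
\<close>
lemma Lp_bound_martingale_step:
  assumes X: "Lp_bound M p X a" and Y: "Lp_bound M p Y b" and p: "2 \<le> p"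
    and orth: "(\<integral>x. sgn (X x) * \<bar>X x\<bar> powr (p - 1) * Y x \<partial>M) = 0"
  shows "Lp_bound M p (\<lambda>x. X x + Y x) (sqrt (a\<^sup>2 + burkholder_const p * b\<^sup>2))"
proof -
  have [measurable]: "X \<in> borel_measurable M" "Y \<in> borel_measurable M"
    using X Y by (auto simp: Lp_bound_def)
  have ab: "0 \<le> a" "0 \<le> b" using X Y by (auto simp: Lp_bound_def)
  note c4 = burkholder_const_ge[OF p]
  show ?thesis
  proof (cases "a = 0 \<or> b = 0")
    case True
    then show ?thesis
    proof
      assume "a = 0"
      then have ae: "AE x in M. X x + Y x = Y x" using X Lp_bound_0_AE[of M p X] by auto
      have "1 * b\<^sup>2 \<le> burkholder_const p * b\<^sup>2" using c4 by (intro mult_right_mono) auto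
      then have "b \<le> sqrt (a\<^sup>2 + burkholder_const p * b\<^sup>2)" using ab \<open>a = 0\<close> by (intro real_le_rsqrt) auto
      with Y p have "Lp_bound M p Y (sqrt (a\<^sup>2 + burkholder_const p * b\<^sup>2))"
        by (auto intro: Lp_bound_mono)
      from Lp_bound_cong_AE[OF ae _ this] show ?thesis by simp
    next
      assume "b = 0"
      then have ae: "AE x in M. X x + Y x = X x" using Y Lp_bound_0_AE[of M p Y] by auto
      have "Lp_bound M p X (sqrt (a\<^sup>2 + burkholder_const p * b\<^sup>2))" using X ab \<open>b = 0\<close> by simp
      from Lp_bound_cong_AE[OF ae _ this] show ?thesis by simp
    qed
  next
    case False
    with ab have a: "0 < a" and b: "0 < b" by auto
    define c where "c = burkholder_const p / 4"
    have c: "1 \<le> c" using c4 by (simp add: c_def)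
    have iX: "integrable M (\<lambda>x. \<bar>X x\<bar> powr p)" and EX: "(\<integral>x. \<bar>X x\<bar> powr p \<partial>M) \<le> a powr p"
      and iY: "integrable M (\<lambda>x. \<bar>Y x\<bar> powr p)" and EY: "(\<integral>x. \<bar>Y x\<bar> powr p \<partial>M) \<le> b powr p"
      using X Y by (auto simp: Lp_bound_iff_integral)
    have iXY: "integrable M (\<lambda>x. \<bar>X x + Y x\<bar> powr p)"
      using Lp_bound_integrable_powr[OF Lp_bound_add[OF X Y]] p by simp
    let ?H = "\<lambda>x. a powr (p - 2) * b\<^sup>2 *
        ((1 - 2/p) * (\<bar>X x\<bar> powr p / a powr p) + (2/p) * (\<bar>Y x\<bar> powr p / b powr p))"
    have iH: "integrable M ?H" using iX iY by auto
    have "(\<integral>x. ?H x \<partial>M) = a powr (p - 2) * b\<^sup>2 *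
        ((1 - 2/p) * ((\<integral>x. \<bar>X x\<bar> powr p \<partial>M) / a powr p) + (2/p) * ((\<integral>x. \<bar>Y x\<bar> powr p \<partial>M) / b powr p))"
      using iX iY by simp
    also have "\<dots> \<le> a powr (p - 2) * b\<^sup>2 * ((1 - 2/p) * 1 + (2/p) * 1)"
      using EX EY p a b by (intro mult_left_mono add_mono) (auto simp: divide_le_eq)
    finally have EH: "(\<integral>x. ?H x \<partial>M) \<le> a powr (p - 2) * b\<^sup>2" by simp
    let ?S = "\<lambda>x. sgn (X x) * \<bar>X x\<bar> powr (p - 1) * Y x"
    have iS: "integrable M ?S" using X Y p by (intro Lp_bound_dual_integrable) auto
    have "(\<integral>x. \<bar>X x + Y x\<bar> powr p \<partial>M)
        \<le> (\<integral>x. \<bar>X x\<bar> powr p + p * ?S x + c * (?H x + \<bar>Y x\<bar> powr p) \<partial>M)"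
    proof (rule integral_mono)
      fix x
      have "\<bar>X x + Y x\<bar> powr p \<le> \<bar>X x\<bar> powr p + p * ?S x + c * (\<bar>X x\<bar> powr (p - 2) * (Y x)\<^sup>2 + \<bar>Y x\<bar> powr p)"
        using abs_add_powr_le[OF p, of "X x" "Y x"] by (simp add: c_def)
      also have "\<dots> \<le> \<bar>X x\<bar> powr p + p * ?S x + c * (?H x + \<bar>Y x\<bar> powr p)"
        using powr_young_product[OF p a b, of "X x" "Y x"] c
        by (intro add_left_mono mult_left_mono add_right_mono) auto
      finally show "\<bar>X x + Y x\<bar> powr p \<le> \<dots>" .
    qed (use iXY iX iS iH iY in auto)
    also have "\<dots> = (\<integral>x. \<bar>X x\<bar> powr p \<partial>M) + p * (\<integral>x. ?S x \<partial>M) + c * ((\<integral>x. ?H x \<partial>M) + (\<integral>x. \<bar>Y x\<bar> powr p \<partial>M))"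
      using iX iS iH iY by (simp del: integral_mult_right_zero integral_divide_zero)
    also have "\<dots> \<le> a powr p + p * 0 + c * (a powr (p - 2) * b\<^sup>2 + b powr p)"
      using EX EY EH orth c p by (intro add_mono mult_left_mono) auto
    also have "\<dots> \<le> (sqrt (a\<^sup>2 + 4 * c * b\<^sup>2)) powr p"
      using powr_sum_expansion_le[OF p a b c] by simp
    finally show ?thesis
      using iXY c_def c4 by (simp add: Lp_bound_iff_integral)
  qed
qed

section \<open>Resampling the coordinates of a product space\<close>

text \<open>
  The components have full space, so that points of the product are arbitrary functions on the
  index set and may be modified coordinatewise with \<open>override_on\<close>. The point
  \<open>override_on y x J\<close> agrees with \<open>x\<close> on \<open>J\<close> and with \<open>y\<close> elsewhere; integrating over \<open>y\<close> is
  conditioning on the coordinates in \<open>J\<close>.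
\<close>
locale coordinate_product =
  fixes N :: "'i \<Rightarrow> 'a measure"
  assumes prob_N: "\<And>i. prob_space (N i)"
    and space_N: "\<And>i. space (N i) = UNIV"
begin

abbreviation PP :: "('i \<Rightarrow> 'a) measure" where "PP \<equiv> PiM UNIV N"

abbreviation PP2 :: "(('i \<Rightarrow> 'a) \<times> ('i \<Rightarrow> 'a)) measure" where "PP2 \<equiv> PP \<Otimes>\<^sub>M PP"

lemma prob_PP: "prob_space PP"
  by (rule prob_space_PiM) (rule prob_N)

sublocale PP: prob_space PP by (rule prob_PP)

sublocale PP2: pair_prob_space PP PP ..

lemma prob_PP2: "prob_space PP2" by unfold_locales

lemma space_PP [simp]: "space PP = UNIV"
  by (simp add: space_PiM space_N)

lemma measurable_override_on [measurable (raw)]: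
  assumes [measurable]: "f \<in> measurable L PP" "g \<in> measurable L PP"
  shows "(\<lambda>z. override_on (f z) (g z) J) \<in> measurable L PP"
  unfolding override_on_def
proof (rule measurable_PiM_single')
  show "(\<lambda>z. if i \<in> J then g z i else f z i) \<in> measurable L (N i)" for i
    by (cases "i \<in> J") simp_all
qed (auto simp: space_N)

text \<open>
  Two independent points may exchange any set of coordinates without changing their joint law.
  The pair of points is viewed as one point of a product indexed by site and copy; the law of such a
  point is determined by cylinder sets, on which the exchange only permutes factors.
\<close>
lemma distr_swap_coordinates:
  "distr PP2 PP2 (\<lambda>(x, y). (override_on y x J, override_on x y J)) = PP2"
proof -
  define NN where "NN = (\<lambda>(i, b :: bool). N i)"
  interpret NN: product_prob_space NN UNIV
    by (intro product_prob_space.intro product_sigma_finite.intro product_prob_space_axioms.intro)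
      (auto simp: NN_def prob_N prob_space_imp_sigma_finite split: prod.splits)
  interpret N: product_prob_space N UNIV
    by (intro product_prob_space.intro product_sigma_finite.intro product_prob_space_axioms.intro)
      (auto simp: prob_N prob_space_imp_sigma_finite)
  let ?Q = "PiM UNIV NN"
  \<comment> \<open>the component at \<open>(i, b)\<close> is the \<open>b\<close>-th copy after the exchange; \<open>J = UNIV\<close> exchanges nothing\<close>
  define join where "join = (\<lambda>J (x :: 'i \<Rightarrow> 'a, y :: 'i \<Rightarrow> 'a). (\<lambda>(i, b). if (i \<in> J) = b then x i else y i))"
  define split :: "('i \<times> bool \<Rightarrow> 'a) \<Rightarrow> _" where "split = (\<lambda>w. (\<lambda>i. w (i, True), \<lambda>i. w (i, False)))"
  have join_eq: "join J = (\<lambda>z ib. if (fst ib \<in> J) = snd ib then fst z (fst ib) else snd z (fst ib))" for J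
    by (auto simp: join_def fun_eq_iff)
  have join_meas: "join J \<in> measurable PP2 ?Q" for J
    unfolding join_eq
  proof (rule measurable_PiM_single')
    fix ib :: "'i \<times> bool"
    have "NN ib = N (fst ib)" by (cases ib) (simp add: NN_def)
    moreover have "(\<lambda>z. fst z i) \<in> measurable PP2 (N i)" "(\<lambda>z. snd z i) \<in> measurable PP2 (N i)" for i
      by measurable
    ultimately show "(\<lambda>z. if (fst ib \<in> J) = snd ib then fst z (fst ib) else snd z (fst ib)) \<in> measurable PP2 (NN ib)"
      by (cases "(fst ib \<in> J) = snd ib") simp_all
  qed (auto simp: NN_def space_N split: prod.splits)
  have split_meas: "split \<in> measurable ?Q PP2"
  proof -
    have "(\<lambda>w i. w (i, b)) \<in> measurable ?Q PP" for b
    proof (rule measurable_PiM_single')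
      fix i
      have "(\<lambda>w. w (i, b)) \<in> measurable ?Q (NN (i, b))" by measurable
      then show "(\<lambda>w. w (i, b)) \<in> measurable ?Q (N i)" by (simp add: NN_def)
    qed (auto simp: space_N)
    then show ?thesis unfolding split_def by (intro measurable_Pair)
  qed
  have join_distr: "distr PP2 ?Q (join J) = ?Q" for J
  proof (rule NN.PiM_eq)
    fix F :: "('i \<times> bool) set" and E
    assume F: "finite F" and E: "\<And>j. j \<in> F \<Longrightarrow> E j \<in> sets (NN j)"
    define F1 F2 where "F1 = {i. (i, i \<in> J) \<in> F}" and "F2 = {i. (i, i \<notin> J) \<in> F}"
    have inj: "inj_on (\<lambda>i. (i, i \<in> J)) F1" "inj_on (\<lambda>i. (i, i \<notin> J)) F2" by (auto simp: inj_on_def)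
    have img: "(\<lambda>i. (i, i \<in> J)) ` F1 \<subseteq> F" "(\<lambda>i. (i, i \<notin> J)) ` F2 \<subseteq> F"
      by (auto simp: F1_def F2_def)
    have fin: "finite F1" "finite F2"
      using inj_on_finite[OF inj(1) img(1) F] inj_on_finite[OF inj(2) img(2) F] by auto
    have Fun: "F = (\<lambda>i. (i, i \<in> J)) ` F1 \<union> (\<lambda>i. (i, i \<notin> J)) ` F2"
    proof (intro set_eqI iffI)
      fix ib assume "ib \<in> F"
      then show "ib \<in> (\<lambda>i. (i, i \<in> J)) ` F1 \<union> (\<lambda>i. (i, i \<notin> J)) ` F2"
        by (cases ib; cases "snd ib = (fst ib \<in> J)") (auto simp: F1_def F2_def image_iff)
    qed (use img in auto)
    have E1: "E (i, i \<in> J) \<in> sets (N i)" if "i \<in> F1" for i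
      using that E[of "(i, i \<in> J)"] by (auto simp: F1_def NN_def)
    have E2: "E (i, i \<notin> J) \<in> sets (N i)" if "i \<in> F2" for i
      using that E[of "(i, i \<notin> J)"] by (auto simp: F2_def NN_def)
    let ?A1 = "{x \<in> space PP. \<forall>i\<in>F1. x i \<in> E (i, i \<in> J)}"
    let ?A2 = "{x \<in> space PP. \<forall>i\<in>F2. x i \<in> E (i, i \<notin> J)}"
    have cylinder: "{x \<in> space PP. \<forall>i\<in>F'. x i \<in> E' i} \<in> sets PP"
      if "finite F'" "\<And>i. i \<in> F' \<Longrightarrow> E' i \<in> sets (N i)" for F' E'
    proof (rule sets.sets_Collect_finite_All[OF _ that(1)])
      fix i assume "i \<in> F'"
      then have "{x \<in> space (N i). x \<in> E' i} \<in> sets (N i)" using that by (simp add: space_N)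
      then show "{x \<in> space PP. x i \<in> E' i} \<in> sets PP" by (intro sets_Collect_single') auto
    qed
    have A: "?A1 \<in> sets PP" "?A2 \<in> sets PP"
      using fin E1 E2 by (auto intro!: cylinder simp del: space_PP)
    have pre: "join J -` prod_emb UNIV NN F (Pi\<^sub>E F E) \<inter> space PP2 = ?A1 \<times> ?A2"
    proof -
      have "prod_emb UNIV NN F (Pi\<^sub>E F E) = {w. \<forall>j\<in>F. w j \<in> E j}"
        by (auto simp: prod_emb_def space_N NN_def PiE_iff split: prod.splits)
      moreover have "(\<forall>j\<in>F. join J z j \<in> E j) \<longleftrightarrow>
          (\<forall>i\<in>F1. fst z i \<in> E (i, i \<in> J)) \<and> (\<forall>i\<in>F2. snd z i \<in> E (i, i \<notin> J))" for z
        unfolding Fun ball_Un ball_simps by (simp add: join_eq)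
      ultimately show ?thesis by (auto simp: space_pair_measure)
    qed
    have "emeasure (distr PP2 ?Q (join J)) (prod_emb UNIV NN F (Pi\<^sub>E F E)) = emeasure PP2 (?A1 \<times> ?A2)"
      using F E join_meas by (subst emeasure_distr) (auto simp: pre intro!: sets_PiM_I)
    also have "\<dots> = emeasure PP ?A1 * emeasure PP ?A2"
      using A by (rule PP.emeasure_pair_measure_Times)
    also have "emeasure PP ?A1 = (\<Prod>i\<in>F1. emeasure (N i) (E (i, i \<in> J)))"
      using fin E1 by (intro N.emeasure_PiM_Collect) auto
    also have "emeasure PP ?A2 = (\<Prod>i\<in>F2. emeasure (N i) (E (i, i \<notin> J)))"
      using fin E2 by (intro N.emeasure_PiM_Collect) auto
    also have "(\<Prod>i\<in>F1. emeasure (N i) (E (i, i \<in> J))) * (\<Prod>i\<in>F2. emeasure (N i) (E (i, i \<notin> J)))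
       = (\<Prod>j\<in>F. emeasure (NN j) (E j))"
      unfolding Fun using fin inj
      by (subst prod.union_disjoint) (auto simp: prod.reindex NN_def)
    finally show "emeasure (distr PP2 ?Q (join J)) (prod_emb UNIV NN F (Pi\<^sub>E F E)) = (\<Prod>j\<in>F. emeasure (NN j) (E j))" .
  qed simp
  have "distr PP2 PP2 (\<lambda>(x, y). (override_on y x J, override_on x y J)) = distr PP2 PP2 (split \<circ> join J)"
    by (intro arg_cong[where f = "distr PP2 PP2"]) (auto simp: fun_eq_iff split_def join_def override_on_def)
  also have "\<dots> = distr ?Q PP2 split"
    using distr_distr[OF split_meas join_meas[of J]] by (simp add: join_distr)
  also have "\<dots> = distr PP2 PP2 (split \<circ> join UNIV)"
    using distr_distr[OF split_meas join_meas[of UNIV]] by (simp add: join_distr)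
  also have "\<dots> = distr PP2 PP2 (\<lambda>z. z)"
    by (intro arg_cong[where f = "distr PP2 PP2"]) (auto simp: fun_eq_iff split_def join_def)
  finally show ?thesis by (simp add: distr_id)
qed

lemma distr_override_on: "distr PP2 PP (\<lambda>(x, y). override_on y x J) = PP"
proof -
  have "distr PP2 PP (\<lambda>(x, y). override_on y x J)
      = distr PP2 PP (fst \<circ> (\<lambda>(x, y). (override_on y x J, override_on x y J)))"
    by (intro arg_cong[where f = "distr PP2 PP"]) auto
  also have "\<dots> = distr (distr PP2 PP2 (\<lambda>(x, y). (override_on y x J, override_on x y J))) PP fst"
    by (rule distr_distr[symmetric]) measurable
  also have "\<dots> = PP" unfolding distr_swap_coordinates by (rule PP.distr_pair_fst)
  finally show ?thesis .
qed

lemma distr_override_on': "distr PP2 PP (\<lambda>(x, y). override_on x y J) = PP"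
proof -
  have "(\<lambda>(x, y). override_on x y J) = (\<lambda>(x :: 'i \<Rightarrow> 'a, y). override_on y x (- J))"
    by (auto simp: fun_eq_iff override_on_def)
  then show ?thesis using distr_override_on[of "- J"] by simp
qed

lemma Lp_bound_override_on:
  assumes "Lp_bound PP p f b"
  shows "Lp_bound PP2 p (\<lambda>(x, y). f (override_on y x J)) b"
    and "Lp_bound PP2 p (\<lambda>(x, y). f (override_on x y J)) b"
    and "Lp_bound PP2 p (\<lambda>(x, y). f x) b"
proof -
  have [measurable]: "f \<in> borel_measurable PP" using assms by (simp add: Lp_bound_def)
  have "Lp_bound (distr PP2 PP (\<lambda>(x, y). override_on y x J)) p f b"
    "Lp_bound (distr PP2 PP (\<lambda>(x, y). override_on x y J)) p f b"
    "Lp_bound (distr PP2 PP fst) p f b"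
    using assms by (simp_all add: distr_override_on distr_override_on' PP.distr_pair_fst)
  then show "Lp_bound PP2 p (\<lambda>(x, y). f (override_on y x J)) b"
    "Lp_bound PP2 p (\<lambda>(x, y). f (override_on x y J)) b"
    "Lp_bound PP2 p (\<lambda>(x, y). f x) b"
    by (simp_all add: Lp_bound_distr case_prod_beta')
qed

text \<open>Averaging over one of the two points is a contraction in Lp, by Jensen's inequality.\<close>
lemma Lp_bound_integral_snd:
  assumes "Lp_bound PP2 p (\<lambda>(x, y). h x y) b" "1 \<le> p"
  shows "Lp_bound PP p (\<lambda>x. \<integral>y. h x y \<partial>PP) b"
proof -
  have h [measurable]: "(\<lambda>(x, y). h x y) \<in> borel_measurable PP2" using assms by (simp add: Lp_bound_def)
  have "(\<integral>\<^sup>+x. ennreal (\<bar>\<integral>y. h x y \<partial>PP\<bar> powr p) \<partial>PP)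
      \<le> (\<integral>\<^sup>+x. (\<integral>\<^sup>+y. ennreal (\<bar>h x y\<bar> powr p) \<partial>PP) \<partial>PP)"
    using assms(2) by (intro nn_integral_mono jensen_abs_powr prob_PP) measurable
  also have "\<dots> = (\<integral>\<^sup>+z. ennreal (\<bar>case z of (x, y) \<Rightarrow> h x y\<bar> powr p) \<partial>PP2)"
    by (subst PP.nn_integral_fst[symmetric]) auto
  also have "\<dots> \<le> ennreal (b powr p)" using assms by (simp add: Lp_bound_def)
  finally show ?thesis using assms by (auto simp: Lp_bound_def)
qed

definition cond_mean :: "'i set \<Rightarrow> (('i \<Rightarrow> 'a) \<Rightarrow> real) \<Rightarrow> ('i \<Rightarrow> 'a) \<Rightarrow> real" where
  "cond_mean J f x = (\<integral>y. f (override_on y x J) \<partial>PP)"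

lemma measurable_cond_mean [measurable]:
  assumes [measurable]: "f \<in> borel_measurable PP"
  shows "cond_mean J f \<in> borel_measurable PP"
  unfolding cond_mean_def by measurable

lemma Lp_bound_cond_mean:
  assumes "Lp_bound PP p f b" "1 \<le> p"
  shows "Lp_bound PP p (cond_mean J f) b"
  using Lp_bound_integral_snd[OF Lp_bound_override_on(1)[OF assms(1), of J] assms(2)]
  by (simp add: cond_mean_def[abs_def])

lemma cond_mean_empty [simp]: "cond_mean {} f x = (\<integral>y. f y \<partial>PP)"
  by (simp add: cond_mean_def)

lemma cond_mean_override_on:
  assumes "J \<subseteq> J'"
  shows "cond_mean J f (override_on y x J') = cond_mean J f x"
proof -
  have "override_on z (override_on y x J') J = override_on z x J" for z
    using assms by (auto simp: override_on_def fun_eq_iff)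
  then show ?thesis by (simp add: cond_mean_def)
qed

text \<open>
  The defining property of the conditional expectation: \<open>cond_mean\<close> may be replaced by the function
  itself when it is tested against functions of the revealed coordinates. It follows from
  Fubini's theorem because \<open>override_on y x J\<close> has the same law as \<open>x\<close>.
\<close>
lemma integral_cond_mean_mult:
  assumes [measurable]: "f \<in> borel_measurable PP" "g \<in> borel_measurable PP"
    and int: "integrable PP (\<lambda>x. f x * g x)"
    and g: "\<And>x y. g (override_on y x J) = g x"
  shows "(\<integral>x. cond_mean J f x * g x \<partial>PP) = (\<integral>x. f x * g x \<partial>PP)"
proof -
  let ?T = "\<lambda>(x, y). override_on y x J"
  have "integrable (distr PP2 PP ?T) (\<lambda>x. f x * g x)" using int by (simp add: distr_override_on)
  then have i: "integrable PP2 (\<lambda>z. f (?T z) * g (?T z))" by (subst (asm) integrable_distr_eq) auto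
  have "(\<integral>x. f x * g x \<partial>PP) = (\<integral>x. f x * g x \<partial>distr PP2 PP ?T)" by (simp add: distr_override_on)
  also have "\<dots> = (\<integral>z. f (?T z) * g (?T z) \<partial>PP2)" by (rule integral_distr) auto
  also have "\<dots> = (\<integral>x. \<integral>y. f (override_on y x J) * g (override_on y x J) \<partial>PP \<partial>PP)"
    using PP2.integral_fst'[OF i] by simp
  also have "\<dots> = (\<integral>x. cond_mean J f x * g x \<partial>PP)"
    by (simp add: g cond_mean_def)
  finally show ?thesis ..
qed

text \<open>
  Revealing one more coordinate changes the conditional mean by at most the effect of resampling
  that coordinate: exchanging the coordinates outside \<open>insert k J\<close> turns the increment into an average
  of differences between a function and its version with coordinate \<open>k\<close> resampled.
\<close>
lemma cond_mean_insert_diff: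
  assumes f: "Lp_bound PP p f a" and d: "Lp_bound PP2 p (\<lambda>(x, y). f x - f (override_on x y {k})) b"
    and p: "1 \<le> p" and k: "k \<notin> J"
  shows "Lp_bound PP p (\<lambda>x. cond_mean (insert k J) f x - cond_mean J f x) b"
proof -
  have [measurable]: "f \<in> borel_measurable PP" using f by (simp add: Lp_bound_def)
  let ?T = "\<lambda>(x, y). (override_on y x (insert k J), override_on x y (insert k J))"
  have "Lp_bound (distr PP2 PP2 ?T) p (\<lambda>(x, y). f x - f (override_on x y {k})) b"
    unfolding distr_swap_coordinates by (rule d)
  then have "Lp_bound PP2 p (\<lambda>z. case ?T z of (x, y) \<Rightarrow> f x - f (override_on x y {k})) b"
    by (subst (asm) Lp_bound_distr) auto
  also have "(\<lambda>z. case ?T z of (x, y) \<Rightarrow> f x - f (override_on x y {k}))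
      = (\<lambda>(x, y). f (override_on y x (insert k J)) - f (override_on y x J))"
  proof -
    have "override_on (override_on y x (insert k J)) (override_on x y (insert k J)) {k} = override_on y x J"
      for x y :: "'i \<Rightarrow> 'a" using k by (auto simp: override_on_def)
    then show ?thesis by auto
  qed
  finally have "Lp_bound PP p (\<lambda>x. \<integral>y. f (override_on y x (insert k J)) - f (override_on y x J) \<partial>PP) b"
    using p by (rule Lp_bound_integral_snd)
  moreover have "AE x in PP. cond_mean (insert k J) f x - cond_mean J f x
      = (\<integral>y. f (override_on y x (insert k J)) - f (override_on y x J) \<partial>PP)"
  proof -
    have "AE x in PP. integrable PP (\<lambda>y. f (override_on y x J'))" for J'
      using PP2.AE_integrable_fst'[OF Lp_bound_integrable[OF prob_PP2 Lp_bound_override_on(1)[OF f] p]]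
      by simp
    from this[of J] this[of "insert k J"] show ?thesis
      by eventually_elim (simp add: cond_mean_def)
  qed
  ultimately show ?thesis by (auto intro: Lp_bound_cong_AE)
qed

text \<open>
  The increments of the conditional mean are orthogonal to functions of the coordinates revealed
  before, in particular to the dual element \<open>?S\<close> of the centred conditional mean, and so the
  martingale step applies.
\<close>
lemma Lp_bound_cond_mean_centered:
  assumes f: "Lp_bound PP p f a" and p: "2 \<le> p" and J: "finite J"
    and d: "\<And>k. Lp_bound PP2 p (\<lambda>(x, y). f x - f (override_on x y {k})) (\<Delta> k)"
  shows "Lp_bound PP p (\<lambda>x. cond_mean J f x - (\<integral>y. f y \<partial>PP)) (sqrt (burkholder_const p * (\<Sum>k\<in>J. (\<Delta> k)\<^sup>2)))"
  using J
proof induct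
  case empty
  then show ?case by (simp add: Lp_bound_def)
next
  case (insert k J)
  have [measurable]: "f \<in> borel_measurable PP" using f by (simp add: Lp_bound_def)
  let ?X = "\<lambda>x. cond_mean J f x - (\<integral>y. f y \<partial>PP)"
  let ?Y = "\<lambda>x. cond_mean (insert k J) f x - cond_mean J f x"
  let ?S = "\<lambda>x. sgn (?X x) * \<bar>?X x\<bar> powr (p - 1)"
  let ?a = "sqrt (burkholder_const p * (\<Sum>k\<in>J. (\<Delta> k)\<^sup>2))"
  have X: "Lp_bound PP p ?X ?a" by (rule insert)
  have Y: "Lp_bound PP p ?Y (\<Delta> k)" using cond_mean_insert_diff[OF f d] p insert by simp
  have p1: "1 < p" using p by simp
  have iS: "integrable PP (\<lambda>x. ?S x * g x)" if "Lp_bound PP p g b" for g b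
    using Lp_bound_dual_integrable[OF X that p1] .
  have fS: "(\<integral>x. cond_mean J' f x * ?S x \<partial>PP) = (\<integral>x. f x * ?S x \<partial>PP)" if "J \<subseteq> J'" for J'
  proof (rule integral_cond_mean_mult)
    show "integrable PP (\<lambda>x. f x * ?S x)" using iS[OF f] by (simp add: mult_ac)
    show "?S (override_on y x J') = ?S x" for x y by (simp add: cond_mean_override_on[OF that])
  qed measurable
  have iJ: "integrable PP (\<lambda>x. cond_mean J' f x * ?S x)" for J'
    using iS[OF Lp_bound_cond_mean[OF f, of J']] p by (simp add: mult_ac)
  have "(\<integral>x. ?S x * ?Y x \<partial>PP) = (\<integral>x. cond_mean (insert k J) f x * ?S x - cond_mean J f x * ?S x \<partial>PP)"
    by (intro Bochner_Integration.integral_cong) (auto simp: algebra_simps)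
  also have "\<dots> = 0"
    using iJ fS[of "insert k J"] fS[of J] by (subst Bochner_Integration.integral_diff) auto
  finally have "Lp_bound PP p (\<lambda>x. ?X x + ?Y x) (sqrt (?a\<^sup>2 + burkholder_const p * (\<Delta> k)\<^sup>2))"
    using X Y p by (intro Lp_bound_martingale_step) auto
  moreover have "?a\<^sup>2 + burkholder_const p * (\<Delta> k)\<^sup>2 = burkholder_const p * (\<Sum>k\<in>insert k J. (\<Delta> k)\<^sup>2)"
    using insert burkholder_const_ge[OF p] by (simp add: sum_nonneg algebra_simps)
  ultimately show ?case by simp
qed

text \<open>
  When a further coordinate is revealed, the mixed terms vanish by the tower property and only the
  product of the two increments is added to the covariance.
\<close>
lemma cov_cond_mean_le:
  assumes f: "Lp_bound PP 2 f a" and g: "Lp_bound PP 2 g b" and J: "finite J"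
    and df: "\<And>k. Lp_bound PP2 2 (\<lambda>(x, y). f x - f (override_on x y {k})) (\<Delta> k)"
    and dg: "\<And>k. Lp_bound PP2 2 (\<lambda>(x, y). g x - g (override_on x y {k})) (\<Gamma> k)"
  shows "\<bar>(\<integral>x. cond_mean J f x * cond_mean J g x \<partial>PP) - (\<integral>x. f x \<partial>PP) * (\<integral>x. g x \<partial>PP)\<bar>
     \<le> (\<Sum>k\<in>J. \<Delta> k * \<Gamma> k)"
  using J
proof induct
  case empty
  then show ?case using PP.prob_space by simp
next
  case (insert k J)
  have fg [measurable]: "f \<in> borel_measurable PP" "g \<in> borel_measurable PP"
    using f g by (simp_all add: Lp_bound_def)
  let ?D = "\<lambda>h x. cond_mean (insert k J) h x - cond_mean J h x"
  have i: "integrable PP (\<lambda>x. u x * v x)" if "Lp_bound PP 2 u c" "Lp_bound PP 2 v d" for u v c d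
    using Lp_bound_mult[of PP 1 u c v d] that by (auto intro!: Lp_bound_integrable[OF prob_PP])
  have L2: "Lp_bound PP 2 (cond_mean J' f) a" "Lp_bound PP 2 (cond_mean J' g) b" for J'
    using f g by (auto intro: Lp_bound_cond_mean)
  have tower: "(\<integral>x. cond_mean J' u x * cond_mean J v x \<partial>PP) = (\<integral>x. u x * cond_mean J v x \<partial>PP)"
    if "J \<subseteq> J'" "Lp_bound PP 2 u c" "Lp_bound PP 2 v d" for J' u v c d
  proof (rule integral_cond_mean_mult)
    show "integrable PP (\<lambda>x. u x * cond_mean J v x)"
      using that i Lp_bound_cond_mean[of 2 v d J] by auto
    show "cond_mean J v (override_on y x J') = cond_mean J v x" for x y
      by (rule cond_mean_override_on[OF that(1)])
    have [measurable]: "v \<in> borel_measurable PP" "u \<in> borel_measurable PP"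
      using that by (simp_all add: Lp_bound_def)
    show "u \<in> borel_measurable PP" "cond_mean J v \<in> borel_measurable PP" by measurable
  qed
  have "(\<integral>x. cond_mean (insert k J) f x * cond_mean (insert k J) g x \<partial>PP)
     = (\<integral>x. cond_mean J f x * cond_mean J g x + (cond_mean (insert k J) f x * cond_mean J g x - cond_mean J f x * cond_mean J g x)
         + (cond_mean (insert k J) g x * cond_mean J f x - cond_mean J g x * cond_mean J f x)
         + ?D f x * ?D g x \<partial>PP)"
    by (intro Bochner_Integration.integral_cong) (auto simp: algebra_simps)
  also have "\<dots> = (\<integral>x. cond_mean J f x * cond_mean J g x \<partial>PP) + (\<integral>x. ?D f x * ?D g x \<partial>PP)"
  proof -
    have iD: "integrable PP (\<lambda>x. ?D f x * ?D g x)"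
      by (rule i[OF Lp_bound_diff[OF L2(1) L2(1)] Lp_bound_diff[OF L2(2) L2(2)]]) auto
    have ii: "integrable PP (\<lambda>x. cond_mean J' f x * cond_mean J'' g x)"
      "integrable PP (\<lambda>x. cond_mean J'' g x * cond_mean J' f x)" for J' J''
      by (rule i[OF L2(1) L2(2)] i[OF L2(2) L2(1)])+
    have z1: "(\<integral>x. cond_mean (insert k J) f x * cond_mean J g x - cond_mean J f x * cond_mean J g x \<partial>PP) = 0"
      using tower[OF _ f g, of "insert k J"] tower[OF _ f g, of J] ii
      by (subst Bochner_Integration.integral_diff) auto
    have z2: "(\<integral>x. cond_mean (insert k J) g x * cond_mean J f x - cond_mean J g x * cond_mean J f x \<partial>PP) = 0"
      using tower[OF _ g f, of "insert k J"] tower[OF _ g f, of J] ii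
      by (subst Bochner_Integration.integral_diff) auto
    show ?thesis
      using z1 z2 ii iD
      by (subst Bochner_Integration.integral_add, (intro Bochner_Integration.integrable_add Bochner_Integration.integrable_diff ii iD)+)+
         simp
  qed
  finally have eq: "(\<integral>x. cond_mean (insert k J) f x * cond_mean (insert k J) g x \<partial>PP)
     = (\<integral>x. cond_mean J f x * cond_mean J g x \<partial>PP) + (\<integral>x. ?D f x * ?D g x \<partial>PP)" .
  have "Lp_bound PP 1 (\<lambda>x. ?D f x * ?D g x) (\<Delta> k * \<Gamma> k)"
    using cond_mean_insert_diff[OF f df] cond_mean_insert_diff[OF g dg] insert
    by (intro Lp_bound_mult) auto
  then have "\<bar>\<integral>x. ?D f x * ?D g x \<partial>PP\<bar> \<le> \<Delta> k * \<Gamma> k"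
    by (intro Lp_bound_integral[OF prob_PP]) auto
  with eq insert show ?case by simp
qed

section \<open>Convergence of conditional means and the two inequalities for functions of independent variables\<close>

text \<open>
  A cylinder set does not notice the resampling of coordinates outside its base. The sets with the
  convergence property form a Dynkin system: for a disjoint union all but finitely
  many members have small total probability, before and after resampling.
\<close>
lemma prob_override_on_sym_diff_tendsto:
  assumes "A \<in> sets PP"
  shows "((\<lambda>J. measure PP2 {z \<in> space PP2. (override_on (snd z) (fst z) J \<in> A) \<noteq> (fst z \<in> A)}) \<longlongrightarrow> 0)
     (finite_subsets_at_top UNIV)"
proof -
  define D where "D = (\<lambda>A J. {z \<in> space PP2. (override_on (snd z) (fst z) J \<in> A) \<noteq> (fst z \<in> A)})"
  have D_meas: "D A J \<in> sets PP2" if "A \<in> sets PP" for A J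
    unfolding D_def using that by measurable
  have "Int_stable (prod_algebra UNIV N)" by (rule Int_stable_prod_algebra)
  moreover have "prod_algebra UNIV N \<subseteq> Pow (\<Pi>\<^sub>E i\<in>UNIV. space (N i))" by (rule prod_algebra_sets_into_space)
  moreover have "A \<in> sigma_sets (\<Pi>\<^sub>E i\<in>UNIV. space (N i)) (prod_algebra UNIV N)" using assms by (simp add: sets_PiM)
  ultimately have "((\<lambda>J. measure PP2 (D A J)) \<longlongrightarrow> 0) (finite_subsets_at_top UNIV)"
  proof (induct rule: sigma_sets_induct_disjoint)
    case (basic A)
    then obtain F E where A: "A = prod_emb UNIV N F (Pi\<^sub>E F E)" and F: "finite F" by (rule prod_algebraE)
    have "D A J = {}" if "F \<subseteq> J" for J
      using that by (auto simp: D_def A prod_emb_def space_N PiE_iff override_on_def subset_eq)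
    then have "\<forall>\<^sub>F J in finite_subsets_at_top UNIV. measure PP2 (D A J) = 0"
      unfolding eventually_finite_subsets_at_top using F by (intro exI[of _ F]) auto
    then show ?case by (rule tendsto_eventually)
  next
    case empty
    show ?case by (simp add: D_def)
  next
    case (compl A)
    have "D ((\<Pi>\<^sub>E i\<in>UNIV. space (N i)) - A) J = D A J" for J
      by (auto simp: D_def space_N)
    then show ?case using compl by simp
  next
    case (union A)
    have A: "A i \<in> sets PP" for i using union by (auto simp: sets_PiM)
    define R where "R = (\<lambda>n. \<Union>i\<in>{n..}. A i)"
    have R: "R n \<in> sets PP" for n unfolding R_def using A by auto
    have R0: "(\<lambda>n. measure PP (R n)) \<longlonglongrightarrow> 0"
    proof -
      have "(\<lambda>n. measure PP (R n)) \<longlonglongrightarrow> measure PP (\<Inter>n. R n)"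
        using R by (intro PP.finite_Lim_measure_decseq) (auto simp: decseq_def R_def intro: order_trans)
      moreover have "(\<Inter>n. R n) = {}"
      proof (rule ccontr)
        assume "(\<Inter>n. R n) \<noteq> {}"
        then obtain x where x: "\<And>n. x \<in> R n" by auto
        from x[of 0] obtain i where i: "x \<in> A i" by (auto simp: R_def)
        from x[of "Suc i"] obtain j where j: "j \<ge> Suc i" "x \<in> A j" by (auto simp: R_def)
        then have "A i \<inter> A j = {}" using union(1) by (auto simp: disjoint_family_on_def)
        with i j show False by auto
      qed
      ultimately show ?thesis by simp
    qed
    show ?case
    proof (rule order_tendstoI)
      fix \<eta> :: real assume "0 < \<eta>"
      then have "\<forall>\<^sub>F n in sequentially. measure PP (R n) < \<eta> / 4"
        using R0 by (intro order_tendstoD) auto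
      then obtain n where n: "measure PP (R n) < \<eta> / 4" by (auto simp: eventually_sequentially)
      have "((\<lambda>J. \<Sum>i<n. measure PP2 (D (A i) J)) \<longlongrightarrow> (\<Sum>i<n. 0)) (finite_subsets_at_top UNIV)"
        by (intro tendsto_sum union)
      then have "\<forall>\<^sub>F J in finite_subsets_at_top UNIV. (\<Sum>i<n. measure PP2 (D (A i) J)) < \<eta> / 2"
        using \<open>0 < \<eta>\<close> by (intro order_tendstoD) auto
      then show "\<forall>\<^sub>F J in finite_subsets_at_top UNIV. measure PP2 (D (\<Union> (range A)) J) < \<eta>"
      proof eventually_elim
        case (elim J)
        let ?U = "{z \<in> space PP2. override_on (snd z) (fst z) J \<in> R n}" and ?W = "{z \<in> space PP2. fst z \<in> R n}"
        have meas: "?U \<in> sets PP2" "?W \<in> sets PP2" using R by measurable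
        have U: "measure PP2 ?U = measure PP (R n)"
        proof -
          have "measure PP (R n) = measure (distr PP2 PP (\<lambda>(x, y). override_on y x J)) (R n)"
            by (simp add: distr_override_on)
          also have "\<dots> = measure PP2 ?U"
            using R by (subst measure_distr) (auto simp: vimage_def Int_def case_prod_beta' conj_commute)
          finally show ?thesis ..
        qed
        have W: "measure PP2 ?W = measure PP (R n)"
        proof -
          have "measure PP (R n) = measure (distr PP2 PP fst) (R n)"
            by (simp add: PP.distr_pair_fst)
          also have "\<dots> = measure PP2 ?W"
            using R by (subst measure_distr) (auto simp: vimage_def Int_def conj_commute)
          finally show ?thesis ..
        qed
        have sub: "D (\<Union> (range A)) J \<subseteq> (\<Union>i<n. D (A i) J) \<union> (?U \<union> ?W)"
        proof
          fix z assume "z \<in> D (\<Union> (range A)) J"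
          then obtain i where z: "z \<in> space PP2" and i: "(override_on (snd z) (fst z) J \<in> A i) \<noteq> (fst z \<in> A i)"
            unfolding D_def by auto
          show "z \<in> (\<Union>i<n. D (A i) J) \<union> (?U \<union> ?W)"
          proof (cases "i < n")
            case True then show ?thesis using z i by (auto simp: D_def)
          next
            case False then show ?thesis using z i by (auto simp: R_def)
          qed
        qed
        have "measure PP2 (D (\<Union> (range A)) J) \<le> measure PP2 ((\<Union>i<n. D (A i) J) \<union> (?U \<union> ?W))"
          using A D_meas meas by (intro PP2.finite_measure_mono[OF sub]) auto
        also have "\<dots> \<le> measure PP2 (\<Union>i<n. D (A i) J) + measure PP2 (?U \<union> ?W)"
          using A D_meas meas by (intro measure_Un_le) auto
        also have "\<dots> \<le> (\<Sum>i<n. measure PP2 (D (A i) J)) + (measure PP2 ?U + measure PP2 ?W)"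
          using A D_meas meas by (intro add_mono PP2.finite_measure_subadditive_finite measure_Un_le) auto
        also have "\<dots> < \<eta>" using elim n U W by simp
        finally show ?case .
      qed
    qed (auto intro!: always_eventually order_less_le_trans[OF _ measure_nonneg])
  qed
  then show ?thesis by (simp add: D_def)
qed

definition resampling_converges :: "real \<Rightarrow> (('i \<Rightarrow> 'a) \<Rightarrow> real) \<Rightarrow> bool" where
  "resampling_converges p f \<longleftrightarrow> (\<forall>\<eta>>0. \<forall>\<^sub>F J in finite_subsets_at_top UNIV.
     Lp_bound PP2 p (\<lambda>(x, y). f (override_on y x J) - f x) \<eta>)"

lemma resampling_converges_indicator:
  assumes A [measurable]: "A \<in> sets PP" and p: "0 < p"
  shows "resampling_converges p (indicator A)"
  unfolding resampling_converges_def
proof (intro allI impI)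
  fix \<eta> :: real assume \<eta>: "0 < \<eta>"
  let ?D = "\<lambda>J. {z \<in> space PP2. (override_on (snd z) (fst z) J \<in> A) \<noteq> (fst z \<in> A)}"
  have "\<forall>\<^sub>F J in finite_subsets_at_top UNIV. measure PP2 (?D J) < \<eta> powr p"
    using prob_override_on_sym_diff_tendsto[OF A] \<eta> by (intro order_tendstoD) auto
  then show "\<forall>\<^sub>F J in finite_subsets_at_top UNIV.
     Lp_bound PP2 p (\<lambda>(x, y). indicator A (override_on y x J) - indicator A x) \<eta>"
  proof eventually_elim
    case (elim J)
    have "(\<integral>\<^sup>+z. ennreal (\<bar>case z of (x, y) \<Rightarrow> indicator A (override_on y x J) - indicator A x\<bar> powr p) \<partial>PP2)
       = (\<integral>\<^sup>+z. indicator (?D J) z \<partial>PP2)"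
      by (intro nn_integral_cong) (auto simp: indicator_def)
    also have "\<dots> = emeasure PP2 (?D J)" by (intro nn_integral_indicator) measurable
    also have "\<dots> \<le> ennreal (\<eta> powr p)" using elim by (simp add: PP2.emeasure_eq_measure ennreal_leI)
    finally show ?case using \<eta> by (auto simp: Lp_bound_def)
  qed
qed

lemma resampling_converges_sum:
  assumes "finite I" "\<And>i. i \<in> I \<Longrightarrow> resampling_converges p (f i)" "1 \<le> p"
  shows "resampling_converges p (\<lambda>x. \<Sum>i\<in>I. c i * f i x)"
  unfolding resampling_converges_def
proof (intro allI impI)
  fix \<eta> :: real assume \<eta>: "0 < \<eta>"
  define \<theta> where "\<theta> = \<eta> / ((\<Sum>i\<in>I. \<bar>c i\<bar>) + 1)"
  have s: "(\<Sum>i\<in>I. \<bar>c i\<bar>) \<ge> 0" by (intro sum_nonneg) auto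
  then have \<theta>: "\<theta> > 0" using \<eta> by (simp add: \<theta>_def add_nonneg_pos)
  have "\<forall>\<^sub>F J in finite_subsets_at_top UNIV. \<forall>i\<in>I. Lp_bound PP2 p (\<lambda>(x, y). f i (override_on y x J) - f i x) \<theta>"
    using assms(2) \<theta> by (intro eventually_ball_finite assms(1)) (auto simp: resampling_converges_def)
  then show "\<forall>\<^sub>F J in finite_subsets_at_top UNIV.
     Lp_bound PP2 p (\<lambda>(x, y). (\<Sum>i\<in>I. c i * f i (override_on y x J)) - (\<Sum>i\<in>I. c i * f i x)) \<eta>"
  proof eventually_elim
    case (elim J)
    have "Lp_bound PP2 p (\<lambda>z. \<Sum>i\<in>I. c i * (case z of (x, y) \<Rightarrow> f i (override_on y x J) - f i x)) (\<Sum>i\<in>I. \<bar>c i\<bar> * \<theta>)"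
      using elim assms by (intro Lp_bound_sum Lp_bound_cmult) auto
    moreover have "(\<Sum>i\<in>I. \<bar>c i\<bar> * \<theta>) \<le> \<eta>"
    proof -
      have "(\<Sum>i\<in>I. \<bar>c i\<bar> * \<theta>) \<le> ((\<Sum>i\<in>I. \<bar>c i\<bar>) + 1) * \<theta>"
        using \<theta> by (simp add: sum_distrib_right[symmetric])
      also have "\<dots> = \<eta>" using s by (simp add: \<theta>_def add_nonneg_eq_0_iff)
      finally show ?thesis .
    qed
    ultimately have "Lp_bound PP2 p (\<lambda>z. \<Sum>i\<in>I. c i * (case z of (x, y) \<Rightarrow> f i (override_on y x J) - f i x)) \<eta>"
      using assms(3) by (auto intro: Lp_bound_mono)
    then show ?case
      by (simp add: case_prod_beta' right_diff_distrib sum_subtractf)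
  qed
qed

text \<open>
  Simple functions inherit the property from sets. A function in Lp is close in Lp to a simple
  function, and resampling preserves the distance because it preserves the law.
\<close>
lemma resampling_converges_Lp:
  assumes f: "Lp_bound PP p f a" and p: "1 \<le> p"
  shows "resampling_converges p f"
  unfolding resampling_converges_def
proof (intro allI impI)
  fix \<eta> :: real assume \<eta>: "0 < \<eta>"
  have fm [measurable]: "f \<in> borel_measurable PP" using f by (simp add: Lp_bound_def)
  from borel_measurable_implies_sequence_metric[OF fm, of 0]
  obtain s where s: "\<And>i. simple_function PP (s i)" and lim: "\<And>x. (\<lambda>i. s i x) \<longlonglongrightarrow> f x"
    and bound: "\<And>i x. \<bar>s i x\<bar> \<le> 2 * \<bar>f x\<bar>"
    by auto
  have sm [measurable]: "s i \<in> borel_measurable PP" for i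
    using s by (rule borel_measurable_simple_function)
  have "(\<lambda>i. \<integral>\<^sup>+x. ennreal (\<bar>f x - s i x\<bar> powr p) \<partial>PP) \<longlonglongrightarrow> (\<integral>\<^sup>+x. 0 \<partial>PP)"
  proof (rule nn_integral_dominated_convergence[where w = "\<lambda>x. ennreal ((3 * \<bar>f x\<bar>) powr p)"])
    show "AE x in PP. ennreal (\<bar>f x - s i x\<bar> powr p) \<le> ennreal ((3 * \<bar>f x\<bar>) powr p)" for i
    proof (intro AE_I2 ennreal_leI powr_mono2)
      show "\<bar>f x - s i x\<bar> \<le> 3 * \<bar>f x\<bar>" for x using bound[of i x] by linarith
    qed (use p in auto)
    have "(\<integral>\<^sup>+x. ennreal (\<bar>3 * f x\<bar> powr p) \<partial>PP) \<le> ennreal ((\<bar>3\<bar> * a) powr p)"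
      using Lp_bound_cmult[OF f, of 3] unfolding Lp_bound_def by blast
    then show "(\<integral>\<^sup>+x. ennreal ((3 * \<bar>f x\<bar>) powr p) \<partial>PP) < \<infinity>"
      by (auto simp: abs_mult intro: le_less_trans)
    show "AE x in PP. (\<lambda>i. ennreal (\<bar>f x - s i x\<bar> powr p)) \<longlonglongrightarrow> 0"
    proof (rule AE_I2)
      fix x
      have "(\<lambda>i. \<bar>f x - s i x\<bar>) \<longlonglongrightarrow> \<bar>f x - f x\<bar>" by (intro tendsto_intros lim)
      then have "(\<lambda>i. ennreal (\<bar>f x - s i x\<bar> powr p)) \<longlonglongrightarrow> ennreal (0 powr p)"
        using p by (intro tendsto_ennrealI tendsto_powr') auto
      then show "(\<lambda>i. ennreal (\<bar>f x - s i x\<bar> powr p)) \<longlonglongrightarrow> 0" by simp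
    qed
  qed auto
  then have "\<forall>\<^sub>F i in sequentially. (\<integral>\<^sup>+x. ennreal (\<bar>f x - s i x\<bar> powr p) \<partial>PP) < ennreal ((\<eta>/3) powr p)"
    using \<eta> by (intro order_tendstoD) auto
  then obtain i where i: "(\<integral>\<^sup>+x. ennreal (\<bar>f x - s i x\<bar> powr p) \<partial>PP) < ennreal ((\<eta>/3) powr p)"
    by (auto simp: eventually_sequentially)
  let ?s = "s i"
  have d: "Lp_bound PP p (\<lambda>x. f x - ?s x) (\<eta>/3)" using i \<eta> by (simp add: Lp_bound_def)
  have "resampling_converges p ?s"
  proof -
    have "?s = (\<lambda>x. \<Sum>v\<in>range ?s. v * indicator (?s -` {v}) x)"
    proof
      fix x
      have "?s x = (\<Sum>v\<in>range ?s. indicator (?s -` {v}) x *\<^sub>R v)"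
        by (rule simple_function_indicator_representation_banach[OF s[of i], unfolded space_PP Int_UNIV_right, OF UNIV_I])
      also have "\<dots> = (\<Sum>v\<in>range ?s. v * indicator (?s -` {v}) x)"
        by (intro sum.cong) auto
      finally show "?s x = (\<Sum>v\<in>range ?s. v * indicator (?s -` {v}) x)" .
    qed
    moreover have "resampling_converges p (\<lambda>x. \<Sum>v\<in>range ?s. v * indicator (?s -` {v}) x)"
    proof (rule resampling_converges_sum)
      show "finite (range ?s)" using s[of i] by (simp add: simple_function_def)
      show "resampling_converges p (indicator (?s -` {v}))" for v
        using measurable_sets[OF sm[of i], of "{v}"] p by (intro resampling_converges_indicator) auto
    qed (rule p)
    ultimately show ?thesis by simp
  qed
  then have "\<forall>\<^sub>F J in finite_subsets_at_top UNIV. Lp_bound PP2 p (\<lambda>(x, y). ?s (override_on y x J) - ?s x) (\<eta>/3)"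
    using \<eta> by (simp add: resampling_converges_def)
  then show "\<forall>\<^sub>F J in finite_subsets_at_top UNIV. Lp_bound PP2 p (\<lambda>(x, y). f (override_on y x J) - f x) \<eta>"
  proof eventually_elim
    case (elim J)
    have "Lp_bound PP2 p (\<lambda>z. ((\<lambda>(x, y). f (override_on y x J) - ?s (override_on y x J)) z
        + (\<lambda>(x, y). ?s (override_on y x J) - ?s x) z) - (\<lambda>(x, y). f x - ?s x) z) (\<eta>/3 + \<eta>/3 + \<eta>/3)"
      by (intro Lp_bound_diff Lp_bound_add elim Lp_bound_override_on(1)[OF d, of J] Lp_bound_override_on(3)[OF d] p)
    then show ?case by (simp add: case_prod_beta')
  qed
qed

lemma cond_mean_converges:
  assumes f: "Lp_bound PP p f a" and p: "1 \<le> p" and \<eta>: "0 < \<eta>"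
  shows "\<forall>\<^sub>F J in finite_subsets_at_top UNIV. Lp_bound PP p (\<lambda>x. cond_mean J f x - f x) \<eta>"
proof -
  have [measurable]: "f \<in> borel_measurable PP" using f by (simp add: Lp_bound_def)
  have "\<forall>\<^sub>F J in finite_subsets_at_top UNIV. Lp_bound PP2 p (\<lambda>(x, y). f (override_on y x J) - f x) \<eta>"
    using resampling_converges_Lp[OF f p] \<eta> by (simp add: resampling_converges_def)
  then show ?thesis
  proof eventually_elim
    case (elim J)
    from Lp_bound_integral_snd[OF this p]
    have "Lp_bound PP p (\<lambda>x. \<integral>y. f (override_on y x J) - f x \<partial>PP) \<eta>" .
    moreover have "AE x in PP. integrable PP (\<lambda>y. f (override_on y x J))"
      using PP2.AE_integrable_fst'[OF Lp_bound_integrable[OF prob_PP2 Lp_bound_override_on(1)[OF f] p]]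
      by simp
    then have "AE x in PP. cond_mean J f x - f x = (\<integral>y. f (override_on y x J) - f x \<partial>PP)"
      by eventually_elim (use PP.prob_space in \<open>simp add: cond_mean_def\<close>)
    ultimately show ?case by (auto intro: Lp_bound_cong_AE)
  qed
qed

lemma eventually_finite: "\<forall>\<^sub>F J in finite_subsets_at_top UNIV. finite J"
  by (rule eventually_finite_subsets_at_top_weakI)

text \<open>
  A moment inequality of Efron--Stein type for functions of infinitely many independent variables,
  in terms of the effects \<open>\<Delta> k\<close> of resampling single variables.
\<close>
theorem Lp_bound_centered:
  assumes f: "Lp_bound PP p f a" and p: "2 \<le> p"
    and d: "\<And>k. Lp_bound PP2 p (\<lambda>(x, y). f x - f (override_on x y {k})) (\<Delta> k)"
    and S: "\<And>J. finite J \<Longrightarrow> (\<Sum>k\<in>J. (\<Delta> k)\<^sup>2) \<le> S"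
  shows "Lp_bound PP p (\<lambda>x. f x - (\<integral>y. f y \<partial>PP)) (sqrt (burkholder_const p * S))"
proof (rule Lp_bound_closed)
  show "0 \<le> sqrt (burkholder_const p * S)" "0 < p"
    using S[of "{}"] burkholder_const_ge[OF p] p by auto
  fix \<eta> :: real assume \<eta>: "0 < \<eta>"
  have "\<forall>\<^sub>F J in finite_subsets_at_top UNIV. Lp_bound PP p (\<lambda>x. cond_mean J f x - f x) \<eta> \<and> finite J"
    using cond_mean_converges[OF f _ \<eta>] eventually_finite p by (auto intro: eventually_conj)
  then obtain J where J: "Lp_bound PP p (\<lambda>x. cond_mean J f x - f x) \<eta>" "finite J"
    using eventually_happens'[OF finite_subsets_at_top_neq_bot] by blast
  have "Lp_bound PP p (\<lambda>x. (cond_mean J f x - (\<integral>y. f y \<partial>PP)) - (cond_mean J f x - f x))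
      (sqrt (burkholder_const p * (\<Sum>k\<in>J. (\<Delta> k)\<^sup>2)) + \<eta>)"
    using Lp_bound_cond_mean_centered[OF f p J(2) d] J p by (intro Lp_bound_diff) auto
  then have "Lp_bound PP p (\<lambda>x. f x - (\<integral>y. f y \<partial>PP)) (sqrt (burkholder_const p * (\<Sum>k\<in>J. (\<Delta> k)\<^sup>2)) + \<eta>)"
    by simp
  then show "Lp_bound PP p (\<lambda>x. f x - (\<integral>y. f y \<partial>PP)) (sqrt (burkholder_const p * S) + \<eta>)"
    using S[OF J(2)] burkholder_const_ge[OF p] p by (elim Lp_bound_mono) auto
qed

theorem cov_le_sum_influences:
  assumes f: "Lp_bound PP 2 f a" and g: "Lp_bound PP 2 g b"
    and df: "\<And>k. Lp_bound PP2 2 (\<lambda>(x, y). f x - f (override_on x y {k})) (\<Delta> k)"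
    and dg: "\<And>k. Lp_bound PP2 2 (\<lambda>(x, y). g x - g (override_on x y {k})) (\<Gamma> k)"
    and S: "\<And>J. finite J \<Longrightarrow> (\<Sum>k\<in>J. \<Delta> k * \<Gamma> k) \<le> S"
  shows "\<bar>(\<integral>x. f x * g x \<partial>PP) - (\<integral>x. f x \<partial>PP) * (\<integral>x. g x \<partial>PP)\<bar> \<le> S"
proof (rule field_le_epsilon)
  fix e :: real assume e: "0 < e"
  have ab: "0 \<le> a" "0 \<le> b" using f g by (auto simp: Lp_bound_def)
  define \<eta> where "\<eta> = e / (a + b + 1)"
  have \<eta>: "0 < \<eta>" using e ab by (simp add: \<eta>_def)
  have "\<forall>\<^sub>F J in finite_subsets_at_top UNIV. (Lp_bound PP 2 (\<lambda>x. cond_mean J f x - f x) \<eta>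
      \<and> Lp_bound PP 2 (\<lambda>x. cond_mean J g x - g x) \<eta>) \<and> finite J"
    using cond_mean_converges[OF f _ \<eta>] cond_mean_converges[OF g _ \<eta>]
      eventually_finite by (auto intro: eventually_conj)
  then obtain J where J: "Lp_bound PP 2 (\<lambda>x. cond_mean J f x - f x) \<eta>"
      "Lp_bound PP 2 (\<lambda>x. cond_mean J g x - g x) \<eta>" "finite J"
    using eventually_happens'[OF finite_subsets_at_top_neq_bot] by blast
  have L2: "Lp_bound PP 2 (cond_mean J f) a" using f by (auto intro: Lp_bound_cond_mean)
  have "Lp_bound PP 1 (\<lambda>x. (cond_mean J f x - f x) * g x + cond_mean J f x * (cond_mean J g x - g x)) (\<eta> * b + a * \<eta>)"
    using J g L2 by (intro Lp_bound_add Lp_bound_mult) auto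
  then have "\<bar>\<integral>x. (cond_mean J f x - f x) * g x + cond_mean J f x * (cond_mean J g x - g x) \<partial>PP\<bar> \<le> \<eta> * b + a * \<eta>"
    by (intro Lp_bound_integral[OF prob_PP]) auto
  also have "\<eta> * b + a * \<eta> \<le> e"
  proof -
    have "\<eta> * b + a * \<eta> \<le> \<eta> * (a + b + 1)" using \<eta> by (simp add: algebra_simps)
    also have "\<dots> = e" using ab by (simp add: \<eta>_def)
    finally show ?thesis .
  qed
  also have "(\<integral>x. (cond_mean J f x - f x) * g x + cond_mean J f x * (cond_mean J g x - g x) \<partial>PP)
     = (\<integral>x. cond_mean J f x * cond_mean J g x - f x * g x \<partial>PP)"
    by (intro Bochner_Integration.integral_cong) (auto simp: algebra_simps)
  also have "\<dots> = (\<integral>x. cond_mean J f x * cond_mean J g x \<partial>PP) - (\<integral>x. f x * g x \<partial>PP)"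
  proof (rule Bochner_Integration.integral_diff)
    have i: "integrable PP (\<lambda>x. u x * v x)" if "Lp_bound PP 2 u c" "Lp_bound PP 2 v d" for u v c d
      using Lp_bound_mult[of PP 1 u c v d] that by (auto intro!: Lp_bound_integrable[OF prob_PP])
    show "integrable PP (\<lambda>x. cond_mean J f x * cond_mean J g x)" "integrable PP (\<lambda>x. f x * g x)"
      using f g by (auto intro!: i Lp_bound_cond_mean)
  qed
  finally have 1: "\<bar>(\<integral>x. cond_mean J f x * cond_mean J g x \<partial>PP) - (\<integral>x. f x * g x \<partial>PP)\<bar> \<le> e" .
  have "\<bar>(\<integral>x. cond_mean J f x * cond_mean J g x \<partial>PP) - (\<integral>x. f x \<partial>PP) * (\<integral>x. g x \<partial>PP)\<bar> \<le> (\<Sum>k\<in>J. \<Delta> k * \<Gamma> k)"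
    by (rule cov_cond_mean_le[OF f g J(3) df dg])
  also have "\<dots> \<le> S" by (rule S[OF J(3)])
  finally show "\<bar>(\<integral>x. f x * g x \<partial>PP) - (\<integral>x. f x \<partial>PP) * (\<integral>x. g x \<partial>PP)\<bar> \<le> S + e" using 1 by linarith
qed

end

section \<open>Sums over the grid and matrices with bounded row and column sums\<close>

text \<open>
  The terms with positive \<open>h\<close> are dominated by a telescoping series that starts at \<open>1 / B\<close>.
  The order \<open>1 / B\<close> gives the row sums of the kernel matrix, and \<open>B = 1\<close> the summability over the grid.
\<close>
lemma sum_inverse_square_int_le:
  fixes F :: "int set" and B :: real
  assumes F: "finite F" and B: "1 \<le> B"
  shows "(\<Sum>h\<in>F. 1 / (B + \<bar>real_of_int h\<bar>)\<^sup>2) \<le> 3 / B"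
proof -
  have sym: "(\<Sum>h\<in>{- int n..int n}. 1 / (B + \<bar>real_of_int h\<bar>)\<^sup>2) \<le> 1 / B\<^sup>2 + 2 * (1 / B - 1 / (B + real n))" for n
  proof (induct n)
    case 0
    then show ?case by simp
  next
    case (Suc n)
    have set: "{- int (Suc n)..int (Suc n)} = insert (int (Suc n)) (insert (- int (Suc n)) {- int n..int n})"
      by auto
    have "1 / (B + real (Suc n))\<^sup>2 \<le> 1 / (B + real n) - 1 / (B + real (Suc n))"
    proof -
      have "1 / (B + real (Suc n))\<^sup>2 \<le> 1 / ((B + real n) * (B + real (Suc n)))"
        unfolding power2_eq_square using B by (intro divide_left_mono mult_right_mono) auto
      also have "\<dots> = 1 / (B + real n) - 1 / (B + real (Suc n))" using B by (simp add: field_simps)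
      finally show ?thesis .
    qed
    then show ?case unfolding set using Suc by (simp add: add_ac)
  qed
  obtain n where n: "F \<subseteq> {- int n..int n}"
  proof -
    have "F \<subseteq> {- int (nat (Max (abs ` F)))..int (nat (Max (abs ` F)))}"
    proof
      fix h assume h: "h \<in> F"
      have "\<bar>h\<bar> \<le> Max (abs ` F)" using F h by (intro Max_ge) auto
      then show "h \<in> {- int (nat (Max (abs ` F)))..int (nat (Max (abs ` F)))}" by auto
    qed
    then show ?thesis using that by blast
  qed
  have "(\<Sum>h\<in>F. 1 / (B + \<bar>real_of_int h\<bar>)\<^sup>2) \<le> (\<Sum>h\<in>{- int n..int n}. 1 / (B + \<bar>real_of_int h\<bar>)\<^sup>2)"
    by (rule sum_mono2[OF _ n]) auto
  also have "\<dots> \<le> 1 / B\<^sup>2 + 2 / B"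
  proof -
    have "0 \<le> 2 / (B + real n)" using B by (intro divide_nonneg_nonneg) auto
    then show ?thesis using sym[of n] by (simp only: right_diff_distrib)
  qed
  also have "\<dots> \<le> 3 / B"
  proof -
    have "1 / B\<^sup>2 \<le> 1 / B" unfolding power2_eq_square using B mult_right_mono[of 1 B B]
      by (intro divide_left_mono) auto
    then show ?thesis by simp
  qed
  finally show ?thesis .
qed

lemma sum_inverse_square_int_shift_le:
  fixes F :: "int set" and B :: real
  assumes F: "finite F" and B: "1 \<le> B"
  shows "(\<Sum>h\<in>F. 1 / (B + \<bar>real_of_int (h - a)\<bar>)\<^sup>2) \<le> 3 / B"
proof -
  have "(\<Sum>h\<in>F. 1 / (B + \<bar>real_of_int (h - a)\<bar>)\<^sup>2) = (\<Sum>h\<in>(\<lambda>h. h - a) ` F. 1 / (B + \<bar>real_of_int h\<bar>)\<^sup>2)"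
    by (subst sum.reindex) (auto simp: inj_on_def)
  also have "\<dots> \<le> 3 / B" using F B by (intro sum_inverse_square_int_le) auto
  finally show ?thesis .
qed

definition grid_dist :: "int \<times> int \<Rightarrow> int \<times> int \<Rightarrow> real" where
  "grid_dist s t = \<bar>real_of_int (fst s - fst t)\<bar> + \<bar>real_of_int (snd s - snd t)\<bar>"

lemma grid_dist_nonneg [simp]: "0 \<le> grid_dist s t"
  by (simp add: grid_dist_def)

lemma grid_dist_commute: "grid_dist s t = grid_dist t s"
  by (simp add: grid_dist_def abs_minus_commute)

lemma grid_dist_triangle: "grid_dist s t \<le> grid_dist k s + grid_dist k t"
  by (simp add: grid_dist_def)

text \<open>Since \<open>(1 + a + b)^2\<close> is at least \<open>(1 + a) * (1 + b)\<close>, exponent 4 splits into two summable squares.\<close>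
lemma sum_grid_decay_le:
  assumes "finite F" "4 \<le> r"
  shows "(\<Sum>k\<in>F. 1 / (1 + grid_dist k s) ^ r) \<le> 9"
proof -
  let ?g = "\<lambda>a h. 1 / (1 + \<bar>real_of_int (h - a)\<bar>)\<^sup>2 :: real"
  have pt: "1 / (1 + grid_dist k s) ^ r \<le> ?g (fst s) (fst k) * ?g (snd s) (snd k)" for k
  proof -
    define a b where "a = \<bar>real_of_int (fst k - fst s)\<bar>" and "b = \<bar>real_of_int (snd k - snd s)\<bar>"
    have ab: "a \<ge> 0" "b \<ge> 0" by (auto simp: a_def b_def)
    have "(1 + a)\<^sup>2 * (1 + b)\<^sup>2 \<le> (1 + a + b)\<^sup>2 * (1 + a + b)\<^sup>2"
      using ab by (intro mult_mono power_mono) auto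
    also have "\<dots> = (1 + a + b) ^ 4" by (simp add: power2_eq_square power4_eq_xxxx)
    also have "\<dots> \<le> (1 + a + b) ^ r" using ab assms by (intro power_increasing) auto
    finally have "1 / (1 + a + b) ^ r \<le> 1 / ((1 + a)\<^sup>2 * (1 + b)\<^sup>2)"
      using ab by (intro divide_left_mono) (auto intro!: mult_pos_pos zero_less_power)
    then show ?thesis by (simp add: grid_dist_def a_def b_def add_ac)
  qed
  have "(\<Sum>k\<in>F. 1 / (1 + grid_dist k s) ^ r) \<le> (\<Sum>k\<in>F. ?g (fst s) (fst k) * ?g (snd s) (snd k))"
    by (intro sum_mono pt)
  also have "\<dots> \<le> (\<Sum>k\<in>fst ` F \<times> snd ` F. ?g (fst s) (fst k) * ?g (snd s) (snd k))"
    using assms by (intro sum_mono2) (auto simp: subset_fst_snd)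
  also have "\<dots> = (\<Sum>h\<in>fst ` F. ?g (fst s) h) * (\<Sum>h\<in>snd ` F. ?g (snd s) h)"
    by (simp add: sum_product sum.cartesian_product case_prod_beta')
  also have "\<dots> \<le> 3 * 3"
    using assms sum_inverse_square_int_shift_le[of "fst ` F" 1 "fst s"] sum_inverse_square_int_shift_le[of "snd ` F" 1 "snd s"]
    by (intro mult_mono) (auto intro!: sum_nonneg)
  finally show ?thesis by simp
qed

text \<open>A nonnegative matrix whose rows and columns sum to at most \<open>W\<close> has operator norm at most \<open>W\<close>.\<close>
lemma schur_test:
  fixes w :: "'k \<Rightarrow> 's \<Rightarrow> real"
  assumes fin: "finite S" "finite J" and w: "\<And>k s. 0 \<le> w k s"
    and row: "\<And>k. (\<Sum>s\<in>S. w k s) \<le> W" and col: "\<And>s. (\<Sum>k\<in>J. w k s) \<le> W" and W: "0 \<le> W"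
  shows "(\<Sum>k\<in>J. (\<Sum>s\<in>S. \<bar>c s\<bar> * w k s)\<^sup>2) \<le> W\<^sup>2 * (\<Sum>s\<in>S. (c s)\<^sup>2)"
proof -
  have "(\<Sum>s\<in>S. \<bar>c s\<bar> * w k s)\<^sup>2 \<le> W * (\<Sum>s\<in>S. (c s)\<^sup>2 * w k s)" for k
  proof -
    have "(\<Sum>s\<in>S. \<bar>c s\<bar> * w k s)\<^sup>2 = (\<Sum>s\<in>S. sqrt (w k s) * (\<bar>c s\<bar> * sqrt (w k s)))\<^sup>2"
      by (intro arg_cong[where f = power2] sum.cong) (auto simp: w)
    also have "\<dots> \<le> (\<Sum>s\<in>S. (sqrt (w k s))\<^sup>2) * (\<Sum>s\<in>S. (\<bar>c s\<bar> * sqrt (w k s))\<^sup>2)"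
      by (rule Cauchy_Schwarz_ineq_sum)
    also have "\<dots> = (\<Sum>s\<in>S. w k s) * (\<Sum>s\<in>S. (c s)\<^sup>2 * w k s)"
      by (simp add: w power_mult_distrib)
    also have "\<dots> \<le> W * (\<Sum>s\<in>S. (c s)\<^sup>2 * w k s)"
      using row w by (intro mult_right_mono sum_nonneg) auto
    finally show ?thesis .
  qed
  then have "(\<Sum>k\<in>J. (\<Sum>s\<in>S. \<bar>c s\<bar> * w k s)\<^sup>2) \<le> (\<Sum>k\<in>J. W * (\<Sum>s\<in>S. (c s)\<^sup>2 * w k s))"
    by (intro sum_mono)
  also have "\<dots> = W * (\<Sum>s\<in>S. (c s)\<^sup>2 * (\<Sum>k\<in>J. w k s))"
    by (simp add: sum_distrib_left sum_distrib_right sum.swap[of _ J S] mult_ac)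
  also have "\<dots> \<le> W * (\<Sum>s\<in>S. (c s)\<^sup>2 * W)"
    using col W by (intro mult_left_mono sum_mono) auto
  also have "\<dots> = W\<^sup>2 * (\<Sum>s\<in>S. (c s)\<^sup>2)"
    by (simp add: sum_distrib_left power2_eq_square mult_ac)
  finally show ?thesis .
qed

lemma schur_bilinear:
  fixes w :: "'s \<Rightarrow> 's \<Rightarrow> real"
  assumes w: "\<And>s t. 0 \<le> w s t"
    and row: "\<And>s. (\<Sum>t\<in>S. w s t) \<le> W" and col: "\<And>t. (\<Sum>s\<in>S. w s t) \<le> W"
    and c: "(\<Sum>s\<in>S. (c s)\<^sup>2) \<le> 1" and c': "(\<Sum>s\<in>S. (c' s)\<^sup>2) \<le> 1" and W: "0 \<le> W"
  shows "(\<Sum>s\<in>S. \<Sum>t\<in>S. \<bar>c s\<bar> * \<bar>c' t\<bar> * w s t) \<le> W"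
proof -
  have "\<bar>u\<bar> * \<bar>v\<bar> \<le> u\<^sup>2 / 2 + v\<^sup>2 / 2" for u v :: real
    using sum_squares_bound[of "\<bar>u\<bar>" "\<bar>v\<bar>"] by simp
  then have "(\<Sum>s\<in>S. \<Sum>t\<in>S. \<bar>c s\<bar> * \<bar>c' t\<bar> * w s t)
      \<le> (\<Sum>s\<in>S. \<Sum>t\<in>S. ((c s)\<^sup>2 / 2 + (c' t)\<^sup>2 / 2) * w s t)"
    by (intro sum_mono mult_right_mono w) auto
  also have "\<dots> = (\<Sum>s\<in>S. (c s)\<^sup>2 / 2 * (\<Sum>t\<in>S. w s t)) + (\<Sum>t\<in>S. (c' t)\<^sup>2 / 2 * (\<Sum>s\<in>S. w s t))"
    unfolding sum_distrib_left distrib_right sum.distrib by (subst (2) sum.swap) simp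
  also have "\<dots> \<le> (\<Sum>s\<in>S. (c s)\<^sup>2 / 2 * W) + (\<Sum>t\<in>S. (c' t)\<^sup>2 / 2 * W)"
    using row col by (intro add_mono sum_mono mult_left_mono) auto
  also have "\<dots> = ((\<Sum>s\<in>S. (c s)\<^sup>2) + (\<Sum>t\<in>S. (c' t)\<^sup>2)) / 2 * W"
    by (simp add: sum_distrib_left sum_divide_distrib add_divide_distrib algebra_simps)
  also have "\<dots> \<le> 1 * W" using c c' W by (intro mult_right_mono) auto
  finally show ?thesis by simp
qed

section \<open>Decay and regularity of variance kernels\<close>

lemma variance_kernelD:
  assumes "variance_kernel K"
  shows "0 \<le> K x" "K x \<le> 1" "K (- x) = K x" "K C1_differentiable_on UNIV" "K 0 = 1"
    "0 \<le> u \<Longrightarrow> u \<le> v \<Longrightarrow> K v \<le> K u" "set_integrable lborel {0..} (\<lambda>x. x * K x)"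
  using assms by (auto simp: variance_kernel_def monotone_on_def)

lemma variance_kernel_abs:
  assumes "variance_kernel K" shows "K \<bar>x\<bar> = K x"
  using variance_kernelD(3)[OF assms, of x] by (simp add: abs_if)

text \<open>
  Monotonicity turns the integrability of \<open>t * K t\<close> into a pointwise bound: over the interval from
  \<open>x / 2\<close> to \<open>x\<close> the integrand is at least \<open>x / 2 * K x\<close>, so that \<open>x^2 * K x\<close> is bounded.
\<close>
lemma variance_kernel_decay:
  assumes K: "variance_kernel K"
  obtains \<kappa> where "0 < \<kappa>" "\<And>x. K x \<le> \<kappa> / (1 + \<bar>x\<bar>)\<^sup>2"
proof -
  note k = variance_kernelD[OF K]
  define I where "I = (LINT x:{0..}|lborel. x * K x)"
  have quad: "x\<^sup>2 * K x \<le> 4 * I" if x: "0 < x" for x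
  proof -
    have i: "set_integrable lborel {x/2..x} (\<lambda>x. x * K x)"
      by (rule set_integrable_subset[OF k(7)]) (use x in auto)
    have "x\<^sup>2 * K x / 4 = (LINT t:{x/2..x}|lborel. x/2 * K x)"
      using x by (simp add: power2_eq_square set_lebesgue_integral_def)
    also have "\<dots> \<le> (LINT t:{x/2..x}|lborel. t * K t)"
    proof (rule set_integral_mono[OF _ i])
      show "x/2 * K x \<le> t * K t" if "t \<in> {x/2..x}" for t
        using x that k(1) k(6)[of t x] by (intro mult_mono) auto
      show "set_integrable lborel {x/2..x} (\<lambda>t. x/2 * K x)"
        unfolding set_integrable_def by (intro integrable_scaleR_left integrable_real_indicator) (use x in auto)
    qed
    also have "\<dots> \<le> I" unfolding I_def set_lebesgue_integral_def
    proof (rule integral_mono)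
      show "integrable lborel (\<lambda>t. indicator {x/2..x} t *\<^sub>R (t * K t))"
        "integrable lborel (\<lambda>t. indicator {0..} t *\<^sub>R (t * K t))"
        using i k(7) by (auto simp: set_integrable_def)
      show "indicator {x/2..x} t *\<^sub>R (t * K t) \<le> indicator {0..} t *\<^sub>R (t * K t)" for t
        using x k(1)[of t] by (auto simp: indicator_def)
    qed
    finally show ?thesis by simp
  qed
  have I: "0 \<le> I" using quad[of 1] k(1)[of 1] by simp
  show ?thesis
  proof
    show "0 < 2 + 8 * I" using I by simp
    fix x :: real
    have "(1 + \<bar>x\<bar>)\<^sup>2 \<le> 2 + 2 * x\<^sup>2"
      using zero_le_power2[of "1 - \<bar>x\<bar>"] by (simp add: power2_eq_square algebra_simps)
    then have "K x * (1 + \<bar>x\<bar>)\<^sup>2 \<le> K x * (2 + 2 * x\<^sup>2)" using k(1) by (intro mult_left_mono)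
    also have "\<dots> = 2 * K x + 2 * (x\<^sup>2 * K x)" by (simp add: algebra_simps)
    also have "\<dots> \<le> 2 * 1 + 2 * (4 * I)"
    proof (intro add_mono mult_left_mono k(2))
      show "x\<^sup>2 * K x \<le> 4 * I"
      proof (cases "x = 0")
        case False
        then show ?thesis using quad[of "\<bar>x\<bar>"] by (simp add: variance_kernel_abs[OF K])
      qed (use I in simp)
    qed auto
    finally show "K x \<le> (2 + 8 * I) / (1 + \<bar>x\<bar>)\<^sup>2" by (simp add: pos_le_divide_eq)
  qed
qed

text \<open>
  The mean value theorem covers the unit interval, where the continuous derivative is bounded;
  further out \<open>1 - K x \<le> 1\<close> suffices.
\<close>
lemma variance_kernel_lipschitz_at_0:
  assumes K: "variance_kernel K"
  obtains L where "1 \<le> L" "\<And>x. 1 - K x \<le> L * \<bar>x\<bar>"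
proof -
  note k = variance_kernelD[OF K]
  from k(4) obtain D where D: "\<And>x. (K has_vector_derivative D x) (at x)" and cD: "continuous_on UNIV D"
    unfolding C1_differentiable_on_def by auto
  have "compact (D ` {0..1})"
    by (intro compact_continuous_image continuous_on_subset[OF cD]) auto
  then have "bounded (D ` {0..1})" by (rule compact_imp_bounded)
  then obtain L where L: "\<And>x. x \<in> {0..1} \<Longrightarrow> \<bar>D x\<bar> \<le> L"
    unfolding bounded_iff by (metis image_eqI real_norm_def)
  show ?thesis
  proof
    show "1 \<le> max 1 L" by simp
    fix x :: real
    show "1 - K x \<le> max 1 L * \<bar>x\<bar>"
    proof (cases "\<bar>x\<bar> \<le> 1")
      case True
      have "norm (K \<bar>x\<bar> - K 0) \<le> max 1 L * norm (\<bar>x\<bar> - 0)"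
      proof (rule field_differentiable_bound[where S = "{0..1}" and f' = D])
        show "(K has_field_derivative D z) (at z within {0..1})" for z
          using D[of z] by (simp add: has_real_derivative_iff_has_vector_derivative has_vector_derivative_at_within)
        show "norm (D z) \<le> max 1 L" if "z \<in> {0..1}" for z using L[OF that] by simp
      qed (use True in auto)
      then show ?thesis using k(5) by (simp add: variance_kernel_abs[OF K])
    next
      case False
      have "1 - K x \<le> 1 * \<bar>x\<bar>" using False k(1)[of x] by linarith
      also have "\<dots> \<le> max 1 L * \<bar>x\<bar>" by (intro mult_right_mono) auto
      finally show ?thesis .
    qed
  qed
qed

text \<open>
  The kernel weights along a line add up to the order of the bandwidth, as for the Riemann sums of
  an integrable function.
\<close>
lemma kernel_row_sum:
  fixes K :: "real \<Rightarrow> real" and F :: "int set"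
  assumes F: "finite F" and B: "1 \<le> B" and \<kappa>: "0 \<le> \<kappa>" and K: "\<And>x. K x \<le> \<kappa> / (1 + \<bar>x\<bar>)\<^sup>2"
  shows "(\<Sum>h\<in>F. K (real_of_int (h - a) / B)) \<le> 3 * \<kappa> * B"
proof -
  have "(\<Sum>h\<in>F. K (real_of_int (h - a) / B)) \<le> (\<Sum>h\<in>F. \<kappa> * B\<^sup>2 * (1 / (B + \<bar>real_of_int (h - a)\<bar>)\<^sup>2))"
  proof (rule sum_mono)
    fix h
    have "1 + \<bar>real_of_int (h - a) / B\<bar> = (B + \<bar>real_of_int (h - a)\<bar>) / B" using B by (simp add: field_simps)
    then show "K (real_of_int (h - a) / B) \<le> \<kappa> * B\<^sup>2 * (1 / (B + \<bar>real_of_int (h - a)\<bar>)\<^sup>2)"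
      using K[of "real_of_int (h - a) / B"] by (simp add: power_divide)
  qed
  also have "\<dots> = \<kappa> * B\<^sup>2 * (\<Sum>h\<in>F. 1 / (B + \<bar>real_of_int (h - a)\<bar>)\<^sup>2)" by (simp add: sum_distrib_left)
  also have "\<dots> \<le> \<kappa> * B\<^sup>2 * (3 / B)"
    using sum_inverse_square_int_shift_le[OF F B, of a] \<kappa> by (intro mult_left_mono) auto
  also have "\<dots> = 3 * \<kappa> * B" using B by (simp add: power2_eq_square)
  finally show ?thesis .
qed

section \<open>Quadratic forms in a weakly dependent field\<close>

text \<open>
  The field at the sites of \<open>S\<close> as functions of all innovations. Resampling the innovation
  at \<open>k\<close> affects the site \<open>s\<close> by at most the fifth inverse power of their distance: four powers
  are used up by the summation over the plane, and the fifth pays for the distance that the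
  bias of a kernel weight contributes.
\<close>
locale grid_field = coordinate_product N for N :: "int \<times> int \<Rightarrow> 'a measure" +
  fixes X :: "int \<times> int \<Rightarrow> (int \<times> int \<Rightarrow> 'a) \<Rightarrow> real" and S :: "(int \<times> int) set" and M A :: real
  assumes M: "4 \<le> M" and finite_S: "finite S"
    and moment: "\<And>s. s \<in> S \<Longrightarrow> Lp_bound PP M (X s) A"
    and influence: "\<And>s k. s \<in> S \<Longrightarrow>
      Lp_bound PP2 M (\<lambda>(x, y). X s x - X s (override_on x y {k})) (A / (1 + grid_dist k s) ^ 5)"
    and mean_zero: "\<And>s. s \<in> S \<Longrightarrow> (\<integral>x. X s x \<partial>PP) = 0"
begin

lemma integrable_X_mult: "s \<in> S \<Longrightarrow> t \<in> S \<Longrightarrow> integrable PP (\<lambda>x. X s x * X t x)"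
  using Lp_bound_mult[of PP "M / 2" "X s" A "X t" A] moment M
  by (intro Lp_bound_integrable[OF prob_PP, of "M / 2"]) auto

text \<open>
  An innovation cannot be close to both sites: one of its two effects decays at least like the
  distance of the sites, while the other one is summable over all innovations.
\<close>
lemma cov_decay:
  assumes s: "s \<in> S" and t: "t \<in> S"
  shows "\<bar>\<integral>x. X s x * X t x \<partial>PP\<bar> \<le> 576 * A\<^sup>2 / (1 + grid_dist s t) ^ 5"
proof -
  define u where "u = (\<lambda>k s. 1 / (1 + grid_dist k s) ^ 5)"
  have u0: "0 \<le> u k s" for k s by (simp add: u_def add_nonneg_nonneg)
  have L2: "Lp_bound PP 2 (X r) A" "Lp_bound PP2 2 (\<lambda>(x, y). X r x - X r (override_on x y {k})) (A * u k r)"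
    if "r \<in> S" for r k
    using Lp_bound_mono_exponent[OF prob_PP moment[OF that], of 2] M
      Lp_bound_mono_exponent[OF prob_PP2 influence[OF that], of 2 k] by (auto simp: u_def)
  \<comment> \<open>32 is \<open>2 ^ 5\<close>, from halving the distance of the sites\<close>
  have split: "u k s * u k t \<le> 32 * u s t * (u k s + u k t)" for k
  proof -
    have half: "u k r \<le> 32 * u s t" if "(1 + grid_dist s t) / 2 \<le> 1 + grid_dist k r" for r
    proof -
      have "((1 + grid_dist s t) / 2) ^ 5 \<le> (1 + grid_dist k r) ^ 5"
        using that by (intro power_mono) (auto simp: add_nonneg_nonneg)
      then have "1 / (1 + grid_dist k r) ^ 5 \<le> 1 / ((1 + grid_dist s t) / 2) ^ 5"
        by (intro divide_left_mono) (auto intro!: mult_pos_pos zero_less_power add_pos_nonneg)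
      then show ?thesis by (simp add: u_def power_divide)
    qed
    consider "(1 + grid_dist s t) / 2 \<le> 1 + grid_dist k s" | "(1 + grid_dist s t) / 2 \<le> 1 + grid_dist k t"
      using grid_dist_triangle[of s t k] grid_dist_nonneg[of s t] by (cases "(1 + grid_dist s t) / 2 \<le> 1 + grid_dist k s") (auto simp: field_simps)
    then show ?thesis
    proof cases
      case 1
      have "u k s * u k t \<le> 32 * u s t * u k t" using half[OF 1] u0 by (intro mult_right_mono)
      also have "\<dots> \<le> 32 * u s t * (u k s + u k t)" using u0 by (intro mult_left_mono) auto
      finally show ?thesis .
    next
      case 2
      have "u k s * u k t \<le> u k s * (32 * u s t)" using half[OF 2] u0 by (intro mult_left_mono)
      also have "\<dots> \<le> 32 * u s t * (u k s + u k t)" using u0 by (simp add: algebra_simps)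
      finally show ?thesis .
    qed
  qed
  have "\<bar>(\<integral>x. X s x * X t x \<partial>PP) - (\<integral>x. X s x \<partial>PP) * (\<integral>x. X t x \<partial>PP)\<bar> \<le> 576 * A\<^sup>2 * u s t"
  proof (rule cov_le_sum_influences[OF L2(1)[OF s] L2(1)[OF t] L2(2)[OF s] L2(2)[OF t]])
    fix J :: "(int \<times> int) set" assume J: "finite J"
    have "(\<Sum>k\<in>J. A * u k s * (A * u k t)) = A\<^sup>2 * (\<Sum>k\<in>J. u k s * u k t)"
      by (simp add: sum_distrib_left power2_eq_square mult_ac)
    also have "\<dots> \<le> A\<^sup>2 * (\<Sum>k\<in>J. 32 * u s t * (u k s + u k t))"
      by (intro mult_left_mono sum_mono split) auto
    also have "\<dots> = A\<^sup>2 * (32 * u s t * ((\<Sum>k\<in>J. u k s) + (\<Sum>k\<in>J. u k t)))"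
      by (simp add: sum_distrib_left sum.distrib distrib_left)
    also have "\<dots> \<le> A\<^sup>2 * (32 * u s t * (9 + 9))"
      unfolding u_def by (intro mult_left_mono add_mono sum_grid_decay_le J) (auto simp: add_nonneg_nonneg)
    finally show "(\<Sum>k\<in>J. A * u k s * (A * u k t)) \<le> 576 * A\<^sup>2 * u s t" by simp
  qed
  then show ?thesis using mean_zero[OF s] by (simp add: u_def)
qed

text \<open>
  By the product rule, resampling the innovation at \<open>k\<close> changes the summand of the pair \<open>(s, t)\<close> by
  the sum of the effects on \<open>s\<close> and on \<open>t\<close>. Bounding one weight by \<open>\<gamma>\<close> and one kernel sum by \<open>R\<close> leaves
  the image of the other weights under the decay matrix \<open>u\<close>, which Schur's test controls in the
  space of square summable functions.
\<close>
lemma quadratic_form_concentration: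
  fixes c c' :: "int \<times> int \<Rightarrow> real" and w :: "int \<times> int \<Rightarrow> int \<times> int \<Rightarrow> real"
  assumes c: "(\<Sum>s\<in>S. (c s)\<^sup>2) \<le> 1" "(\<Sum>s\<in>S. (c' s)\<^sup>2) \<le> 1"
    and \<gamma>: "\<And>s. s \<in> S \<Longrightarrow> \<bar>c s\<bar> \<le> \<gamma>" "\<And>s. s \<in> S \<Longrightarrow> \<bar>c' s\<bar> \<le> \<gamma>" "0 \<le> \<gamma>"
    and w: "\<And>s t. 0 \<le> w s t"
    and R: "\<And>s. (\<Sum>t\<in>S. w s t) \<le> R" "\<And>t. (\<Sum>s\<in>S. w s t) \<le> R" "0 \<le> R"
  defines "Q \<equiv> \<lambda>x. \<Sum>s\<in>S. \<Sum>t\<in>S. c s * c' t * w s t * (X s x * X t x)"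
  shows "Lp_bound PP (M / 2) (\<lambda>x. Q x - (\<integral>y. Q y \<partial>PP))
    (18 * sqrt (burkholder_const (M / 2)) * (A\<^sup>2 * \<gamma> * R))"
proof -
  define p where "p = M / 2"
  have p: "2 \<le> p" "2 * p = M" using M by (auto simp: p_def)
  define u where "u = (\<lambda>k s. 1 / (1 + grid_dist k s) ^ 5)"
  have u0: "0 \<le> u k s" for k s by (simp add: u_def add_nonneg_nonneg)
  have XX: "Lp_bound PP p (\<lambda>x. X s x * X t x) (A * A)" if "s \<in> S" "t \<in> S" for s t
    using moment that p by (intro Lp_bound_mult) auto
  have dXX: "Lp_bound PP2 p (\<lambda>(x, y). X s x * X t x - X s (override_on x y {k}) * X t (override_on x y {k}))
      (A\<^sup>2 * (u k s + u k t))" if "s \<in> S" "t \<in> S" for s t k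
  proof -
    have "Lp_bound PP2 p (\<lambda>z. (\<lambda>(x, y). X s x - X s (override_on x y {k})) z * (\<lambda>(x, y). X t x) z
        + (\<lambda>(x, y). X s (override_on x y {k})) z * (\<lambda>(x, y). X t x - X t (override_on x y {k})) z)
        (A / (1 + grid_dist k s) ^ 5 * A + A * (A / (1 + grid_dist k t) ^ 5))"
      using p influence[OF that(1), of k] influence[OF that(2), of k]
        Lp_bound_override_on(2)[OF moment[OF that(1)], of "{k}"] Lp_bound_override_on(3)[OF moment[OF that(2)]]
      by (intro Lp_bound_add Lp_bound_mult) auto
    then show ?thesis by (simp add: case_prod_beta' u_def algebra_simps power2_eq_square)
  qed
  define \<Delta> where "\<Delta> = (\<lambda>k. A\<^sup>2 * \<gamma> * R * ((\<Sum>s\<in>S. \<bar>c s\<bar> * u k s) + (\<Sum>t\<in>S. \<bar>c' t\<bar> * u k t)))"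
  have Q: "Lp_bound PP p Q (\<Sum>s\<in>S. \<Sum>t\<in>S. \<bar>c s * c' t * w s t\<bar> * (A * A))"
    unfolding Q_def using p by (intro Lp_bound_sum finite_S Lp_bound_cmult XX) auto
  have dQ: "Lp_bound PP2 p (\<lambda>(x, y). Q x - Q (override_on x y {k})) (\<Delta> k)" for k
  proof -
    have "Lp_bound PP2 p (\<lambda>z. \<Sum>s\<in>S. \<Sum>t\<in>S. c s * c' t * w s t *
        (\<lambda>(x, y). X s x * X t x - X s (override_on x y {k}) * X t (override_on x y {k})) z)
        (\<Sum>s\<in>S. \<Sum>t\<in>S. \<bar>c s * c' t * w s t\<bar> * (A\<^sup>2 * (u k s + u k t)))"
      using p by (intro Lp_bound_sum finite_S Lp_bound_cmult dXX) auto
    moreover have "(\<Sum>s\<in>S. \<Sum>t\<in>S. \<bar>c s * c' t * w s t\<bar> * (A\<^sup>2 * (u k s + u k t))) \<le> \<Delta> k"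
    proof -
      have 1: "(\<Sum>s\<in>S. \<Sum>t\<in>S. \<bar>c s\<bar> * \<bar>c' t\<bar> * w s t * u k s) \<le> \<gamma> * R * (\<Sum>s\<in>S. \<bar>c s\<bar> * u k s)"
      proof -
        have "(\<Sum>s\<in>S. \<Sum>t\<in>S. \<bar>c s\<bar> * \<bar>c' t\<bar> * w s t * u k s)
            \<le> (\<Sum>s\<in>S. \<Sum>t\<in>S. \<bar>c s\<bar> * \<gamma> * w s t * u k s)"
          using \<gamma> w u0 by (intro sum_mono mult_right_mono mult_left_mono) auto
        also have "\<dots> = (\<Sum>s\<in>S. \<bar>c s\<bar> * u k s * \<gamma> * (\<Sum>t\<in>S. w s t))"
          by (simp add: sum_distrib_left mult_ac)
        also have "\<dots> \<le> (\<Sum>s\<in>S. \<bar>c s\<bar> * u k s * \<gamma> * R)"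
          using R \<gamma> u0 by (intro sum_mono mult_left_mono) auto
        finally show ?thesis by (simp add: sum_distrib_left mult_ac)
      qed
      have 2: "(\<Sum>s\<in>S. \<Sum>t\<in>S. \<bar>c s\<bar> * \<bar>c' t\<bar> * w s t * u k t) \<le> \<gamma> * R * (\<Sum>t\<in>S. \<bar>c' t\<bar> * u k t)"
      proof -
        have "(\<Sum>s\<in>S. \<Sum>t\<in>S. \<bar>c s\<bar> * \<bar>c' t\<bar> * w s t * u k t)
            \<le> (\<Sum>s\<in>S. \<Sum>t\<in>S. \<gamma> * \<bar>c' t\<bar> * w s t * u k t)"
          using \<gamma> w u0 by (intro sum_mono mult_right_mono) auto
        also have "\<dots> = (\<Sum>t\<in>S. \<bar>c' t\<bar> * u k t * \<gamma> * (\<Sum>s\<in>S. w s t))"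
          by (subst sum.swap) (simp add: sum_distrib_left mult_ac)
        also have "\<dots> \<le> (\<Sum>t\<in>S. \<bar>c' t\<bar> * u k t * \<gamma> * R)"
          using R \<gamma> u0 by (intro sum_mono mult_left_mono) auto
        finally show ?thesis by (simp add: sum_distrib_left mult_ac)
      qed
      have "(\<Sum>s\<in>S. \<Sum>t\<in>S. \<bar>c s * c' t * w s t\<bar> * (A\<^sup>2 * (u k s + u k t)))
         = (\<Sum>s\<in>S. \<Sum>t\<in>S. A\<^sup>2 * (\<bar>c s\<bar> * \<bar>c' t\<bar> * w s t * u k s) + A\<^sup>2 * (\<bar>c s\<bar> * \<bar>c' t\<bar> * w s t * u k t))"
        using w by (intro sum.cong refl) (simp add: abs_mult algebra_simps)
      also have "\<dots> = A\<^sup>2 * ((\<Sum>s\<in>S. \<Sum>t\<in>S. \<bar>c s\<bar> * \<bar>c' t\<bar> * w s t * u k s)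
          + (\<Sum>s\<in>S. \<Sum>t\<in>S. \<bar>c s\<bar> * \<bar>c' t\<bar> * w s t * u k t))"
        by (simp add: sum.distrib sum_distrib_left distrib_left)
      also have "\<dots> \<le> A\<^sup>2 * (\<gamma> * R * (\<Sum>s\<in>S. \<bar>c s\<bar> * u k s) + \<gamma> * R * (\<Sum>t\<in>S. \<bar>c' t\<bar> * u k t))"
        using 1 2 by (intro mult_left_mono add_mono) auto
      also have "\<dots> = \<Delta> k" by (simp add: \<Delta>_def algebra_simps)
      finally show ?thesis .
    qed
    ultimately have "Lp_bound PP2 p (\<lambda>z. \<Sum>s\<in>S. \<Sum>t\<in>S. c s * c' t * w s t *
        (\<lambda>(x, y). X s x * X t x - X s (override_on x y {k}) * X t (override_on x y {k})) z) (\<Delta> k)"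
      using p by (auto intro: Lp_bound_mono)
    then show ?thesis
      by (simp add: Q_def case_prod_beta' right_diff_distrib sum_subtractf)
  qed
  define B where "B = A\<^sup>2 * \<gamma> * R"
  have B: "0 \<le> B" using \<gamma> R by (simp add: B_def)
  have "Lp_bound PP p (\<lambda>x. Q x - (\<integral>y. Q y \<partial>PP)) (sqrt (burkholder_const p * (324 * B\<^sup>2)))"
  proof (rule Lp_bound_centered[OF Q p(1) dQ])
    fix J :: "(int \<times> int) set" assume J: "finite J"
    have uc: "(\<Sum>k\<in>J. u k s) \<le> 9" for s
      unfolding u_def by (rule sum_grid_decay_le[OF J]) simp
    have ur: "(\<Sum>s\<in>S. u k s) \<le> 9" for k
      using sum_grid_decay_le[OF finite_S, of 5 k] by (simp add: u_def grid_dist_commute)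
    have sq: "(\<Sum>k\<in>J. (\<Sum>s\<in>S. \<bar>d s\<bar> * u k s)\<^sup>2) \<le> 81" if "(\<Sum>s\<in>S. (d s)\<^sup>2) \<le> 1" for d
    proof -
      have "(\<Sum>k\<in>J. (\<Sum>s\<in>S. \<bar>d s\<bar> * u k s)\<^sup>2) \<le> 9\<^sup>2 * (\<Sum>s\<in>S. (d s)\<^sup>2)"
        by (rule schur_test[OF finite_S J u0 ur uc]) simp
      also have "\<dots> \<le> 9\<^sup>2 * 1" using that by (intro mult_left_mono) auto
      finally show ?thesis by simp
    qed
    have two: "(a + b)\<^sup>2 \<le> 2 * (a\<^sup>2 + b\<^sup>2)" for a b :: real
      using zero_le_power2[of "a - b"] by (simp add: power2_eq_square algebra_simps)
    have "(\<Sum>k\<in>J. (\<Delta> k)\<^sup>2) = B\<^sup>2 * (\<Sum>k\<in>J. ((\<Sum>s\<in>S. \<bar>c s\<bar> * u k s) + (\<Sum>t\<in>S. \<bar>c' t\<bar> * u k t))\<^sup>2)"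
      by (simp add: \<Delta>_def B_def[symmetric] power_mult_distrib sum_distrib_left)
    also have "\<dots> \<le> B\<^sup>2 * (\<Sum>k\<in>J. 2 * ((\<Sum>s\<in>S. \<bar>c s\<bar> * u k s)\<^sup>2 + (\<Sum>t\<in>S. \<bar>c' t\<bar> * u k t)\<^sup>2))"
      by (intro mult_left_mono sum_mono two) auto
    also have "\<dots> = B\<^sup>2 * (2 * ((\<Sum>k\<in>J. (\<Sum>s\<in>S. \<bar>c s\<bar> * u k s)\<^sup>2) + (\<Sum>k\<in>J. (\<Sum>t\<in>S. \<bar>c' t\<bar> * u k t)\<^sup>2)))"
      by (simp add: sum.distrib sum_distrib_left)
    also have "\<dots> \<le> B\<^sup>2 * (2 * (81 + 81))"
      using c by (intro mult_left_mono add_mono sq) auto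
    finally show "(\<Sum>k\<in>J. (\<Delta> k)\<^sup>2) \<le> 324 * B\<^sup>2" by simp
  qed
  moreover have "sqrt (burkholder_const p * (324 * B\<^sup>2)) = 18 * sqrt (burkholder_const p) * B"
    using B real_sqrt_abs[of 18] by (simp add: real_sqrt_mult)
  ultimately show ?thesis by (simp add: p_def B_def)
qed

text \<open>
  The distance in the bound for the kernel weight lowers the decay of the covariances from the
  fifth to the fourth power, which is still summable over the plane.
\<close>
lemma quadratic_form_bias:
  fixes c c' :: "int \<times> int \<Rightarrow> real" and w :: "int \<times> int \<Rightarrow> int \<times> int \<Rightarrow> real"
  assumes c: "(\<Sum>s\<in>S. (c s)\<^sup>2) \<le> 1" "(\<Sum>s\<in>S. (c' s)\<^sup>2) \<le> 1"
    and w: "\<And>s t. \<bar>1 - w s t\<bar> \<le> \<Lambda> * grid_dist s t" and \<Lambda>: "0 \<le> \<Lambda>"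
  shows "\<bar>(\<integral>x. (\<Sum>s\<in>S. \<Sum>t\<in>S. c s * c' t * w s t * (X s x * X t x)) \<partial>PP)
      - (\<integral>x. (\<Sum>s\<in>S. c s * X s x) * (\<Sum>t\<in>S. c' t * X t x) \<partial>PP)\<bar> \<le> 5184 * A\<^sup>2 * \<Lambda>"
proof -
  let ?r = "\<lambda>s t. \<integral>x. X s x * X t x \<partial>PP"
  have ii: "integrable PP (\<lambda>x. d * (X s x * X t x))" if "s \<in> S" "t \<in> S" for s t d
    using integrable_X_mult[OF that] by simp
  have e1: "(\<integral>x. (\<Sum>s\<in>S. \<Sum>t\<in>S. c s * c' t * w s t * (X s x * X t x)) \<partial>PP)
      = (\<Sum>s\<in>S. \<Sum>t\<in>S. c s * c' t * w s t * ?r s t)"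
    using ii by (subst Bochner_Integration.integral_sum) (auto intro!: sum.cong Bochner_Integration.integrable_sum)
  have "(\<integral>x. (\<Sum>s\<in>S. c s * X s x) * (\<Sum>t\<in>S. c' t * X t x) \<partial>PP)
      = (\<integral>x. (\<Sum>s\<in>S. \<Sum>t\<in>S. (c s * c' t) * (X s x * X t x)) \<partial>PP)"
    by (simp add: sum_product mult_ac)
  also have "\<dots> = (\<Sum>s\<in>S. \<Sum>t\<in>S. c s * c' t * ?r s t)"
    using ii by (subst Bochner_Integration.integral_sum) (auto intro!: sum.cong Bochner_Integration.integrable_sum)
  finally have e2: "(\<integral>x. (\<Sum>s\<in>S. c s * X s x) * (\<Sum>t\<in>S. c' t * X t x) \<partial>PP) = \<dots>" .
  have "\<bar>(\<Sum>s\<in>S. \<Sum>t\<in>S. c s * c' t * w s t * ?r s t) - (\<Sum>s\<in>S. \<Sum>t\<in>S. c s * c' t * ?r s t)\<bar>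
      = \<bar>\<Sum>s\<in>S. \<Sum>t\<in>S. c s * c' t * (w s t - 1) * ?r s t\<bar>"
    by (simp add: sum_subtractf[symmetric] algebra_simps)
  also have "\<dots> \<le> (\<Sum>s\<in>S. \<Sum>t\<in>S. \<bar>c s * c' t * (w s t - 1) * ?r s t\<bar>)"
    by (intro order_trans[OF sum_abs] sum_mono sum_abs)
  also have "\<dots> \<le> (\<Sum>s\<in>S. \<Sum>t\<in>S. 576 * A\<^sup>2 * \<Lambda> * (\<bar>c s\<bar> * \<bar>c' t\<bar> * (1 / (1 + grid_dist s t) ^ 4)))"
  proof (intro sum_mono)
    fix s t assume st: "s \<in> S" "t \<in> S"
    let ?g = "grid_dist s t"
    have g: "0 < 1 + ?g" by (simp add: add_pos_nonneg)
    have "\<bar>w s t - 1\<bar> * \<bar>?r s t\<bar> \<le> \<Lambda> * ?g * (576 * A\<^sup>2 / (1 + ?g) ^ 5)"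
      using w[of s t] cov_decay[OF st] \<Lambda> by (intro mult_mono) (auto simp: abs_minus_commute)
    also have "\<dots> \<le> \<Lambda> * (1 + ?g) * (576 * A\<^sup>2 / (1 + ?g) ^ 5)"
      using \<Lambda> g by (intro mult_right_mono mult_left_mono) auto
    also have "\<dots> = 576 * A\<^sup>2 * \<Lambda> * (1 / (1 + ?g) ^ 4)"
    proof -
      have "(1 + ?g) ^ 5 = (1 + ?g) * (1 + ?g) ^ 4" by (simp add: power_Suc[symmetric])
      then show ?thesis using g by simp
    qed
    finally have "\<bar>c s\<bar> * \<bar>c' t\<bar> * (\<bar>w s t - 1\<bar> * \<bar>?r s t\<bar>) \<le> \<bar>c s\<bar> * \<bar>c' t\<bar> * (576 * A\<^sup>2 * \<Lambda> * (1 / (1 + ?g) ^ 4))"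
      by (intro mult_left_mono) auto
    then show "\<bar>c s * c' t * (w s t - 1) * ?r s t\<bar> \<le> 576 * A\<^sup>2 * \<Lambda> * (\<bar>c s\<bar> * \<bar>c' t\<bar> * (1 / (1 + ?g) ^ 4))"
      by (simp add: abs_mult mult_ac)
  qed
  also have "\<dots> = 576 * A\<^sup>2 * \<Lambda> * (\<Sum>s\<in>S. \<Sum>t\<in>S. \<bar>c s\<bar> * \<bar>c' t\<bar> * (1 / (1 + grid_dist s t) ^ 4))"
    by (simp add: sum_distrib_left)
  also have "\<dots> \<le> 576 * A\<^sup>2 * \<Lambda> * 9"
  proof (intro mult_left_mono schur_bilinear[OF _ _ _ c])
    show "(\<Sum>s\<in>S. 1 / (1 + grid_dist s t) ^ 4) \<le> 9" for t
      by (rule sum_grid_decay_le[OF finite_S]) simp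
    show "(\<Sum>t\<in>S. 1 / (1 + grid_dist s t) ^ 4) \<le> 9" for s
      using sum_grid_decay_le[OF finite_S, of 4 s] by (simp add: grid_dist_commute)
  qed (use \<Lambda> in \<open>auto simp: add_nonneg_nonneg\<close>)
  finally show ?thesis unfolding e1 e2 by simp
qed

end

section \<open>Fields driven by independent innovations\<close>

lemma Lp_bound_of_Lr_norm:
  assumes "X \<in> borel_measurable P" "Lr_norm P r X \<le> ennreal c" "0 \<le> c" "0 < r"
  shows "Lp_bound P r X c"
proof -
  define I where "I = (\<integral>\<^sup>+ \<omega>. ennreal (\<bar>X \<omega>\<bar> powr r) \<partial>P)"
  have "I \<noteq> \<infinity>"
    using assms(2) by (auto simp: Lr_norm_def I_def[symmetric] Let_def top_unique)
  then obtain t where t: "I = ennreal t" "0 \<le> t" by (cases I) auto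
  then have "t powr (1 / r) \<le> c"
    using assms by (simp add: Lr_norm_def I_def[symmetric] Let_def)
  then have "(t powr (1 / r)) powr r \<le> c powr r" using assms by (intro powr_mono2) auto
  then have "t \<le> c powr r" using t assms by (simp add: powr_powr)
  then show ?thesis using assms t by (simp add: Lp_bound_def I_def[symmetric] ennreal_leI)
qed

lemma Lr_norm_le_of_Lp_bound:
  assumes "Lp_bound P r X c" "0 < r"
  shows "Lr_norm P r X \<le> ennreal c"
proof -
  define I where "I = (\<integral>\<^sup>+ \<omega>. ennreal (\<bar>X \<omega>\<bar> powr r) \<partial>P)"
  have le: "I \<le> ennreal (c powr r)" and c: "0 \<le> c" using assms by (auto simp: Lp_bound_def I_def)
  then have "I \<noteq> \<infinity>" by (auto simp: top_unique)
  then obtain t where t: "I = ennreal t" "0 \<le> t" by (cases I) auto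
  with le c have "t powr (1 / r) \<le> (c powr r) powr (1 / r)" using assms by (intro powr_mono2) auto
  also have "\<dots> = c" using assms c by (simp add: powr_powr)
  finally show ?thesis using t by (simp add: Lr_norm_def I_def[symmetric] Let_def ennreal_leI)
qed

lemma Lr_norm_cong:
  "(\<And>\<omega>. \<omega> \<in> space P \<Longrightarrow> X \<omega> = Y \<omega>) \<Longrightarrow> Lr_norm P r X = Lr_norm P r Y"
proof -
  assume "\<And>\<omega>. \<omega> \<in> space P \<Longrightarrow> X \<omega> = Y \<omega>"
  then have "(\<integral>\<^sup>+ \<omega>. ennreal (\<bar>X \<omega>\<bar> powr r) \<partial>P) = (\<integral>\<^sup>+ \<omega>. ennreal (\<bar>Y \<omega>\<bar> powr r) \<partial>P)"
    by (intro nn_integral_cong) simp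
  then show ?thesis by (simp only: Lr_norm_def)
qed

lemma ennreal_le_divide:
  assumes "ennreal w * y \<le> ennreal A" "0 < w" "0 \<le> A"
  shows "y \<le> ennreal (A / w)"
proof (cases y)
  case (real r)
  then show ?thesis using assms by (simp add: ennreal_mult[symmetric] field_simps)
next
  case top
  then show ?thesis using assms by (simp add: ennreal_mult_top top_unique)
qed

text \<open>
  Independence says that the innovations, read as one point of the product space, have the product
  of their laws as distribution. All estimates for functions on the product space thereby carry over
  to the original probability space, and those for a pair of points to its square, on which
  the dependence measure is defined.
\<close>
locale innovations = prob_space P for P :: "'w measure" +
  fixes e :: "int \<times> int \<Rightarrow> 'w \<Rightarrow> real"
  assumes indep: "indep_vars (\<lambda>_. borel) e UNIV"
begin

lemma measurable_e [measurable]: "e k \<in> borel_measurable P"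
  using indep by (cases k) (simp add: indep_vars_def)

definition law :: "int \<times> int \<Rightarrow> real measure" where "law k = distr P borel (e k)"

sublocale coordinate_product law
proof (rule coordinate_product.intro)
  show "prob_space (law i)" for i unfolding law_def by (rule prob_space_distr) (rule measurable_e)
  show "space (law i) = UNIV" for i by (simp add: law_def)
qed

definition config :: "'w \<Rightarrow> field_config" where "config \<omega> = (\<lambda>k. e k \<omega>)"

lemma sets_PP_borel: "sets PP = sets (\<Pi>\<^sub>M k\<in>UNIV. borel)"
  by (intro sets_PiM_cong) (auto simp: law_def)

lemma measurable_config [measurable]: "config \<in> measurable P PP"
  unfolding config_def
  by (rule measurable_PiM_single') (auto simp: space_N law_def)

lemma distr_config: "distr P PP config = PP"
proof -
  have "distr P (\<Pi>\<^sub>M k\<in>UNIV. borel) (\<lambda>x. \<lambda>i\<in>UNIV. e i x) = (\<Pi>\<^sub>M i\<in>UNIV. distr P borel (e i))"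
    using indep by (subst (asm) indep_vars_iff_distr_eq_PiM) auto
  moreover have "distr P PP config = distr P (\<Pi>\<^sub>M k\<in>UNIV. borel) (\<lambda>x. \<lambda>i\<in>UNIV. e i x)"
    by (rule distr_cong) (auto simp: sets_PP_borel config_def)
  ultimately show ?thesis by (simp add: law_def[abs_def])
qed

lemma distr_config_pair: "distr (P \<Otimes>\<^sub>M P) PP2 (\<lambda>(\<omega>, \<omega>'). (config \<omega>, config \<omega>')) = PP2"
proof -
  have "sigma_finite_measure (distr P PP config)"
    unfolding distr_config by (rule PP.sigma_finite_measure_axioms)
  from pair_measure_distr[OF measurable_config measurable_config this] show ?thesis
    unfolding distr_config by (rule sym)
qed

lemma Lp_bound_config:
  "f \<in> borel_measurable PP \<Longrightarrow> Lp_bound P p (\<lambda>\<omega>. f (config \<omega>)) b \<longleftrightarrow> Lp_bound PP p f b"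
  using Lp_bound_distr[OF measurable_config, of f p b] unfolding distr_config by (rule sym)

lemma integral_config:
  fixes f :: "field_config \<Rightarrow> real"
  assumes "f \<in> borel_measurable PP" shows "(\<integral>\<omega>. f (config \<omega>) \<partial>P) = (\<integral>x. f x \<partial>PP)"
  using integral_distr[OF measurable_config assms] unfolding distr_config by (rule sym)

lemma Lp_bound_config_pair:
  assumes "f \<in> borel_measurable PP2"
  shows "Lp_bound (P \<Otimes>\<^sub>M P) p (\<lambda>(\<omega>, \<omega>'). f (config \<omega>, config \<omega>')) b \<longleftrightarrow> Lp_bound PP2 p f b"
proof -
  have meas: "(\<lambda>(\<omega>, \<omega>'). (config \<omega>, config \<omega>')) \<in> measurable (P \<Otimes>\<^sub>M P) PP2"
    unfolding case_prod_beta'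
    by (intro measurable_Pair measurable_compose[OF measurable_fst measurable_config]
      measurable_compose[OF measurable_snd measurable_config])
  have "Lp_bound PP2 p f b \<longleftrightarrow> Lp_bound (distr (P \<Otimes>\<^sub>M P) PP2 (\<lambda>(\<omega>, \<omega>'). (config \<omega>, config \<omega>'))) p f b"
    by (rule arg_cong[where f = "\<lambda>R. Lp_bound R p f b"]) (rule distr_config_pair[symmetric])
  also have "\<dots> \<longleftrightarrow> Lp_bound (P \<Otimes>\<^sub>M P) p (\<lambda>z. f (case z of (\<omega>, \<omega>') \<Rightarrow> (config \<omega>, config \<omega>'))) b"
    by (rule Lp_bound_distr[OF meas assms])
  finally show ?thesis by (simp add: case_prod_beta')
qed

lemma measurable_seen_from:
  assumes "g \<in> borel_measurable (\<Pi>\<^sub>M k\<in>UNIV. borel)"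
  shows "(\<lambda>z. g (seen_from i j z)) \<in> borel_measurable PP"
proof -
  have "seen_from i j \<in> measurable (\<Pi>\<^sub>M k\<in>UNIV. borel) (\<Pi>\<^sub>M k\<in>UNIV. borel)"
  proof -
    have "seen_from i j = (\<lambda>z k. z (i - fst k, j - snd k))" by (auto simp: seen_from_def fun_eq_iff)
    moreover have "(\<lambda>z k. z (i - fst k, j - snd k)) \<in> measurable (\<Pi>\<^sub>M k\<in>UNIV. borel) (\<Pi>\<^sub>M k\<in>UNIV. borel)"
    proof (rule measurable_PiM_single')
      show "(\<lambda>z. z (i - fst k, j - snd k)) \<in> measurable (\<Pi>\<^sub>M k\<in>UNIV. borel) borel" for k
        by (rule measurable_component_singleton) simp
    qed simp
    ultimately show ?thesis by (simp only:)
  qed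
  from measurable_compose[OF this assms] show ?thesis
    unfolding measurable_cong_sets[OF sets_PP_borel refl] .
qed

text \<open>
  The estimate for a single grid size, with explicit constants. The weights \<open>c\<close> stand for the normalised
  coefficients. Subtracting the bias before taking the maximum keeps it free of the
  factor \<open>V powr (4 / M)\<close>, which only the random part incurs.
\<close>
lemma Lr_norm_max_cov_estimator_error:
  fixes G :: "int \<Rightarrow> int \<Rightarrow> field_config \<Rightarrow> real" and \<epsilon> :: "int \<Rightarrow> int \<Rightarrow> 'w \<Rightarrow> real"
    and n m V :: nat and c :: "nat \<Rightarrow> int \<Rightarrow> int \<Rightarrow> real"
  assumes M: "4 \<le> M" and \<alpha>: "5 \<le> \<alpha>" and nm: "1 \<le> n" "1 \<le> m"
    and field: "\<And>i j. i \<in> {1..int n} \<Longrightarrow> j \<in> {1..int m} \<Longrightarrow>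
       G i j \<in> borel_measurable (\<Pi>\<^sub>M k\<in>UNIV. borel) \<and>
       (\<forall>\<omega>\<in>space P. \<epsilon> i j \<omega> = G i j (seen_from i j (\<lambda>k. e k \<omega>))) \<and>
       integrable P (\<epsilon> i j) \<and> (\<integral>\<omega>. \<epsilon> i j \<omega> \<partial>P) = 0"
    and A: "0 < A"
    and mom: "(MAX (i, j) \<in> {1..int n} \<times> {1..int m}. Lr_norm P M (\<epsilon> i j)) \<le> ennreal A"
    and dep: "(SUP (p, q) \<in> UNIV. ennreal ((1 + \<bar>real_of_int p\<bar> + \<bar>real_of_int q\<bar>) powr \<alpha>)
              * dependence_measure P M e G n m p q) \<le> ennreal A"
    and V: "1 \<le> V"
    and c: "\<And>v. v \<in> {1..V} \<Longrightarrow> (\<Sum>i\<in>{1..int n}. \<Sum>j\<in>{1..int m}. (c v i j)\<^sup>2) \<le> 1"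
    and \<gamma>: "\<And>v i j. v \<in> {1..V} \<Longrightarrow> i \<in> {1..int n} \<Longrightarrow> j \<in> {1..int m} \<Longrightarrow> \<bar>c v i j\<bar> \<le> \<gamma>" "0 \<le> \<gamma>"
    and K: "variance_kernel K" and \<kappa>: "0 \<le> \<kappa>" "\<And>x. K x \<le> \<kappa> / (1 + \<bar>x\<bar>)\<^sup>2"
    and L: "0 \<le> L" "\<And>x. 1 - K x \<le> L * \<bar>x\<bar>"
    and B: "1 \<le> B"
  shows "Lr_norm P (M / 2)
      (\<lambda>\<omega>. MAX (v\<^sub>1, v\<^sub>2) \<in> {1..V} \<times> {1..V}.
         \<bar>cov_estimator n m K B (c v\<^sub>1) (c v\<^sub>2) \<epsilon> \<omega>
          - covariance P (weighted_sum n m (c v\<^sub>1) \<epsilon>) (weighted_sum n m (c v\<^sub>2) \<epsilon>)\<bar>)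
    \<le> ennreal (real V powr (4 / M) * (18 * sqrt (burkholder_const (M / 2)) * (A\<^sup>2 * \<gamma> * (3 * \<kappa> * B)\<^sup>2))
         + 5184 * A\<^sup>2 * (L / B))"
proof -
  note k = variance_kernelD[OF K]
  define S where "S = {1..int n} \<times> {1..int m}"
  define X where "X = (\<lambda>s z. G (fst s) (snd s) (seen_from (fst s) (snd s) z))"
  have S_fin: "finite S" by (simp add: S_def)
  have X_meas [measurable]: "X s \<in> borel_measurable PP" if "s \<in> S" for s
    using field that unfolding X_def by (intro measurable_seen_from) (auto simp: S_def)
  have eps: "\<epsilon> (fst s) (snd s) \<omega> = X s (config \<omega>)" if "s \<in> S" "\<omega> \<in> space P" for s \<omega>
    using field that by (auto simp: S_def X_def config_def)
  interpret grid_field law X S M A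
  proof unfold_locales
    fix s assume s: "s \<in> S"
    have "Lr_norm P M (\<epsilon> (fst s) (snd s)) \<le> (MAX (i, j) \<in> {1..int n} \<times> {1..int m}. Lr_norm P M (\<epsilon> i j))"
      using s by (intro Max_ge) (auto simp: S_def case_prod_beta')
    also have "\<dots> \<le> ennreal A" by (rule mom)
    finally have "Lr_norm P M (\<lambda>\<omega>. X s (config \<omega>)) \<le> ennreal A"
      using Lr_norm_cong[of P "\<epsilon> (fst s) (snd s)" "\<lambda>\<omega>. X s (config \<omega>)" M] eps[OF s] by simp
    then have "Lp_bound P M (\<lambda>\<omega>. X s (config \<omega>)) A"
      using A M measurable_compose[OF measurable_config X_meas[OF s]] by (intro Lp_bound_of_Lr_norm) auto
    then show "Lp_bound PP M (X s) A" using X_meas[OF s] by (simp add: Lp_bound_config)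
    have "(\<integral>x. X s x \<partial>PP) = (\<integral>\<omega>. X s (config \<omega>) \<partial>P)"
      using X_meas[OF s] by (simp add: integral_config)
    also have "\<dots> = (\<integral>\<omega>. \<epsilon> (fst s) (snd s) \<omega> \<partial>P)"
      by (intro Bochner_Integration.integral_cong) (auto simp: eps[OF s])
    also have "\<dots> = 0" using field s by (auto simp: S_def)
    finally show "(\<integral>x. X s x \<partial>PP) = 0" .
    fix k
    define p q where "p = fst k - fst s" and "q = snd k - snd s"
    define w where "w = 1 + grid_dist k s"
    have w: "1 \<le> w" by (simp add: w_def)
    have w_eq: "w = 1 + \<bar>real_of_int p\<bar> + \<bar>real_of_int q\<bar>" by (simp add: w_def grid_dist_def p_def q_def)
    let ?D = "\<lambda>(i, j). Lr_norm (P \<Otimes>\<^sub>M P) M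
          (\<lambda>(\<omega>, \<omega>'). G i j (seen_from i j (\<lambda>k. e k \<omega>))
                   - G i j (seen_from i j ((\<lambda>k. e k \<omega>)((i + p, j + q) := e (i + p, j + q) \<omega>'))))"
    \<comment> \<open>the dependence measure is indexed by the offset from the site, here it is needed for a fixed innovation\<close>
    have upd: "(\<lambda>k. e k \<omega>)((fst s + p, snd s + q) := e (fst s + p, snd s + q) \<omega>')
        = override_on (config \<omega>) (config \<omega>') {k}" for \<omega> \<omega>'
      by (auto simp: fun_eq_iff p_def q_def config_def override_on_def)
    have "?D s \<le> dependence_measure P M e G n m p q"
      unfolding dependence_measure_def using s by (intro Max_ge) (auto simp: S_def)
    then have "ennreal (w powr \<alpha>) * ?D s \<le> ennreal (w powr \<alpha>) * dependence_measure P M e G n m p q"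
      by (intro mult_left_mono) auto
    also have "\<dots> = (\<lambda>(p, q). ennreal ((1 + \<bar>real_of_int p\<bar> + \<bar>real_of_int q\<bar>) powr \<alpha>)
              * dependence_measure P M e G n m p q) (p, q)" by (simp add: w_eq)
    also have "\<dots> \<le> (SUP (p, q) \<in> UNIV. ennreal ((1 + \<bar>real_of_int p\<bar> + \<bar>real_of_int q\<bar>) powr \<alpha>)
              * dependence_measure P M e G n m p q)" by (rule SUP_upper) simp
    also have "\<dots> \<le> ennreal A" by (rule dep)
    finally have "ennreal (w powr \<alpha>) * ?D s \<le> ennreal A" .
    moreover have "w ^ 5 \<le> w powr \<alpha>"
      using powr_mono[OF \<alpha>, of w] w by simp
    then have "ennreal (w ^ 5) * ?D s \<le> ennreal (w powr \<alpha>) * ?D s"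
      by (intro mult_right_mono ennreal_leI) auto
    ultimately have "?D s \<le> ennreal (A / w ^ 5)"
      using w A by (intro ennreal_le_divide) auto
    moreover have "?D s = Lr_norm (P \<Otimes>\<^sub>M P) M
        (\<lambda>(\<omega>, \<omega>'). (\<lambda>(x, y). X s x - X s (override_on x y {k})) (config \<omega>, config \<omega>'))"
      by (simp add: case_prod_beta' X_def upd) (simp add: config_def)
    ultimately have le: "Lr_norm (P \<Otimes>\<^sub>M P) M
        (\<lambda>(\<omega>, \<omega>'). (\<lambda>(x, y). X s x - X s (override_on x y {k})) (config \<omega>, config \<omega>')) \<le> ennreal (A / w ^ 5)"
      by simp
    have m2: "(\<lambda>(x, y). X s x - X s (override_on x y {k})) \<in> borel_measurable PP2"
    proof -
      have [measurable]: "X s \<in> borel_measurable PP" by (rule X_meas[OF s])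
      show ?thesis by measurable
    qed
    have "(\<lambda>(\<omega>, \<omega>'). (config \<omega>, config \<omega>')) \<in> measurable (P \<Otimes>\<^sub>M P) PP2"
      unfolding case_prod_beta'
      by (intro measurable_Pair measurable_compose[OF measurable_fst measurable_config]
        measurable_compose[OF measurable_snd measurable_config])
    from measurable_compose[OF this m2]
    have "(\<lambda>(\<omega>, \<omega>'). (\<lambda>(x, y). X s x - X s (override_on x y {k})) (config \<omega>, config \<omega>'))
       \<in> borel_measurable (P \<Otimes>\<^sub>M P)" by (simp only: case_prod_beta' fst_conv snd_conv)
    from Lp_bound_of_Lr_norm[OF this le] have "Lp_bound (P \<Otimes>\<^sub>M P) M
        (\<lambda>(\<omega>, \<omega>'). (\<lambda>(x, y). X s x - X s (override_on x y {k})) (config \<omega>, config \<omega>')) (A / w ^ 5)"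
      using A w M by simp
    then show "Lp_bound PP2 M (\<lambda>(x, y). X s x - X s (override_on x y {k})) (A / (1 + grid_dist k s) ^ 5)"
      using Lp_bound_config_pair[OF m2] by (simp only: w_def)
  qed (use M S_fin in auto)
  define w where "w = (\<lambda>s t. K (real_of_int (fst s - fst t) / B) * K (real_of_int (snd s - snd t) / B))"
  define c' where "c' = (\<lambda>v s. c v (fst s) (snd s))"
  define Q where "Q = (\<lambda>v z. \<Sum>s\<in>S. \<Sum>t\<in>S. c' (fst v) s * c' (snd v) t * w s t * (X s z * X t z))"
  define \<Gamma> where "\<Gamma> = (\<lambda>v. \<integral>z. (\<Sum>s\<in>S. c' (fst v) s * X s z) * (\<Sum>t\<in>S. c' (snd v) t * X t z) \<partial>PP)"
  define b where "b = 18 * sqrt (burkholder_const (M / 2)) * (A\<^sup>2 * \<gamma> * (3 * \<kappa> * B)\<^sup>2)"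
  define \<beta> where "\<beta> = 5184 * A\<^sup>2 * (L / B)"
  have w0: "0 \<le> w s t" for s t using k(1) by (simp add: w_def)
  have K_sym: "K (real_of_int (i - j) / B) = K (real_of_int (j - i) / B)" for i j
    using k(3)[of "real_of_int (i - j) / B"] by (simp add: minus_divide_left)
  have w_sym: "w s t = w t s" for s t
    unfolding w_def by (simp only: K_sym[of "fst s" "fst t"] K_sym[of "snd s" "snd t"])
  have w_col: "(\<Sum>s\<in>S. w s t) \<le> (3 * \<kappa> * B)\<^sup>2" for t
  proof -
    have "(\<Sum>s\<in>S. w s t) = (\<Sum>i\<in>{1..int n}. K (real_of_int (i - fst t) / B)) * (\<Sum>j\<in>{1..int m}. K (real_of_int (j - snd t) / B))"
      by (simp add: S_def w_def sum_product sum.cartesian_product')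
    also have "\<dots> \<le> (3 * \<kappa> * B) * (3 * \<kappa> * B)"
      using \<kappa> B k(1) by (intro mult_mono kernel_row_sum) (auto intro!: sum_nonneg)
    finally show ?thesis by (simp add: power2_eq_square)
  qed
  have w_row: "(\<Sum>t\<in>S. w s t) \<le> (3 * \<kappa> * B)\<^sup>2" for s
  proof -
    have "(\<Sum>t\<in>S. w s t) = (\<Sum>t\<in>S. w t s)" by (intro sum.cong refl w_sym)
    then show ?thesis using w_col[of s] by simp
  qed
  have w_bias: "\<bar>1 - w s t\<bar> \<le> L / B * grid_dist s t" for s t
  proof -
    define u v where "u = real_of_int (fst s - fst t) / B" and "v = real_of_int (snd s - snd t) / B"
    have "K u * K v \<le> 1" using k(1,2) by (intro mult_le_one) auto
    moreover have "K u * (1 - K v) \<le> 1 * (1 - K v)" using k(1,2) by (intro mult_right_mono) auto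
    ultimately have "\<bar>1 - w s t\<bar> \<le> (1 - K u) + (1 - K v)" by (simp add: w_def u_def v_def algebra_simps)
    also have "\<dots> \<le> L * \<bar>u\<bar> + L * \<bar>v\<bar>" by (intro add_mono L)
    also have "\<dots> = L / B * grid_dist s t" using B by (simp add: u_def v_def grid_dist_def distrib_left)
    finally show ?thesis .
  qed
  have c'1: "(\<Sum>s\<in>S. (c' v s)\<^sup>2) \<le> 1" if "v \<in> {1..V}" for v
    using c[OF that] by (simp add: S_def c'_def sum.cartesian_product')
  have c'\<gamma>: "\<bar>c' v s\<bar> \<le> \<gamma>" if "v \<in> {1..V}" "s \<in> S" for v s
    using \<gamma>(1)[OF that(1)] that(2) by (auto simp: S_def c'_def)
  let ?I = "{1..V} \<times> {1..V}"
  have Q_meas [measurable]: "Q v \<in> borel_measurable PP" for v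
    unfolding Q_def by measurable
  have fluct: "Lp_bound P (M / 2) (\<lambda>\<omega>. Q v (config \<omega>) - (\<integral>z. Q v z \<partial>PP)) b" if "v \<in> ?I" for v
  proof -
    have "Lp_bound PP (M / 2) (\<lambda>z. Q v z - (\<integral>z. Q v z \<partial>PP)) b"
      unfolding Q_def b_def using that B \<kappa> \<gamma>(2)
      by (intro quadratic_form_concentration c'1 c'\<gamma> w0 w_row w_col) auto
    then show ?thesis by (subst Lp_bound_config[where f = "\<lambda>z. Q v z - (\<integral>z. Q v z \<partial>PP)"]) auto
  qed
  have bias: "\<bar>(\<integral>z. Q v z \<partial>PP) - \<Gamma> v\<bar> \<le> \<beta>" if "v \<in> ?I" for v
    unfolding Q_def \<Gamma>_def \<beta>_def using that L(1) B
    by (intro quadratic_form_bias c'1 w_bias) auto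
  have est: "cov_estimator n m K B (c v1) (c v2) \<epsilon> \<omega> = Q (v1, v2) (config \<omega>)" if "\<omega> \<in> space P" for v1 v2 \<omega>
  proof -
    have "cov_estimator n m K B (c v1) (c v2) \<epsilon> \<omega> = (\<Sum>s\<in>S. \<Sum>t\<in>S.
        c' v1 s * c' v2 t * \<epsilon> (fst s) (snd s) \<omega> * \<epsilon> (fst t) (snd t) \<omega>
        * K (real_of_int (fst s - fst t) / B) * K (real_of_int (snd s - snd t) / B))"
      by (simp add: cov_estimator_def S_def sum.cartesian_product' c'_def)
    also have "\<dots> = Q (v1, v2) (config \<omega>)"
      unfolding Q_def by (intro sum.cong refl) (simp add: eps that w_def mult_ac)
    finally show ?thesis .
  qed
  have cov: "covariance P (weighted_sum n m (c v1) \<epsilon>) (weighted_sum n m (c v2) \<epsilon>) = \<Gamma> (v1, v2)" for v1 v2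
  proof -
    have W: "weighted_sum n m (c v) \<epsilon> \<omega> = (\<Sum>s\<in>S. c' v s * X s (config \<omega>))" if "\<omega> \<in> space P" for v \<omega>
    proof -
      have "weighted_sum n m (c v) \<epsilon> \<omega> = (\<Sum>s\<in>S. c' v s * \<epsilon> (fst s) (snd s) \<omega>)"
        by (simp add: weighted_sum_def S_def sum.cartesian_product' c'_def)
      then show ?thesis using that by (simp add: eps)
    qed
    have mean: "(\<integral>\<omega>. weighted_sum n m (c v) \<epsilon> \<omega> \<partial>P) = 0" for v
    proof -
      have "(\<integral>\<omega>. weighted_sum n m (c v) \<epsilon> \<omega> \<partial>P) = (\<integral>\<omega>. (\<lambda>z. \<Sum>s\<in>S. c' v s * X s z) (config \<omega>) \<partial>P)"
        by (intro Bochner_Integration.integral_cong) (auto simp: W)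
      also have "\<dots> = (\<integral>z. (\<Sum>s\<in>S. c' v s * X s z) \<partial>PP)"
        by (rule integral_config) measurable
      also have "\<dots> = (\<Sum>s\<in>S. c' v s * (\<integral>z. X s z \<partial>PP))"
        using Lp_bound_integrable[OF prob_PP moment] M by (subst Bochner_Integration.integral_sum) auto
      finally show ?thesis by (simp add: mean_zero)
    qed
    have "covariance P (weighted_sum n m (c v1) \<epsilon>) (weighted_sum n m (c v2) \<epsilon>)
        = (\<integral>\<omega>. (\<lambda>z. (\<Sum>s\<in>S. c' v1 s * X s z) * (\<Sum>t\<in>S. c' v2 t * X t z)) (config \<omega>) \<partial>P)"
      unfolding covariance_def mean by (intro Bochner_Integration.integral_cong) (auto simp: W)
    also have "\<dots> = \<Gamma> (v1, v2)"
      unfolding \<Gamma>_def fst_conv snd_conv by (rule integral_config) measurable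
    finally show ?thesis .
  qed
  have I: "finite ?I" "?I \<noteq> {}" using V by auto
  let ?F = "\<lambda>\<omega>. MAX v\<in>?I. \<bar>Q v (config \<omega>) - (\<integral>z. Q v z \<partial>PP)\<bar>"
  have "Lp_bound P (M / 2) ?F (real (card ?I) powr (1 / (M / 2)) * b)"
    using M by (intro Lp_bound_Max[OF I] fluct) auto
  also have "real (card ?I) powr (1 / (M / 2)) = real V powr (4 / M)"
    by (simp add: powr_mult powr_add[symmetric])
  finally have F: "Lp_bound P (M / 2) ?F (real V powr (4 / M) * b)" .
  have \<beta>0: "0 \<le> \<beta>" using L B by (simp add: \<beta>_def)
  have const: "Lp_bound P (M / 2) (\<lambda>_. \<beta>) \<beta>" using \<beta>0 by (simp add: Lp_bound_def emeasure_space_1)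
  have "Lp_bound P (M / 2) (\<lambda>\<omega>. MAX v\<in>?I. \<bar>Q v (config \<omega>) - \<Gamma> v\<bar>) (real V powr (4 / M) * b + \<beta>)"
  proof (rule Lp_bound_dominated)
    show "Lp_bound P (M / 2) (\<lambda>\<omega>. ?F \<omega> + \<beta>) (real V powr (4 / M) * b + \<beta>)"
      using F const M by (intro Lp_bound_add) auto
    have [measurable]: "(\<lambda>\<omega>. Q v (config \<omega>)) \<in> borel_measurable P" for v
      by (rule measurable_compose[OF measurable_config Q_meas])
    show "(\<lambda>\<omega>. MAX v\<in>?I. \<bar>Q v (config \<omega>) - \<Gamma> v\<bar>) \<in> borel_measurable P"
      using I by (intro borel_measurable_Max) auto
    fix \<omega>
    have "\<bar>Q v (config \<omega>) - \<Gamma> v\<bar> \<le> ?F \<omega> + \<beta>" if v: "v \<in> ?I" for v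
    proof -
      have "\<bar>Q v (config \<omega>) - (\<integral>z. Q v z \<partial>PP)\<bar> \<le> ?F \<omega>" using v I by (intro Max_ge) auto
      then show ?thesis using bias[OF v] by linarith
    qed
    then have "(MAX v\<in>?I. \<bar>Q v (config \<omega>) - \<Gamma> v\<bar>) \<le> ?F \<omega> + \<beta>"
      using I by (subst Max_le_iff) auto
    moreover have "0 \<le> (MAX v\<in>?I. \<bar>Q v (config \<omega>) - \<Gamma> v\<bar>)"
      using I V by (subst Max_ge_iff) (auto intro!: bexI[of _ 1])
    ultimately show "\<bar>MAX v\<in>?I. \<bar>Q v (config \<omega>) - \<Gamma> v\<bar>\<bar> \<le> \<bar>?F \<omega> + \<beta>\<bar>" by linarith
  qed (use M in auto)
  then have "Lr_norm P (M / 2) (\<lambda>\<omega>. MAX v\<in>?I. \<bar>Q v (config \<omega>) - \<Gamma> v\<bar>) \<le> ennreal (real V powr (4 / M) * b + \<beta>)"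
    using M by (intro Lr_norm_le_of_Lp_bound) auto
  also have "Lr_norm P (M / 2) (\<lambda>\<omega>. MAX v\<in>?I. \<bar>Q v (config \<omega>) - \<Gamma> v\<bar>)
     = Lr_norm P (M / 2) (\<lambda>\<omega>. MAX (v\<^sub>1, v\<^sub>2) \<in> {1..V} \<times> {1..V}.
         \<bar>cov_estimator n m K B (c v\<^sub>1) (c v\<^sub>2) \<epsilon> \<omega>
          - covariance P (weighted_sum n m (c v\<^sub>1) \<epsilon>) (weighted_sum n m (c v\<^sub>2) \<epsilon>)\<bar>)"
    by (intro Lr_norm_cong arg_cong[where f = Max] image_cong) (auto simp: est cov)
  finally show ?thesis by (simp add: b_def \<beta>_def)
qed

end

section \<open>The rate of the covariance estimator\<close>

lemma filterlim_grid_at_top: "filterlim (\<lambda>(n, m). min n m) at_top grid_at_top"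
  unfolding grid_at_top_def by (rule filterlim_filtercomap)

text \<open>The sum is 1, or 0 when all coefficients vanish, because division by 0 gives 0.\<close>
lemma normalized_sum_squares_le: "(\<Sum>i\<in>{1..int n}. \<Sum>j\<in>{1..int m}. (normalized n m a i j)\<^sup>2) \<le> 1"
proof -
  have nn: "0 \<le> (\<Sum>i\<in>{1..int n}. \<Sum>j\<in>{1..int m}. (a i j)\<^sup>2)" by (intro sum_nonneg) auto
  have "(\<Sum>i\<in>{1..int n}. \<Sum>j\<in>{1..int m}. (normalized n m a i j)\<^sup>2)
      = (\<Sum>i\<in>{1..int n}. \<Sum>j\<in>{1..int m}. (a i j)\<^sup>2) / (weight_norm n m a)\<^sup>2"
    by (simp add: normalized_def power_divide sum_divide_distrib)
  also have "\<dots> \<le> 1" using nn by (simp add: weight_norm_def)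
  finally show ?thesis .
qed

theorem theorem2:
  fixes P :: "'w measure"
    and \<epsilon> :: "nat \<Rightarrow> nat \<Rightarrow> int \<Rightarrow> int \<Rightarrow> 'w \<Rightarrow> real"
    and M \<alpha> C :: real
    and k :: "nat \<Rightarrow> nat \<Rightarrow> int"
    and V :: "nat \<Rightarrow> nat \<Rightarrow> nat"
    and x y :: "nat \<Rightarrow> nat \<Rightarrow> nat \<Rightarrow> int"
    and a :: "nat \<Rightarrow> nat \<Rightarrow> nat \<Rightarrow> int \<Rightarrow> int \<Rightarrow> real"
    and K :: "real \<Rightarrow> real"
    and B :: "nat \<Rightarrow> nat \<Rightarrow> real"
  assumes "prob_space P"
    and "M > 4" and "\<alpha> > 5"
    and "short_range_dependent P M \<alpha> \<epsilon>"
    and "filterlim (\<lambda>(n, m). k n m) at_top grid_at_top"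
    and "((\<lambda>(n, m). real_of_int (k n m) / real n) \<longlongrightarrow> 0) grid_at_top"
    and "((\<lambda>(n, m). real_of_int (k n m) / real m) \<longlongrightarrow> 0) grid_at_top"
    and "\<forall>\<^sub>F (n, m) in grid_at_top. V n m > 0"
    and "\<forall>\<^sub>F (n, m) in grid_at_top. \<forall>v\<in>{1..V n m}.
           k n m + 1 \<le> x n m v \<and> x n m v \<le> int n - k n m \<and>
           k n m + 1 \<le> y n m v \<and> y n m v \<le> int m - k n m"
    and "C > 0"
    and "\<forall>\<^sub>F (n, m) in grid_at_top. \<forall>v\<in>{1..V n m}.
           (\<Sum>i\<in>{1..int n}. \<Sum>j\<in>{1..int m}. (a n m v i j)\<^sup>2) > 0"
    and "\<forall>\<^sub>F (n, m) in grid_at_top. \<forall>v\<in>{1..V n m}. \<exists>lam tau :: int \<Rightarrow> real.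
           (\<forall>i\<in>{1..int n}. 0 \<le> lam i \<and> \<bar>lam i\<bar> \<le> C / sqrt (real_of_int (k n m))) \<and>
           (\<forall>j\<in>{1..int m}. 0 \<le> tau j \<and> \<bar>tau j\<bar> \<le> C / sqrt (real_of_int (k n m))) \<and>
           (\<forall>i\<in>{1..int n}. \<forall>j\<in>{1..int m}.
              \<bar>a n m v i j\<bar> / weight_norm n m (a n m v) \<le> lam i * tau j) \<and>
           (\<Sum>i\<in>{1..int n}. (lam i)\<^sup>2) \<le> C \<and> (\<Sum>j\<in>{1..int m}. (tau j)\<^sup>2) \<le> C"
    and "\<forall>\<^sub>F (n, m) in grid_at_top. \<forall>v\<in>{1..V n m}. \<forall>i\<in>{1..int n}. \<forall>j\<in>{1..int m}.
           \<bar>i - x n m v\<bar> > k n m \<or> \<bar>j - y n m v\<bar> > k n m \<longrightarrow> a n m v i j = 0"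
    and "variance_kernel K"
    and "filterlim (\<lambda>(n, m). B n m) at_top grid_at_top"
    and "((\<lambda>(n, m). real (V n m) powr (4 / M) * B n m ^ 3 / real_of_int (k n m)) \<longlongrightarrow> 0) grid_at_top"
  shows "\<exists>D::real. \<forall>\<^sub>F (n, m) in grid_at_top.
           Lr_norm P (M / 2)
             (\<lambda>\<omega>. MAX (v\<^sub>1, v\<^sub>2) \<in> {1..V n m} \<times> {1..V n m}.
                \<bar>cov_estimator n m K (B n m)
                    (normalized n m (a n m v\<^sub>1)) (normalized n m (a n m v\<^sub>2)) (\<epsilon> n m) \<omega>
                 - covariance P
                    (weighted_sum n m (normalized n m (a n m v\<^sub>1)) (\<epsilon> n m))
                    (weighted_sum n m (normalized n m (a n m v\<^sub>2)) (\<epsilon> n m))\<bar>)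
           \<le> ennreal (D * (bias_rate \<alpha> (B n m)
                            + real (V n m) powr (4 / M) * B n m ^ 3 / real_of_int (k n m)))"
proof -
  note prob = assms(1) and M = assms(2) and \<alpha> = assms(3) and srd = assms(4) and k_top = assms(5)
    and V_pos = assms(8) and C = assms(10) and majorant = assms(12) and K = assms(14) and B_top = assms(15)
  interpret prob_space P by (rule prob)
  from srd obtain e G where
      indep: "indep_vars (\<lambda>_. borel) e UNIV"
    and field: "\<And>n m i j. 1 \<le> n \<Longrightarrow> 1 \<le> m \<Longrightarrow> i \<in> {1..int n} \<Longrightarrow> j \<in> {1..int m} \<Longrightarrow>
           G n m i j \<in> borel_measurable (\<Pi>\<^sub>M k\<in>UNIV. borel) \<and>
           (\<forall>\<omega>\<in>space P. \<epsilon> n m i j \<omega> = G n m i j (seen_from i j (\<lambda>k. e k \<omega>))) \<and>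
           integrable P (\<epsilon> n m i j) \<and> (\<integral>\<omega>. \<epsilon> n m i j \<omega> \<partial>P) = 0"
    and mom: "\<exists>C::real. \<forall>\<^sub>F (n, m) in grid_at_top.
           (MAX (i, j) \<in> {1..int n} \<times> {1..int m}. Lr_norm P M (\<epsilon> n m i j)) \<le> ennreal C"
    and dep: "\<exists>C::real. \<forall>\<^sub>F (n, m) in grid_at_top.
           (SUP (p, q) \<in> UNIV. ennreal ((1 + \<bar>real_of_int p\<bar> + \<bar>real_of_int q\<bar>) powr \<alpha>)
              * dependence_measure P M e (G n m) n m p q) \<le> ennreal C"
    unfolding short_range_dependent_def by blast
  from mom obtain A1 where A1: "\<forall>\<^sub>F (n, m) in grid_at_top.
           (MAX (i, j) \<in> {1..int n} \<times> {1..int m}. Lr_norm P M (\<epsilon> n m i j)) \<le> ennreal A1" by blast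
  from dep obtain A2 where A2: "\<forall>\<^sub>F (n, m) in grid_at_top.
           (SUP (p, q) \<in> UNIV. ennreal ((1 + \<bar>real_of_int p\<bar> + \<bar>real_of_int q\<bar>) powr \<alpha>)
              * dependence_measure P M e (G n m) n m p q) \<le> ennreal A2" by blast
  define A where "A = max 1 (max A1 A2)"
  have A: "0 < A" "ennreal A1 \<le> ennreal A" "ennreal A2 \<le> ennreal A"
    by (auto simp: A_def intro!: ennreal_leI)
  obtain \<kappa> where \<kappa>: "0 < \<kappa>" "\<And>x. K x \<le> \<kappa> / (1 + \<bar>x\<bar>)\<^sup>2"
    using variance_kernel_decay[OF K] by metis
  obtain L where L: "1 \<le> L" "\<And>x. 1 - K x \<le> L * \<bar>x\<bar>"
    using variance_kernel_lipschitz_at_0[OF K] by metis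
  interpret innovations P e by unfold_locales (rule indep)
  define D1 where "D1 = 18 * sqrt (burkholder_const (M / 2)) * (A\<^sup>2 * C\<^sup>2 * (3 * \<kappa>)\<^sup>2)"
  define D2 where "D2 = 5184 * A\<^sup>2 * L"
  have D: "0 \<le> D1" "0 \<le> D2"
    using M L burkholder_const_ge[of "M / 2"] by (auto simp: D1_def D2_def)
  have "\<forall>\<^sub>F z in grid_at_top. (case z of (n, m) \<Rightarrow> min n m) \<ge> 1"
    using filterlim_grid_at_top unfolding filterlim_at_top by blast
  then have ev_nm: "\<forall>\<^sub>F (n, m) in grid_at_top. 1 \<le> n \<and> 1 \<le> m"
    by eventually_elim auto
  have "\<forall>\<^sub>F z in grid_at_top. (case z of (n, m) \<Rightarrow> k n m) \<ge> 1"
    using k_top unfolding filterlim_at_top by blast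
  then have ev_k: "\<forall>\<^sub>F (n, m) in grid_at_top. 1 \<le> k n m"
    by eventually_elim auto
  \<comment> \<open>from \<open>exp 1\<close> on, \<open>ln B \<ge> 1\<close>, so that the bias rate is at least \<open>1 / B\<close> also for \<open>\<alpha> = 6\<close>\<close>
  have "\<forall>\<^sub>F z in grid_at_top. (case z of (n, m) \<Rightarrow> B n m) \<ge> exp 1"
    using B_top unfolding filterlim_at_top by blast
  then have ev_B: "\<forall>\<^sub>F (n, m) in grid_at_top. exp 1 \<le> B n m"
    by eventually_elim auto
  show ?thesis
  proof (intro exI[of _ "D1 + D2"])
    show "\<forall>\<^sub>F (n, m) in grid_at_top.
           Lr_norm P (M / 2)
             (\<lambda>\<omega>. MAX (v\<^sub>1, v\<^sub>2) \<in> {1..V n m} \<times> {1..V n m}.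
                \<bar>cov_estimator n m K (B n m)
                    (normalized n m (a n m v\<^sub>1)) (normalized n m (a n m v\<^sub>2)) (\<epsilon> n m) \<omega>
                 - covariance P
                    (weighted_sum n m (normalized n m (a n m v\<^sub>1)) (\<epsilon> n m))
                    (weighted_sum n m (normalized n m (a n m v\<^sub>2)) (\<epsilon> n m))\<bar>)
           \<le> ennreal ((D1 + D2) * (bias_rate \<alpha> (B n m)
                            + real (V n m) powr (4 / M) * B n m ^ 3 / real_of_int (k n m)))"
      using ev_nm ev_k ev_B A1 A2 V_pos majorant
    proof eventually_elim
      case (elim z)
      obtain n m where z: "z = (n, m)" by (cases z)
      have nm: "1 \<le> n" "1 \<le> m" and k: "1 \<le> k n m" and Bexp: "exp 1 \<le> B n m" and V: "1 \<le> V n m"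
        using elim by (auto simp: z)
      have B: "1 \<le> B n m" using Bexp one_le_exp_iff[of 1] by linarith
      \<comment> \<open>the product of the two bounds on \<open>lam\<close> and \<open>tau\<close>\<close>
      define \<gamma> where "\<gamma> = C\<^sup>2 / real_of_int (k n m)"
      have \<gamma>0: "0 \<le> \<gamma>" using k by (simp add: \<gamma>_def)
      have \<gamma>: "\<bar>normalized n m (a n m v) i j\<bar> \<le> \<gamma>"
        if v: "v \<in> {1..V n m}" and i: "i \<in> {1..int n}" and j: "j \<in> {1..int m}" for v i j
      proof -
        from elim v obtain lam tau :: "int \<Rightarrow> real" where
            lam: "\<And>i. i \<in> {1..int n} \<Longrightarrow> 0 \<le> lam i \<and> \<bar>lam i\<bar> \<le> C / sqrt (real_of_int (k n m))"
          and tau: "\<And>j. j \<in> {1..int m} \<Longrightarrow> 0 \<le> tau j \<and> \<bar>tau j\<bar> \<le> C / sqrt (real_of_int (k n m))"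
          and le: "\<And>i j. i \<in> {1..int n} \<Longrightarrow> j \<in> {1..int m} \<Longrightarrow>
              \<bar>a n m v i j\<bar> / weight_norm n m (a n m v) \<le> lam i * tau j"
          unfolding z by blast
        have "0 \<le> weight_norm n m (a n m v)" by (auto simp: weight_norm_def intro!: sum_nonneg)
        then have "\<bar>normalized n m (a n m v) i j\<bar> \<le> lam i * tau j"
          using le[OF i j] by (simp add: normalized_def)
        also have "\<dots> \<le> (C / sqrt (real_of_int (k n m))) * (C / sqrt (real_of_int (k n m)))"
          using lam[OF i] tau[OF j] C k by (intro mult_mono) auto
        also have "\<dots> = \<gamma>" using k by (simp add: \<gamma>_def power2_eq_square)
        finally show ?thesis .
      qed
      let ?B = "B n m" and ?V = "real (V n m) powr (4 / M)" and ?k = "real_of_int (k n m)"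
      have "Lr_norm P (M / 2)
             (\<lambda>\<omega>. MAX (v\<^sub>1, v\<^sub>2) \<in> {1..V n m} \<times> {1..V n m}.
                \<bar>cov_estimator n m K (B n m)
                    (normalized n m (a n m v\<^sub>1)) (normalized n m (a n m v\<^sub>2)) (\<epsilon> n m) \<omega>
                 - covariance P
                    (weighted_sum n m (normalized n m (a n m v\<^sub>1)) (\<epsilon> n m))
                    (weighted_sum n m (normalized n m (a n m v\<^sub>2)) (\<epsilon> n m))\<bar>)
           \<le> ennreal (?V * (18 * sqrt (burkholder_const (M / 2)) * (A\<^sup>2 * \<gamma> * (3 * \<kappa> * ?B)\<^sup>2))
                + 5184 * A\<^sup>2 * (L / ?B))"
      proof (rule Lr_norm_max_cov_estimator_error[where \<alpha> = \<alpha> and G = "G n m"])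
        show "(MAX (i, j) \<in> {1..int n} \<times> {1..int m}. Lr_norm P M (\<epsilon> n m i j)) \<le> ennreal A"
          by (rule order_trans[OF _ A(2)]) (use elim(4) in \<open>simp only: z prod.case\<close>)
        show "(SUP (p, q) \<in> UNIV. ennreal ((1 + \<bar>real_of_int p\<bar> + \<bar>real_of_int q\<bar>) powr \<alpha>)
              * dependence_measure P M e (G n m) n m p q) \<le> ennreal A"
          by (rule order_trans[OF _ A(3)]) (use elim(5) in \<open>simp only: z prod.case\<close>)
      qed (use M \<alpha> nm field A V \<gamma> \<gamma>0 K \<kappa> L B normalized_sum_squares_le in auto)
      also have "?V * (18 * sqrt (burkholder_const (M / 2)) * (A\<^sup>2 * \<gamma> * (3 * \<kappa> * ?B)\<^sup>2)) + 5184 * A\<^sup>2 * (L / ?B)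
          = D1 * (?V * ?B\<^sup>2 / ?k) + D2 * (1 / ?B)"
        by (simp add: D1_def D2_def \<gamma>_def power_mult_distrib)
      also have "ennreal \<dots> \<le> ennreal ((D1 + D2) * (bias_rate \<alpha> ?B + ?V * ?B ^ 3 / ?k))"
      proof (rule ennreal_leI)
        have "1 / ?B \<le> bias_rate \<alpha> ?B"
        proof -
          have "1 \<le> ln ?B" using Bexp B by (simp add: ln_ge_iff)
          moreover have "1 / ?B = ?B powr (- 1)" using B by (simp add: powr_minus_divide)
          moreover have "?B powr (- 1) \<le> ?B powr (5 - \<alpha>)" if "\<alpha> < 6"
            using that B by (intro powr_mono) auto
          ultimately show ?thesis using B by (auto simp: bias_rate_def divide_right_mono)
        qed
        moreover have "?V * ?B\<^sup>2 / ?k \<le> ?V * ?B ^ 3 / ?k"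
          using B k by (intro divide_right_mono mult_left_mono power_increasing) auto
        moreover have "0 \<le> 1 / ?B" "0 \<le> ?V * ?B\<^sup>2 / ?k" using B k by auto
        ultimately show "D1 * (?V * ?B\<^sup>2 / ?k) + D2 * (1 / ?B) \<le> (D1 + D2) * (bias_rate \<alpha> ?B + ?V * ?B ^ 3 / ?k)"
          using D unfolding distrib_right distrib_left
          by (smt (verit) mult_left_mono mult_nonneg_nonneg)
      qed
      finally show ?case by (simp add: z)
    qed
  qed
qed

end
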